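(* Let $\Bbbk$ be an algebraically closed field of characteristic $2$ and let $\wp,q_{22}\in\Bbbk^\times$. Let $\mathfrak{E}_{\wp}(q_{22})$ be the braided vector space with basis $x_1,x_2,x_3$ defined in the context. The Nichols algebra $\mathscr{B}(\mathfrak{E}_{\wp}(q_{22}))$ is finite-dimensional if and only if $q_{22}=1$ or $q_{22}=\omega$ with $\omega$ a primitive cubic root of unity.
   Context: A braided vector space is a pair $(V,c)$ with $c\in GL(V\otimes V)$ satisfying the braid equation. The Nichols algebra $\mathscr{B}(V)$ is the unique graded connected braided Hopf algebra quotient $\bigoplus_{n\ge0}\mathscr{B}^n(V)$ of the tensor algebra $T(V)$ whose degree-one part is $V$ and coincides with the space of primitive elements; as an algebra it depends only on the braiding $c$. Put $q_{11}=1$, $q_{12}=\wp$, $q_{21}=\wp^{-1}$. The braided vector space $\mathfrak{E}_{\wp}(q_{22})$ has basis $x_1,x_2,x_3$ and braiding, for $i\in\{1,2\}$: $c(x_i\otimes x_1)=x_1\otimes x_i$, $c(x_i\otimes x_2)=x_2\otimes x_i$, $c(x_i\otimes x_3)=q_{12}\,x_3\otimes x_i$, and $c(x_3\otimes x_1)=q_{21}\,x_1\otimes x_3$, $c(x_3\otimes x_2)=q_{21}(x_2+x_1)\otimes x_3$, $c(x_3\otimes x_3)=q_{22}\,x_3\otimes x_3$. *)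

theory Defs
  imports
    "HOL-Library.Poly_Mapping"
    "HOL-Computational_Algebra.Computational_Algebra"
begin

section \<open>Free vector spaces\<close>

text \<open>
  A vector space with basis \<open>'a\<close> over \<open>'k\<close> is rendered as the type \<open>'a \<Rightarrow>\<^sub>0 'k\<close> of finitely
  supported functions; \<open>single a 1\<close> is the basis vector \<open>a\<close>, and the tensor product of the spaces
  with bases \<open>'a\<close> and \<open>'b\<close> is the space with basis \<open>'a \<times> 'b\<close>.
\<close>

definition pm_scale :: "'k::field \<Rightarrow> ('a \<Rightarrow>\<^sub>0 'k) \<Rightarrow> ('a \<Rightarrow>\<^sub>0 'k)"
  where "pm_scale a p = Poly_Mapping.map ((*) a) p"

lemma lookup_pm_scale [simp]: "Poly_Mapping.lookup (pm_scale a p) x = a * Poly_Mapping.lookup p x"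
  unfolding pm_scale_def by transfer (simp add: when_def)

global_interpretation pm: vector_space pm_scale
  by unfold_locales (auto intro!: poly_mapping_eqI simp: lookup_add algebra_simps)

text \<open>The linear extension of a map given on the basis.\<close>

definition lin_ext :: "('a \<Rightarrow> ('b \<Rightarrow>\<^sub>0 'k)) \<Rightarrow> ('a \<Rightarrow>\<^sub>0 'k::field) \<Rightarrow> ('b \<Rightarrow>\<^sub>0 'k)"
  where "lin_ext f p = (\<Sum>x\<in>Poly_Mapping.keys p. pm_scale (Poly_Mapping.lookup p x) (f x))"

lemma lin_ext_superset:
  assumes "finite A" "Poly_Mapping.keys p \<subseteq> A"
  shows "lin_ext f p = (\<Sum>x\<in>A. pm_scale (Poly_Mapping.lookup p x) (f x))"
  unfolding lin_ext_def
  by (rule sum.mono_neutral_left) (use assms in \<open>auto simp: in_keys_iff\<close>)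

lemma lin_ext_zero [simp]: "lin_ext f 0 = 0"
  by (simp add: lin_ext_def)

lemma lin_ext_single [simp]: "lin_ext f (Poly_Mapping.single x a) = pm_scale a (f x)"
  by (simp add: lin_ext_def)

lemma lin_ext_add [simp]: "lin_ext f (p + q) = lin_ext f p + lin_ext f q"
proof -
  have fin: "finite (Poly_Mapping.keys p \<union> Poly_Mapping.keys q)" by simp
  have "lin_ext f (p + q) = (\<Sum>x\<in>Poly_Mapping.keys p \<union> Poly_Mapping.keys q. pm_scale (Poly_Mapping.lookup (p + q) x) (f x))"
    by (rule lin_ext_superset) (use keys_add[of p q] in auto)
  also have "\<dots> = lin_ext f p + lin_ext f q"
    by (simp add: lin_ext_superset[OF fin] lookup_add pm.scale_left_distrib sum.distrib)
  finally show ?thesis .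
qed

lemma lin_ext_scale [simp]: "lin_ext f (pm_scale a p) = pm_scale a (lin_ext f p)"
proof -
  have "lin_ext f (pm_scale a p) = (\<Sum>x\<in>Poly_Mapping.keys p. pm_scale (Poly_Mapping.lookup (pm_scale a p) x) (f x))"
    by (rule lin_ext_superset) (auto simp: in_keys_iff)
  then show ?thesis by (simp add: lin_ext_def pm.scale_sum_right)
qed

lemma pm_scale_single [simp]:
  "pm_scale a (Poly_Mapping.single x b) = Poly_Mapping.single x (a * b)"
  by (simp add: poly_mapping_eq_iff fun_eq_iff lookup_single when_def)


lemma lin_ext_sum [simp]: "lin_ext f (sum h A) = (\<Sum>x\<in>A. lin_ext f (h x))"
  by (induction A rule: infinite_finite_induct) auto

lemma lin_ext_lin_ext: "lin_ext g (lin_ext f r) = lin_ext (\<lambda>x. lin_ext g (f x)) r"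
  by (simp add: lin_ext_def[of f] lin_ext_def[of "\<lambda>x. lin_ext g (f x)"])

lemma lin_ext_id: "lin_ext (\<lambda>x. Poly_Mapping.single x 1) r = r"
  by (rule poly_mapping_eqI)
    (auto simp: lin_ext_def lookup_sum lookup_single when_def in_keys_iff if_distrib
      cong: if_cong)


section \<open>Braided vector spaces\<close>

text \<open>
  A linear endomorphism of \<open>V \<otimes> V\<close> is given by its values \<open>c (x, y) = c(x \<otimes> y)\<close> on the basis.
\<close>

type_synonym ('b, 'k) braiding = "'b \<times> 'b \<Rightarrow> ('b \<times> 'b \<Rightarrow>\<^sub>0 'k)"

definition braid12 :: "('b, 'k::field) braiding \<Rightarrow> ('b \<times> 'b \<times> 'b \<Rightarrow>\<^sub>0 'k) \<Rightarrow> ('b \<times> 'b \<times> 'b \<Rightarrow>\<^sub>0 'k)"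
  where "braid12 c =
    lin_ext (\<lambda>(x, y, z). lin_ext (\<lambda>(y', x'). Poly_Mapping.single (y', x', z) 1) (c (x, y)))"

definition braid23 :: "('b, 'k::field) braiding \<Rightarrow> ('b \<times> 'b \<times> 'b \<Rightarrow>\<^sub>0 'k) \<Rightarrow> ('b \<times> 'b \<times> 'b \<Rightarrow>\<^sub>0 'k)"
  where "braid23 c =
    lin_ext (\<lambda>(x, y, z). lin_ext (\<lambda>(z', y'). Poly_Mapping.single (x, z', y') 1) (c (y, z)))"

definition braided_vector_space :: "('b, 'k::field) braiding \<Rightarrow> bool"
  where "braided_vector_space c \<longleftrightarrow>
    bij (lin_ext c) \<and>
    braid12 c \<circ> braid23 c \<circ> braid12 c = braid23 c \<circ> braid12 c \<circ> braid23 c"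


section \<open>The tensor algebra\<close>

text \<open>
  Words form the free monoid under concatenation, so the convolution product of
  \<open>HOL-Library.Poly_Mapping\<close> makes \<open>'b list \<Rightarrow>\<^sub>0 'k\<close> the tensor algebra \<open>T(V)\<close> of the space \<open>V\<close> with
  basis \<open>'b\<close>: the word \<open>[x, y, \<dots>]\<close> stands for \<open>x \<otimes> y \<otimes> \<dots>\<close>.
\<close>

instantiation list :: (type) monoid_add
begin

definition zero_list :: "'a list" where "zero_list = []"
definition plus_list :: "'a list \<Rightarrow> 'a list \<Rightarrow> 'a list" where "plus_list xs ys = xs @ ys"

instance by standard (simp_all add: zero_list_def plus_list_def)

end

type_synonym ('b, 'k) tensor_algebra = "'b list \<Rightarrow>\<^sub>0 'k"
type_synonym ('b, 'k) tensor_square = "'b list \<times> 'b list \<Rightarrow>\<^sub>0 'k"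

abbreviation word :: "'b list \<Rightarrow> ('b, 'k::field) tensor_algebra"
  where "word w \<equiv> Poly_Mapping.single w 1"

definition tensor :: "('b, 'k::field) tensor_algebra \<Rightarrow> ('b, 'k) tensor_algebra \<Rightarrow> ('b, 'k) tensor_square"
  where "tensor p r = lin_ext (\<lambda>u. lin_ext (\<lambda>v. Poly_Mapping.single (u, v) 1) r) p"

text \<open>
  The braiding of \<open>T(V)\<close> induced by \<open>c\<close> is determined by
  \<open>c(x \<otimes> yu) = (y \<otimes> id) c(x' \<otimes> u)\<close> where \<open>c(x \<otimes> y) = y' \<otimes> x'\<close> (summation understood), and
  \<open>c(xu \<otimes> v) = (c \<otimes> id)(x \<otimes> c(u \<otimes> v))\<close>.
\<close>

fun braid_letter :: "('b, 'k::field) braiding \<Rightarrow> 'b \<Rightarrow> 'b list \<Rightarrow> ('b list \<times> 'b \<Rightarrow>\<^sub>0 'k)"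
  where
    "braid_letter c x [] = Poly_Mapping.single ([], x) 1"
  | "braid_letter c x (y # u) =
       lin_ext (\<lambda>(y', x').
         lin_ext (\<lambda>(u', x''). Poly_Mapping.single (y' # u', x'') 1) (braid_letter c x' u)) (c (x, y))"

fun braid_words :: "('b, 'k::field) braiding \<Rightarrow> 'b list \<Rightarrow> 'b list \<Rightarrow> ('b, 'k) tensor_square"
  where
    "braid_words c [] v = Poly_Mapping.single (v, []) 1"
  | "braid_words c (x # u) v =
       lin_ext (\<lambda>(v', u').
         lin_ext (\<lambda>(v'', x'). Poly_Mapping.single (v'', x' # u') 1) (braid_letter c x v')) (braid_words c u v)"

definition braiding_T :: "('b, 'k::field) braiding \<Rightarrow> ('b, 'k) tensor_square \<Rightarrow> ('b, 'k) tensor_square"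
  where "braiding_T c = lin_ext (\<lambda>(u, v). braid_words c u v)"

text \<open>
  The product of the braided tensor product algebra:
  \<open>(u \<otimes> v) (u' \<otimes> v') = u c(v \<otimes> u') v'\<close>.
\<close>

definition braided_mult ::
    "('b, 'k::field) braiding \<Rightarrow> ('b, 'k) tensor_square \<Rightarrow> ('b, 'k) tensor_square \<Rightarrow> ('b, 'k) tensor_square"
  where "braided_mult c P Q =
    lin_ext (\<lambda>(u, v).
      lin_ext (\<lambda>(u', v').
        lin_ext (\<lambda>(u'', v''). Poly_Mapping.single (u @ u'', v'' @ v') 1) (braid_words c v u')) Q) P"

text \<open>
  The comultiplication is the algebra map into the braided tensor square with
  \<open>\<Delta>(x) = x \<otimes> 1 + 1 \<otimes> x\<close> for \<open>x \<in> V\<close>.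
\<close>

fun comult_word :: "('b, 'k::field) braiding \<Rightarrow> 'b list \<Rightarrow> ('b, 'k) tensor_square"
  where
    "comult_word c [] = tensor 1 1"
  | "comult_word c (x # w) =
       braided_mult c (tensor (word [x]) 1 + tensor 1 (word [x])) (comult_word c w)"

definition comult :: "('b, 'k::field) braiding \<Rightarrow> ('b, 'k) tensor_algebra \<Rightarrow> ('b, 'k) tensor_square"
  where "comult c = lin_ext (comult_word c)"

definition counit :: "('b, 'k::field) tensor_algebra \<Rightarrow> 'k"
  where "counit p = Poly_Mapping.lookup p []"

definition component :: "nat \<Rightarrow> ('b, 'k::field) tensor_algebra \<Rightarrow> ('b, 'k) tensor_algebra"
  where "component n = lin_ext (\<lambda>w. if length w = n then word w else 0)"

definition homogeneous :: "nat \<Rightarrow> ('b, 'k::field) tensor_algebra set"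
  where "homogeneous n = {p. \<forall>w\<in>Poly_Mapping.keys p. length w = n}"


section \<open>Nichols algebras\<close>

definition two_sided_ideal :: "('b, 'k::field) tensor_algebra set \<Rightarrow> bool"
  where "two_sided_ideal J \<longleftrightarrow>
    pm.subspace J \<and> (\<forall>y\<in>J. \<forall>t. t * y \<in> J \<and> y * t \<in> J)"

text \<open>\<open>J \<otimes> T(V) + T(V) \<otimes> J\<close>, the kernel of \<open>T(V) \<otimes> T(V) \<rightarrow> T(V)/J \<otimes> T(V)/J\<close>.\<close>

definition tensor_kernel :: "('b, 'k::field) tensor_algebra set \<Rightarrow> ('b, 'k) tensor_square set"
  where "tensor_kernel J = pm.span ({tensor y t |y t. y \<in> J} \<union> {tensor t y |t y. y \<in> J})"

text \<open>
  \<open>T(V)/J\<close> has an antipode: a linear endomorphism of \<open>T(V)/J\<close> is the same as a linear endomorphism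
  \<open>S\<close> of \<open>T(V)\<close> preserving \<open>J\<close>, taken modulo \<open>J\<close>.
\<close>

definition quotient_has_antipode :: "('b, 'k::field) braiding \<Rightarrow> ('b, 'k) tensor_algebra set \<Rightarrow> bool"
  where "quotient_has_antipode c J \<longleftrightarrow>
    (\<exists>S. Vector_Spaces.linear pm_scale pm_scale S \<and> S ` J \<subseteq> J \<and>
      (\<forall>p. lin_ext (\<lambda>(u, v). S (word u) * word v) (comult c p) - pm_scale (counit p) 1 \<in> J \<and>
           lin_ext (\<lambda>(u, v). word u * S (word v)) (comult c p) - pm_scale (counit p) 1 \<in> J))"

text \<open>
  The structure of \<open>T(V)\<close> descends to make \<open>T(V)/J\<close> a graded braided Hopf algebra. The condition
  on \<open>braiding_T\<close> says that \<open>c\<close> induces a well-defined automorphism of \<open>T(V)/J \<otimes> T(V)/J\<close>.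
\<close>

definition graded_braided_Hopf_ideal :: "('b, 'k::field) braiding \<Rightarrow> ('b, 'k) tensor_algebra set \<Rightarrow> bool"
  where "graded_braided_Hopf_ideal c J \<longleftrightarrow>
    two_sided_ideal J \<and>
    (\<forall>y\<in>J. \<forall>n. component n y \<in> J) \<and>
    comult c ` J \<subseteq> tensor_kernel J \<and>
    (\<forall>y\<in>J. counit y = 0) \<and>
    braiding_T c ` tensor_kernel J = tensor_kernel J \<and>
    quotient_has_antipode c J"

text \<open>The preimage in \<open>T(V)\<close> of the space of primitive elements of \<open>T(V)/J\<close>.\<close>

definition primitive_mod ::
    "('b, 'k::field) braiding \<Rightarrow> ('b, 'k) tensor_algebra set \<Rightarrow> ('b, 'k) tensor_algebra set"
  where "primitive_mod c J = {p. comult c p - tensor p 1 - tensor 1 p \<in> tensor_kernel J}"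

text \<open>
  \<open>nichols_ideal c J\<close> says that \<open>T(V)/J\<close> is the Nichols algebra of \<open>(V, c)\<close>: it is a graded braided
  Hopf algebra quotient of \<open>T(V)\<close>, connected (its degree \<open>0\<close> part is the ground field), with degree
  \<open>1\<close> part \<open>V\<close>, and its space of primitive elements is the image of \<open>V\<close>. Such a \<open>J\<close> exists and is
  unique for every braided vector space.
\<close>

definition nichols_ideal :: "('b, 'k::field) braiding \<Rightarrow> ('b, 'k) tensor_algebra set \<Rightarrow> bool"
  where "nichols_ideal c J \<longleftrightarrow>
    graded_braided_Hopf_ideal c J \<and>
    J \<inter> homogeneous 0 = {0} \<and>
    J \<inter> homogeneous 1 = {0} \<and>
    primitive_mod c J = {v + y |v y. v \<in> homogeneous 1 \<and> y \<in> J}"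

text \<open>\<open>T(V)/J\<close> is spanned by the classes of finitely many elements.\<close>

definition finite_dimensional_quotient :: "('b, 'k::field) tensor_algebra set \<Rightarrow> bool"
  where "finite_dimensional_quotient J \<longleftrightarrow> (\<exists>B. finite B \<and> pm.span (B \<union> J) = UNIV)"


section \<open>The braided vector space \<open>\<EE>\<^sub>\<wp>(q\<^sub>2\<^sub>2)\<close>\<close>

datatype basis3 = X1 | X2 | X3

text \<open>The parameters are \<open>p = \<wp> = q\<^sub>1\<^sub>2\<close>, with \<open>q\<^sub>2\<^sub>1 = inverse p\<close> and \<open>q\<^sub>1\<^sub>1 = 1\<close>, and \<open>q = q\<^sub>2\<^sub>2\<close>.\<close>

fun endymion :: "'k::field \<Rightarrow> 'k \<Rightarrow> (basis3, 'k) braiding"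
  where
    "endymion p q (X1, X1) = Poly_Mapping.single (X1, X1) 1"
  | "endymion p q (X1, X2) = Poly_Mapping.single (X2, X1) 1"
  | "endymion p q (X1, X3) = Poly_Mapping.single (X3, X1) p"
  | "endymion p q (X2, X1) = Poly_Mapping.single (X1, X2) 1"
  | "endymion p q (X2, X2) = Poly_Mapping.single (X2, X2) 1"
  | "endymion p q (X2, X3) = Poly_Mapping.single (X3, X2) p"
  | "endymion p q (X3, X1) = Poly_Mapping.single (X1, X3) (inverse p)"
  | "endymion p q (X3, X2) =
       Poly_Mapping.single (X2, X3) (inverse p) + Poly_Mapping.single (X1, X3) (inverse p)"
  | "endymion p q (X3, X3) = Poly_Mapping.single (X3, X3) q"

lemma braided_vector_space_endymion:
  fixes p q :: "'k::field"
  assumes "p \<noteq> 0" "q \<noteq> 0"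
  shows "braided_vector_space (endymion p q)"
proof -
  define d :: "(basis3, 'k) braiding" where "d = (\<lambda>(x, y).
    if (x, y) = (X2, X3)
    then Poly_Mapping.single (X3, X2) p + Poly_Mapping.single (X3, X1) (- p)
    else if (x, y) = (X1, X3) then Poly_Mapping.single (X3, X1) p
    else if (x, y) = (X3, X3) then Poly_Mapping.single (X3, X3) (inverse q)
    else if x = X3 then Poly_Mapping.single (y, X3) (inverse p)
    else Poly_Mapping.single (y, x) 1)"
  have 1: "lin_ext (endymion p q) (d z) = Poly_Mapping.single z 1" for z
    using assms
    by (cases z; cases "fst z"; cases "snd z")
      (auto simp: d_def pm.scale_right_distrib add_ac simp flip: single_add)
  have 2: "lin_ext d (endymion p q z) = Poly_Mapping.single z 1" for z
    using assms
    by (cases z; cases "fst z"; cases "snd z")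
      (auto simp: d_def pm.scale_right_distrib add_ac simp flip: single_add)
  have bij: "bij (lin_ext (endymion p q))"
    by (rule bij_betw_byWitness[where f' = "lin_ext d"]) (auto simp: lin_ext_lin_ext 1 2 lin_ext_id)
  let ?A = "braid12 (endymion p q)" and ?B = "braid23 (endymion p q)"
  have A: "?A (lin_ext f r) = lin_ext (\<lambda>x. ?A (f x)) r" "?A r' = lin_ext (\<lambda>x. ?A (Poly_Mapping.single x 1)) r'"
    and B: "?B (lin_ext f r) = lin_ext (\<lambda>x. ?B (f x)) r" "?B r' = lin_ext (\<lambda>x. ?B (Poly_Mapping.single x 1)) r'"
    for f r r'
    by (simp_all add: braid12_def braid23_def lin_ext_lin_ext)
  have basis: "?A (?B (?A (Poly_Mapping.single w 1))) = ?B (?A (?B (Poly_Mapping.single w 1)))" for w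
  proof -
    obtain x y z where "w = (x, y, z)" by (cases w)
    then show ?thesis
      by (cases x; cases y; cases z)
        (simp_all add: braid12_def braid23_def pm.scale_right_distrib add_ac mult_ac)
  qed
  have "?A (?B (?A r)) = ?B (?A (?B r))" for r
  proof -
    have "?A (?B (?A r)) = lin_ext (\<lambda>w. ?A (?B (?A (Poly_Mapping.single w 1)))) r"
      by (subst A(2)) (simp only: A(1) B(1))
    also have "\<dots> = lin_ext (\<lambda>w. ?B (?A (?B (Poly_Mapping.single w 1)))) r"
      by (simp only: basis)
    also have "\<dots> = ?B (?A (?B r))"
      by (subst (4) B(2)) (simp only: A(1) B(1))
    finally show ?thesis .
  qed
  then show ?thesis using bij by (simp add: braided_vector_space_def fun_eq_iff)
qed

text \<open>\<open>\<omega>\<close> is a primitive \<open>n\<close>-th root of unity.\<close>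

definition primitive_root_of_unity :: "nat \<Rightarrow> 'k::field \<Rightarrow> bool"
  where "primitive_root_of_unity n \<omega> \<longleftrightarrow> n > 0 \<and> \<omega> ^ n = 1 \<and> (\<forall>m. 0 < m \<and> m < n \<longrightarrow> \<omega> ^ m \<noteq> 1)"

end

theory Submission
  imports Defs
begin

text \<open>
  Since \<open>c(x\<^sub>i \<otimes> y) = g\<^sub>i(y) \<otimes> x\<^sub>i\<close> for automorphisms \<open>g\<^sub>i\<close> of \<open>T(V)\<close>, there are right skew derivations
  \<open>\<partial>\<^sub>i\<close> of \<open>T(V)\<close>, and \<open>t\<close> lies in the Nichols ideal \<open>J\<close> iff all iterated derivatives of \<open>t\<close> have counit
  zero. Put \<open>x = x\<^sub>3\<close> and \<open>y = x\<^sub>2 x\<^sub>3 - \<wp> x\<^sub>3 x\<^sub>2\<close>. The quotient \<open>T(V)/J\<close> is a finite module over its subalgebra \<open>A\<close>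
  generated by \<open>x\<close> and \<open>y\<close>, and \<open>A\<close> is, up to a twist removing \<open>\<wp>\<close>, the Nichols algebra of the braiding
  \<open>q\<close> times the flip on a plane. So the question is whether \<open>A\<close> is finite-dimensional.

  If \<open>q = 1\<close>, then \<open>A\<close> is commutative with \<open>x\<^sup>2 = y\<^sup>2 = 0\<close>; if \<open>q\<close> is not a root of unity, no power of \<open>x\<close>
  vanishes. Otherwise let \<open>N \<ge> 3\<close> be the order of \<open>q\<close>. Then \<open>A = K \<otimes> k[x]/(x\<^sup>N)\<close>, where \<open>K\<close>, the kernel of the
  derivation along \<open>x\<close>, is generated by \<open>z\<^sub>i = (ad x)\<^sup>i(y)\<close> for \<open>i \<le> N - 2\<close>. The canonical pairing of
  words in the \<open>z\<^sub>i\<close> is symmetric up to nonzero factors and the exchange of \<open>z\<^sub>i\<close> with \<open>z\<close> of index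
  \<open>N - 2 - i\<close>, so the bidegrees of \<open>K\<close> are stable under \<open>(i, b) \<mapsto> ((N - 2) b - i, b)\<close>. Those of \<open>A\<close> are
  stable under \<open>(a, b) \<mapsto> (b, a)\<close>. For \<open>N = 3\<close> the two symmetries bound the bidegrees of \<open>A\<close>; for
  \<open>N \<ge> 4\<close> they are incompatible with the existence of a bidegree maximising \<open>a + b\<close>.
\<close>

text \<open>The summand \<open>x1 \<otimes> x3\<close> in \<open>c(x3 \<otimes> x2)\<close> is the
  source of the plane: \<open>w1 = x2 x3 - p x3 x2\<close> has derivative \<open>x1\<close> along
  \<open>x3\<close> and 0 along the others. So in the derivative along \<open>x3\<close> of an
  element of A, the part without \<open>x1\<close> is the derivative along x, and the coefficient of
  \<open>x1\<close> is the derivative along y. Characteristic 2 enters mainly because letters with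
  self-braiding 1 square to zero and because q cannot have order 2.

  Elements are stored as functions on words (differentiate, then take the counit). Such a function
  vanishes iff the element is zero in the Nichols algebra, so no quotient and no basis has to be
  built; only the bidegrees that occur are compared.

  The exchange of indices \<open>i\<close> and \<open>N - 2 - i\<close> comes from
  \<open>q ^ N = 1\<close>: z_i has degree \<open>i + 1\<close>, so the degrees of the two letters
  add up to \<open>N\<close>. The operators D_j send index \<open>j - 1\<close> to \<open>j\<close>
  on one side of the pairing while the adjoint action raises indices on the other; the exchange
  carries one operation into the other.\<close>

definition fun_linear :: "(('a \<Rightarrow> 'k::field) \<Rightarrow> 'b \<Rightarrow> 'k) \<Rightarrow> bool"
  where "fun_linear T \<longleftrightarrow>
    (\<forall>f g. T (\<lambda>v. f v + g v) = (\<lambda>v. T f v + T g v)) \<and>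
    (\<forall>c f. T (\<lambda>v. c * f v) = (\<lambda>v. c * T f v))"

lemma fun_linearI:
  assumes "\<And>f g v. T (\<lambda>v. f v + g v) v = T f v + T g v"
    and "\<And>c f v. T (\<lambda>v. c * f v) v = c * T f v"
  shows "fun_linear T"
  using assms by (auto simp: fun_linear_def)

lemma fun_linear_add: "fun_linear T \<Longrightarrow> T (\<lambda>v. f v + g v) v = T f v + T g v"
  and fun_linear_scale: "fun_linear T \<Longrightarrow> T (\<lambda>v. c * f v) v = c * T f v"
  by (auto simp: fun_linear_def)

lemma fun_linear_zero: "fun_linear T \<Longrightarrow> T (\<lambda>v. 0) v = 0"
  using fun_linear_scale[of T 0 "\<lambda>v. 0"] by simp

lemma fun_linearD:
  assumes "fun_linear T"
  shows "T (\<lambda>v. f v + g v) = (\<lambda>v. T f v + T g v)" "T (\<lambda>v. c * f v) = (\<lambda>v. c * T f v)" "T (\<lambda>v. 0) = (\<lambda>v. 0)"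
  using assms fun_linear_zero[OF assms] by (auto simp: fun_linear_def)

lemma fun_linear_funpow:
  fixes T :: "('a \<Rightarrow> 'k::field) \<Rightarrow> 'a \<Rightarrow> 'k"
  assumes "fun_linear T"
  shows "fun_linear (T ^^ n)"
proof (induction n)
  case 0
  then show ?case by (simp add: fun_linear_def)
next
  case (Suc n)
  then show ?case using assms by (simp add: fun_linear_def)
qed

lemma fun_linear_sum:
  assumes "fun_linear T"
  shows "T (\<lambda>v. \<Sum>x\<in>A. f x v) v = (\<Sum>x\<in>A. T (f x) v)"
  using fun_linear_zero[OF assms] fun_linear_add[OF assms]
  by (induction A rule: infinite_finite_induct) auto

definition unit_fun :: "'a list \<Rightarrow> 'k::field"
  where "unit_fun v = (if v = [] then 1 else 0)"

lemma unit_fun_simps [simp]: "unit_fun [] = 1" "unit_fun (x # v) = 0"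
  by (simp_all add: unit_fun_def)

text \<open>The letter \<open>j\<close> stands for an element of total degree \<open>j + 1\<close>,
  or for an operator lowering that degree by \<open>j + 1\<close>.\<close>

definition wdeg :: "nat list \<Rightarrow> nat"
  where "wdeg v = sum_list v + length v"

lemma wdeg_simps [simp]: "wdeg [] = 0" "wdeg (j # v) = Suc j + wdeg v"
  by (simp_all add: wdeg_def)

section \<open>The Nichols algebra of a scaled flip\<close>

locale qparam =
  fixes q :: "'k::field"
begin

text \<open>
  An element \<open>f\<close> of the Nichols algebra of \<open>q\<close> times the flip on the plane with basis \<open>x\<close> (\<open>False\<close>) and
  \<open>y\<close> (\<open>True\<close>) is encoded by the function sending a word to the counit of the iterated derivative of
  \<open>f\<close> along it, first letter first. Then \<open>letter_mult\<close> is left multiplication by a letter.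
\<close>

fun letter_mult :: "bool \<Rightarrow> (bool list \<Rightarrow> 'k) \<Rightarrow> bool list \<Rightarrow> 'k"
  where
    "letter_mult j f [] = 0"
  | "letter_mult j f (i # v) = letter_mult j (\<lambda>v. f (i # v)) v + (if i = j then q ^ length v * f v else 0)"

fun shuffle_word :: "bool list \<Rightarrow> bool list \<Rightarrow> 'k"
  where
    "shuffle_word [] = unit_fun"
  | "shuffle_word (j # u) = letter_mult j (shuffle_word u)"

lemma fun_linear_letter_mult: "fun_linear (letter_mult j)"
proof (rule fun_linearI)
  show "letter_mult j (\<lambda>v. f v + g v) v = letter_mult j f v + letter_mult j g v" for f g v
    by (induction v arbitrary: f g) (auto simp: algebra_simps)
  show "letter_mult j (\<lambda>v. c * f v) v = c * letter_mult j f v" for c f v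
    by (induction v arbitrary: f) (auto simp: algebra_simps)
qed

lemmas letter_mult_add = fun_linear_add[OF fun_linear_letter_mult]
  and letter_mult_scale = fun_linear_scale[OF fun_linear_letter_mult]
  and letter_mult_zero = fun_linear_zero[OF fun_linear_letter_mult]

lemma letter_mult_map_Not: "letter_mult (\<not> j) f (map Not v) = letter_mult j (\<lambda>v. f (map Not v)) v"
  by (induction v arbitrary: f) auto

text \<open>The braiding is the same scalar times the flip on all pairs of letters, so exchanging x
  and y is an automorphism.\<close>

lemma shuffle_word_map_Not: "shuffle_word (map Not u) (map Not v) = shuffle_word u v"
proof (induction u arbitrary: v)
  case Nil
  then show ?case by (cases v) auto
next
  case (Cons a u)
  then show ?case by (simp add: letter_mult_map_Not)
qed

text \<open>
  For \<open>k\<close> in the kernel \<open>K\<close> of the derivation along \<open>x\<close>, write the derivative along \<open>y\<close> as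
  \<open>\<Sum>j. D\<^sub>j(k) x\<^sup>j\<close> with \<open>D\<^sub>j(k) \<in> K\<close>; then \<open>k\<close> is encoded by the function sending \<open>[j, l, \<dots>]\<close> to the
  counit of \<open>\<dots> D\<^sub>l (D\<^sub>j k)\<close>. In this encoding \<open>raise\<close> is the braided adjoint action of \<open>x\<close> and \<open>zmul i\<close> is left
  multiplication by \<open>z\<^sub>i\<close>, an element of total degree \<open>i + 1\<close>.
\<close>

fun raise :: "(nat list \<Rightarrow> 'k) \<Rightarrow> nat list \<Rightarrow> 'k"
  where
    "raise f [] = 0"
  | "raise f (j # v) = raise (\<lambda>v. f (j # v)) v +
       (if j = 0 then 0 else q ^ wdeg v * (1 - q ^ Suc j) * f ((j - 1) # v))"

fun zmul0 :: "(nat list \<Rightarrow> 'k) \<Rightarrow> nat list \<Rightarrow> 'k"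
  where
    "zmul0 f [] = 0"
  | "zmul0 f (j # v) = zmul0 (\<lambda>v. f (j # v)) v + (if j = 0 then q ^ wdeg v * f v else 0)"

fun zmul :: "nat \<Rightarrow> (nat list \<Rightarrow> 'k) \<Rightarrow> nat list \<Rightarrow> 'k"
  where
    "zmul 0 f = zmul0 f"
  | "zmul (Suc i) f = (\<lambda>v. raise (zmul i f) v - q ^ Suc i * zmul i (raise f) v)"

text \<open>The automorphism acting by \<open>q ^ n\<close> in degree \<open>n\<close>, through
  which x and y braid with homogeneous elements.\<close>

definition qdeg :: "(nat list \<Rightarrow> 'k) \<Rightarrow> nat list \<Rightarrow> 'k"
  where "qdeg f v = q ^ wdeg v * f v"

lemma fun_linear_raise: "fun_linear raise"
proof (rule fun_linearI)
  show "raise (\<lambda>v. f v + g v) v = raise f v + raise g v" for f g v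
    by (induction v arbitrary: f g) (auto simp: algebra_simps)
  show "raise (\<lambda>v. c * f v) v = c * raise f v" for c f v
    by (induction v arbitrary: f) (auto simp: algebra_simps)
qed

lemma fun_linear_zmul0: "fun_linear zmul0"
proof (rule fun_linearI)
  show "zmul0 (\<lambda>v. f v + g v) v = zmul0 f v + zmul0 g v" for f g v
    by (induction v arbitrary: f g) (auto simp: algebra_simps)
  show "zmul0 (\<lambda>v. c * f v) v = c * zmul0 f v" for c f v
    by (induction v arbitrary: f) (auto simp: algebra_simps)
qed

lemma fun_linear_zmul: "fun_linear (zmul i)"
proof (induction i)
  case 0
  then show ?case using fun_linear_zmul0 by (simp add: fun_linear_def)
next
  case (Suc i)
  show ?case
  proof (rule fun_linearI)
    have r: "raise (\<lambda>v. f v + g v) = (\<lambda>v. raise f v + raise g v)"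
      "raise (\<lambda>v. c * f v) = (\<lambda>v. c * raise f v)" for f g c
      using fun_linear_raise by (auto simp: fun_linear_def)
    have z: "zmul i (\<lambda>v. f v + g v) = (\<lambda>v. zmul i f v + zmul i g v)"
      "zmul i (\<lambda>v. c * f v) = (\<lambda>v. c * zmul i f v)" for f g c
      using Suc by (auto simp: fun_linear_def)
    show "zmul (Suc i) (\<lambda>v. f v + g v) v = zmul (Suc i) f v + zmul (Suc i) g v" for f g v
      by (simp add: r z algebra_simps)
    show "zmul (Suc i) (\<lambda>v. c * f v) v = c * zmul (Suc i) f v" for c f v
      by (simp add: r z algebra_simps)
  qed
qed

lemma fun_linear_qdeg: "fun_linear qdeg"
  by (rule fun_linearI) (simp_all add: qdeg_def algebra_simps)

lemmas raise_add = fun_linear_add[OF fun_linear_raise]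
  and raise_scale = fun_linear_scale[OF fun_linear_raise]
  and raise_zero = fun_linear_zero[OF fun_linear_raise]
  and zmul_add = fun_linear_add[OF fun_linear_zmul]
  and zmul_scale = fun_linear_scale[OF fun_linear_zmul]
  and zmul_zero = fun_linear_zero[OF fun_linear_zmul]

lemma qdeg_raise: "qdeg (raise f) v = q * raise (qdeg f) v"
proof -
  have "q ^ wdeg v * raise f v = q * raise (\<lambda>v. q ^ wdeg v * f v) v"
  proof (induction v arbitrary: f)
    case (Cons j v)
    have "raise (\<lambda>v. q ^ wdeg (j # v) * f (j # v)) v = q ^ Suc j * raise (\<lambda>v. q ^ wdeg v * f (j # v)) v"
      by (simp add: power_add mult.assoc flip: raise_scale)
    then show ?case using Cons[of "\<lambda>v. f (j # v)"]
      by (cases j) (simp_all add: algebra_simps power_add)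
  qed simp
  then show ?thesis by (simp add: qdeg_def[abs_def])
qed

lemma qdeg_zmul0: "qdeg (zmul0 f) v = q * zmul0 (qdeg f) v"
proof -
  have "q ^ wdeg v * zmul0 f v = q * zmul0 (\<lambda>v. q ^ wdeg v * f v) v"
  proof (induction v arbitrary: f)
    case (Cons j v)
    have "zmul0 (\<lambda>v. q ^ wdeg (j # v) * f (j # v)) v = q ^ Suc j * zmul0 (\<lambda>v. q ^ wdeg v * f (j # v)) v"
      by (simp add: power_add mult.assoc flip: fun_linear_scale[OF fun_linear_zmul0])
    then show ?case using Cons[of "\<lambda>v. f (j # v)"]
      by (cases j) (simp_all add: algebra_simps power_add)
  qed simp
  then show ?thesis by (simp add: qdeg_def[abs_def])
qed

lemma qdeg_raise_fun: "qdeg (raise f) = (\<lambda>v. q * raise (qdeg f) v)"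
  by (rule ext) (rule qdeg_raise)

lemma qdeg_zmul: "qdeg (zmul i f) v = q ^ Suc i * zmul i (qdeg f) v"
proof (induction i arbitrary: f v)
  case 0
  then show ?case by (simp add: qdeg_zmul0)
next
  case (Suc i)
  have "qdeg (zmul (Suc i) f) v = qdeg (raise (zmul i f)) v - q ^ Suc i * qdeg (zmul i (raise f)) v"
    by (simp add: qdeg_def algebra_simps)
  also have "\<dots> = q * raise (\<lambda>v. q ^ Suc i * zmul i (qdeg f) v) v - q ^ Suc i * (q ^ Suc i * zmul i (\<lambda>v. q * raise (qdeg f) v) v)"
    by (simp add: qdeg_raise Suc[abs_def] qdeg_raise_fun)
  also have "\<dots> = q ^ Suc (Suc i) * zmul (Suc i) (qdeg f) v"
    by (simp add: raise_scale zmul_scale algebra_simps)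
  finally show ?case .
qed

lemma raise_zmul: "raise (zmul i f) v = zmul (Suc i) f v + q ^ Suc i * zmul i (raise f) v"
  by simp

lemma raise_unit [simp]: "raise unit_fun = (\<lambda>v. 0)"
proof
  fix v show "raise unit_fun v = 0" by (cases v) (auto simp: raise_zero)
qed

lemma qdeg_unit [simp]: "qdeg unit_fun = unit_fun"
  by (auto simp: qdeg_def unit_fun_def)

section \<open>Structure constants for differentiating products with z_i\<close>

definition qpoch :: "nat \<Rightarrow> 'k" where "qpoch n = (\<Prod>k=1..n. 1 - q ^ k)"

lemma qpoch_simps [simp]: "qpoch 0 = 1" "qpoch (Suc n) = qpoch n * (1 - q ^ Suc n)"
  by (simp_all add: qpoch_def)

text \<open>\<open>qpoch (Suc i) / (1 - q)\<close> times the Gaussian binomial coefficient of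
  \<open>i\<close> over \<open>j\<close>. The first factor is the coefficient of
  \<open>x ^ i\<close> in the derivative of z_i along y; the second comes from moving
  \<open>x ^ i\<close> past an element of K.\<close>

definition acoef :: "nat \<Rightarrow> nat \<Rightarrow> 'k"
  where "acoef i j = (if j \<le> i then qpoch (Suc i) * qpoch i / ((1 - q) * qpoch j * qpoch (i - j)) else 0)"

lemma acoef_gt: "i < j \<Longrightarrow> acoef i j = 0"
  by (simp add: acoef_def)

end

locale qroot = qparam q for q :: "'k::field" +
  fixes N :: nat
  assumes qN: "q ^ N = 1" and N3: "N \<ge> 3" and q_less: "\<And>k. 0 < k \<Longrightarrow> k < N \<Longrightarrow> q ^ k \<noteq> 1"
begin

lemma q_nz: "q \<noteq> 0"
  using qN N3 by (auto simp: power_0_left)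

lemma qpoch_nz: "n < N \<Longrightarrow> qpoch n \<noteq> 0"
proof (induction n)
  case (Suc n)
  then show ?case using q_less[of "Suc n"] by auto
qed simp

lemma acoef_0: "acoef 0 j = (if j = 0 then 1 else 0)"
  using q_less[of 1] N3 by (simp add: acoef_def)

text \<open>A variant of the Pascal rule: this is what the recursion for \<open>zmul (Suc i)\<close>
  demands of the coefficients in \<open>zmul_Cons\<close>.\<close>

lemma acoef_Suc:
  assumes "Suc i < N"
  shows "acoef (Suc i) j = (1 - q ^ (i + j + 2)) * acoef i j
    + (if j = 0 then 0 else (1 - q ^ Suc j) * q ^ (Suc i - j) * acoef i (j - 1))"
proof -
  have nz: "1 - q \<noteq> 0" "\<And>n. n \<le> Suc i \<Longrightarrow> qpoch n \<noteq> 0"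
    using q_less[of 1] N3 assms qpoch_nz by (auto simp: order_le_less_trans)
  have "j > Suc i \<or> j = Suc i \<or> j = 0 \<or> (\<exists>r j'. j = Suc j' \<and> i = j + r)"
    by presburger
  then consider "j > Suc i" | "j = Suc i" | "j = 0" | r j' where "j = Suc j'" "i = j + r"
    by blast
  then show ?thesis
  proof cases
    case 1
    then show ?thesis by (auto simp: acoef_def)
  next
    case 2
    have "acoef n n = qpoch (Suc n) / (1 - q)" if "n \<le> Suc i" for n
      using nz(2)[OF that] by (simp add: acoef_def)
    then show ?thesis using nz(1) 2 by (simp add: acoef_def)
  next
    case 3
    have "acoef n 0 = qpoch (Suc n) / (1 - q)" if "n \<le> Suc i" for n
      using nz(2)[OF that] by (simp add: acoef_def)
    then show ?thesis using 3 by simp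
  next
    case 4
    have ne: "qpoch j' \<noteq> 0" "qpoch r \<noteq> 0" "1 - q ^ Suc j' \<noteq> 0" "1 - q ^ Suc r \<noteq> 0"
      using nz(2)[of j'] nz(2)[of r] nz(2)[of "Suc j'"] nz(2)[of "Suc r"] 4 by auto
    define a b A B C where "a = q ^ Suc j'" "b = q ^ Suc r" and "A = qpoch j'" "B = qpoch r" "C = qpoch i"
    have e: "q ^ Suc i = a * b" "q ^ Suc (Suc i) = a * b * q"
      by (simp_all add: 4 a_b_def power_add)
    \<comment> \<open>The common factor of the three coefficients. What remains is
      \<open>(1 - abq)(1 - ab) = (1 - aabq)(1 - b) + (1 - aq) b (1 - a)\<close>.\<close>
    define D where "D = C * (1 - a * b) * C / ((1 - q) * A * (1 - a) * B * (1 - b))"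
    have nn: "A \<noteq> 0" "B \<noteq> 0" "1 - a \<noteq> 0" "1 - b \<noteq> 0" using ne by (simp_all add: A_B_C_def a_b_def)
    have x: "acoef (Suc i) j = D * (1 - a * b * q) * (1 - a * b)"
      unfolding acoef_def A_B_C_def D_def qpoch_simps(2) e using 4(1) 4(2)
      by (simp add: a_b_def Suc_diff_le mult_ac)
    have y: "acoef i j = D * (1 - b)"
      unfolding acoef_def qpoch_simps(2) e D_def using 4(1) 4(2) nn(4)
      by (simp add: a_b_def A_B_C_def mult_ac)
    have z: "acoef i (j - 1) = D * (1 - a)"
      unfolding acoef_def qpoch_simps(2) e D_def using 4(1) 4(2) nn(3)
      by (simp add: a_b_def A_B_C_def mult_ac)
    have w: "q ^ (i + j + 2) = a * a * b * q" "q ^ Suc j = a * q" "q ^ (Suc i - j) = b"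
      using 4(1) 4(2) by (simp_all add: a_b_def power_add Suc_diff_le)
    show ?thesis unfolding x y z w using 4(1)
      by (simp add: algebra_simps)
  qed
qed

end

context qparam begin

lemma raise_Cons: "raise f (j # v) = raise (\<lambda>v. f (j # v)) v +
       (if j = 0 then 0 else (1 - q ^ Suc j) * qdeg (\<lambda>v. f ((j - 1) # v)) v)"
  by (simp add: qdeg_def mult_ac)

lemma qdeg_Cons: "qdeg f (j # v) = q ^ Suc j * qdeg (\<lambda>v. f (j # v)) v"
  by (simp add: qdeg_def power_add)

lemma funpow_raise_scale: "(raise ^^ n) (\<lambda>v. c * f v) v = c * (raise ^^ n) f v"
  by (rule fun_linear_scale[OF fun_linear_funpow[OF fun_linear_raise]])

lemma funpow_qdeg: "(qdeg ^^ n) f v = q ^ (wdeg v * n) * f v"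
  by (induction n) (simp_all add: qdeg_def power_add)

lemma qdeg_funpow_raise: "qdeg ((raise ^^ n) f) v = q ^ n * (raise ^^ n) (qdeg f) v"
proof (induction n arbitrary: v)
  case (Suc n)
  have "qdeg ((raise ^^ Suc n) f) v = q * raise (qdeg ((raise ^^ n) f)) v"
    by (simp add: qdeg_raise)
  also have "qdeg ((raise ^^ n) f) = (\<lambda>v. q ^ n * (raise ^^ n) (qdeg f) v)"
    using Suc by blast
  finally show ?case by (simp add: raise_scale)
qed simp

lemma funpow_qdeg_raise: "(qdeg ^^ n) (raise f) = (\<lambda>v. q ^ n * raise ((qdeg ^^ n) f) v)"
proof (induction n)
  case (Suc n)
  show ?case
  proof
    fix v
    have "(qdeg ^^ Suc n) (raise f) v = q ^ n * qdeg (raise ((qdeg ^^ n) f)) v"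
      by (simp add: Suc fun_linear_scale[OF fun_linear_qdeg])
    then show "(qdeg ^^ Suc n) (raise f) v = q ^ Suc n * raise ((qdeg ^^ Suc n) f) v"
      by (simp add: qdeg_raise)
  qed
qed simp

end

context qroot begin

lemma acoef_last: "acoef (N - 1) j = 0"
proof -
  have "qpoch (Suc (N - 1)) = 0"
    using N3 qN qpoch_simps(2)[of "N - 1"] by simp
  then show ?thesis by (simp add: acoef_def)
qed

text \<open>The Leibniz rule along y: either the other factor is differentiated, or z_i is, giving a
  multiple of \<open>x ^ i\<close>. Moving \<open>x ^ i\<close> to the right past the other factor
  leaves iterated adjoint actions times powers \<open>x ^ j\<close>.\<close>

lemma zmul_Cons:
  assumes "i < N"
  shows "zmul i f (j # v) = zmul i (\<lambda>v. f (j # v)) v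
    + acoef i j * (raise ^^ (i - j)) ((qdeg ^^ Suc j) f) v"
  using assms
proof (induction i arbitrary: f j v)
  case 0
  then show ?case by (auto simp: acoef_0 qdeg_def)
next
  case (Suc i)
  then have "i < N" by simp
  note IH = Suc.IH[OF this]
  define R where "R = (raise ^^ (Suc i - j)) ((qdeg ^^ Suc j) f) v"
  \<comment> \<open>The cross term. It occurs with factor \<open>q ^ Suc i\<close> both in
    \<open>raise (zmul i f)\<close> and in the correction subtracted from it, and cancels.\<close>
  define Z where "Z = (if j = 0 then 0 else (1 - q ^ Suc j) * zmul i (qdeg (\<lambda>v. f ((j - 1) # v))) v)"
  have 1: "raise (zmul i f) (j # v) = raise (zmul i (\<lambda>v. f (j # v))) v + acoef i j * R
     + q ^ Suc i * Z + (if j = 0 then 0 else (1 - q ^ Suc j) * q ^ (Suc i - j) * acoef i (j - 1) * R)"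
  proof -
    have "raise (\<lambda>v. zmul i f (j # v)) v = raise (zmul i (\<lambda>v. f (j # v))) v + acoef i j * R"
      by (cases "j \<le> i")
        (auto simp: IH[abs_def] raise_add raise_scale R_def Suc_diff_le acoef_gt raise_zero)
    moreover have "qdeg (\<lambda>v. zmul i f ((j - 1) # v)) v = q ^ Suc i * zmul i (qdeg (\<lambda>v. f ((j - 1) # v))) v
        + q ^ (Suc i - j) * acoef i (j - 1) * R" if "j \<noteq> 0"
    proof -
      obtain j' where j': "j = Suc j'" using \<open>j \<noteq> 0\<close> by (cases j) auto
      have "qdeg (\<lambda>v. zmul i f (j' # v)) v = qdeg (zmul i (\<lambda>v. f (j' # v))) v
          + acoef i j' * qdeg ((raise ^^ (i - j')) ((qdeg ^^ Suc j') f)) v"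
        unfolding IH by (simp add: qdeg_def algebra_simps)
      then show ?thesis by (simp add: qdeg_zmul qdeg_funpow_raise R_def j')
    qed
    ultimately show ?thesis
      by (cases "j = 0") (simp_all add: raise_Cons Z_def algebra_simps del: raise.simps)
  qed
  have 2: "zmul i (raise f) (j # v) = zmul i (raise (\<lambda>v. f (j # v))) v + Z + q ^ Suc j * acoef i j * R"
  proof -
    have "zmul i (\<lambda>v. raise f (j # v)) v = zmul i (raise (\<lambda>v. f (j # v))) v + Z"
      by (cases "j = 0") (simp_all add: raise_Cons Z_def zmul_add zmul_scale del: raise.simps)
    moreover have "acoef i j * (raise ^^ (i - j)) ((qdeg ^^ Suc j) (raise f)) v = q ^ Suc j * acoef i j * R"
    proof (cases "j \<le> i")
      case True
      then show ?thesis
        unfolding funpow_qdeg_raise by (simp add: funpow_raise_scale R_def Suc_diff_le funpow_swap1 del: funpow.simps(2))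
          (simp add: funpow_swap1)
    qed (simp add: acoef_def)
    ultimately show ?thesis unfolding IH by simp
  qed
  have "zmul (Suc i) f (j # v) = zmul (Suc i) (\<lambda>v. f (j # v)) v
     + acoef i j * R - q ^ Suc i * (q ^ Suc j * acoef i j * R) + (if j = 0 then 0 else (1 - q ^ Suc j) * q ^ (Suc i - j) * acoef i (j - 1) * R)"
    unfolding zmul.simps 1 2 by (simp add: algebra_simps)
  also have "\<dots> = zmul (Suc i) (\<lambda>v. f (j # v)) v + acoef (Suc i) j * R"
    unfolding acoef_Suc[OF Suc.prems] by (simp add: algebra_simps power_add)
  finally show ?case by (simp only: R_def)
qed

text \<open>At index \<open>N - 1\<close> all coefficients \<open>acoef\<close> contain
  \<open>1 - q ^ N = 0\<close>, so the Leibniz rule passes down to the empty word, where the value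
  is 0. Larger indices follow by the recursion.\<close>

lemma zmul_ge: "i \<ge> N - 1 \<Longrightarrow> zmul i f v = 0"
proof (induction i arbitrary: f v rule: dec_induct)
  case base
  show ?case
  proof (induction v arbitrary: f)
    case Nil
    then show ?case
    proof -
      have "zmul i f [] = 0" for i f by (induction i arbitrary: f) auto
      then show ?thesis .
    qed
  next
    case (Cons j v)
    then show ?case using N3 zmul_Cons[of "N - 1" f j v] by (simp only: acoef_last) simp
  qed
next
  case (step i)
  have "zmul i g = (\<lambda>v. 0)" for g using step.IH by (rule ext)
  then show ?case by (simp add: raise_zero)
qed

lemma zmul_Nil [simp]: "zmul i f [] = 0"
  by (induction i arbitrary: f) auto

section \<open>The symmetry of the coinvariants\<close>

fun zword :: "nat list \<Rightarrow> nat list \<Rightarrow> 'k"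
  where
    "zword [] = unit_fun"
  | "zword (i # u) = zmul i (zword u)"

text \<open>
  The value \<open>zword u v\<close> is the pairing of two words. The operators \<open>lraise\<close> and \<open>rmul\<close> act on its first
  argument and correspond to \<open>raise\<close> on the second one and to prepending a letter to it.
\<close>

fun lraise :: "(nat list \<Rightarrow> 'k) \<Rightarrow> nat list \<Rightarrow> 'k"
  where
    "lraise h [] = 0"
  | "lraise h (i # u) = h (Suc i # u) + q ^ Suc i * lraise (\<lambda>u. h (i # u)) u"

fun rmul :: "nat \<Rightarrow> (nat list \<Rightarrow> 'k) \<Rightarrow> nat list \<Rightarrow> 'k"
  where
    "rmul j h [] = 0"
  | "rmul j h (i # u) = rmul j (\<lambda>u. h (i # u)) u
       + acoef i j * q ^ (wdeg u * Suc j) * (lraise ^^ (i - j)) h u"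

text \<open>A linear operator on the second argument of the pairing commutes with
  \<open>lraise\<close> on the first.\<close>

lemma linear_lraise:
  assumes "fun_linear T"
  shows "T (\<lambda>v. lraise (\<lambda>u. H u v) u) v = lraise (\<lambda>u. T (H u) v) u"
proof (induction u arbitrary: H)
  case Nil
  then show ?case using fun_linear_zero[OF assms] by simp
next
  case (Cons i u)
  have "T (\<lambda>v. lraise (\<lambda>u. H u v) (i # u)) v
      = T (\<lambda>v. H (Suc i # u) v + q ^ Suc i * lraise (\<lambda>u. H (i # u) v) u) v" by simp
  also have "\<dots> = T (H (Suc i # u)) v + q ^ Suc i * T (\<lambda>v. lraise (\<lambda>u. H (i # u) v) u) v"
    using fun_linear_add[OF assms] fun_linear_scale[OF assms] by simp
  also have "\<dots> = lraise (\<lambda>u. T (H u) v) (i # u)"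
    using Cons[of "\<lambda>u. H (i # u)"] by simp
  finally show ?case .
qed

lemma linear_funpow_lraise:
  assumes "fun_linear T"
  shows "T (\<lambda>v. (lraise ^^ n) (\<lambda>u. H u v) u) v = (lraise ^^ n) (\<lambda>u. T (H u) v) u"
proof (induction n arbitrary: u)
  case 0
  then show ?case by simp
next
  case (Suc n)
  have "T (\<lambda>v. (lraise ^^ Suc n) (\<lambda>u. H u v) u) v
      = T (\<lambda>v. lraise (\<lambda>u. (lraise ^^ n) (\<lambda>u. H u v) u) u) v" by simp
  also have "\<dots> = lraise (\<lambda>u. T (\<lambda>v. (lraise ^^ n) (\<lambda>u. H u v) u) v) u"
    by (rule linear_lraise[OF assms])
  also have "\<dots> = (lraise ^^ Suc n) (\<lambda>u. T (H u) v) u"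
    by (simp add: Suc)
  finally show ?case .
qed

lemma linear_rmul:
  assumes "fun_linear T"
  shows "T (\<lambda>v. rmul j (\<lambda>u. H u v) u) v = rmul j (\<lambda>u. T (H u) v) u"
proof (induction u arbitrary: H)
  case Nil
  then show ?case using fun_linear_zero[OF assms] by simp
next
  case (Cons i u)
  show ?case
    using Cons[of "\<lambda>u. H (i # u)"]
    by (simp only: rmul.simps fun_linear_add[OF assms] fun_linear_scale[OF assms]
        linear_funpow_lraise[OF assms])
qed

text \<open>The adjoint action is a skew derivation raising one index at a time;
  \<open>lraise\<close> is the resulting sum over positions.\<close>

lemma raise_zword: "raise (zword u) v = lraise (\<lambda>u. zword u v) u"
proof (induction u arbitrary: v)
  case Nil
  then show ?case by simp
next
  case (Cons i u)
  have "raise (zword u) = (\<lambda>v. lraise (\<lambda>u. zword u v) u)" using Cons by blast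
  then show ?case
    using linear_lraise[OF fun_linear_zmul, of i zword u v] by (simp add: raise_zmul del: zmul.simps)
qed

lemma funpow_raise_zword: "(raise ^^ n) (zword u) v = (lraise ^^ n) (\<lambda>u. zword u v) u"
proof (induction n arbitrary: v)
  case 0
  then show ?case by simp
next
  case (Suc n)
  have "(raise ^^ n) (zword u) = (\<lambda>v. (lraise ^^ n) (\<lambda>u. zword u v) u)" using Suc by blast
  then have "(raise ^^ Suc n) (zword u) v = (lraise ^^ n) (\<lambda>u. raise (zword u) v) u"
    using linear_funpow_lraise[OF fun_linear_raise, of n zword u v] by simp
  also have "\<dots> = (lraise ^^ Suc n) (\<lambda>u. zword u v) u"
    by (simp add: raise_zword funpow_swap1)
  finally show ?case .
qed

lemma qdeg_zword: "qdeg (zword u) = (\<lambda>v. q ^ wdeg u * zword u v)"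
proof (induction u)
  case (Cons i u)
  show ?case
  proof
    fix v
    show "qdeg (zword (i # u)) v = q ^ wdeg (i # u) * zword (i # u) v"
      by (simp add: qdeg_zmul Cons zmul_scale power_add del: zmul.simps)
  qed
qed simp

lemma funpow_qdeg_zword: "(qdeg ^^ n) (zword u) = (\<lambda>v. q ^ (wdeg u * n) * zword u v)"
proof (induction n)
  case (Suc n)
  have "qdeg (\<lambda>v. q ^ (wdeg u * n) * zword u v) = (\<lambda>v. q ^ (wdeg u * n) * qdeg (zword u) v)"
    by (auto simp: qdeg_def)
  then show ?case using Suc by (simp add: qdeg_zword power_add mult_ac)
qed simp

text \<open>Applying \<open>zmul_Cons\<close> along the first word turns a letter prepended to the
  second word into an operation on the first word alone.\<close>

lemma zword_Cons_right:
  assumes "\<forall>i\<in>set u. i < N"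
  shows "zword u (j # v) = rmul j (\<lambda>u. zword u v) u"
  using assms
proof (induction u arbitrary: v)
  case Nil
  then show ?case by simp
next
  case (Cons i u)
  have IH: "(\<lambda>v. zword u (j # v)) = (\<lambda>v. rmul j (\<lambda>u. zword u v) u)"
    using Cons by auto
  have "zword (i # u) (j # v) = zmul i (\<lambda>v. zword u (j # v)) v
    + acoef i j * (raise ^^ (i - j)) ((qdeg ^^ Suc j) (zword u)) v"
    using Cons.prems by (simp add: zmul_Cons del: zmul.simps funpow.simps)
  also have "zmul i (\<lambda>v. zword u (j # v)) v = rmul j (\<lambda>u. zword (i # u) v) u"
    unfolding IH linear_rmul[OF fun_linear_zmul] by simp
  also have "(raise ^^ (i - j)) ((qdeg ^^ Suc j) (zword u)) v
     = q ^ (wdeg u * Suc j) * (lraise ^^ (i - j)) (\<lambda>u. zword u v) u"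
    by (simp only: funpow_qdeg_zword funpow_raise_scale funpow_raise_zword)
  finally show ?case by (simp add: mult.assoc del: zword.simps)
qed

text \<open>Words with other letters are irrelevant, since \<open>z\<close> of index \<open>N - 1\<close> vanishes.\<close>

abbreviation good :: "nat list \<Rightarrow> bool"
  where "good u \<equiv> \<forall>i\<in>set u. i < N - 1"

lemma zword_bad: "\<not> good u \<Longrightarrow> zword u v = 0"
proof (induction u arbitrary: v)
  case (Cons i u)
  show ?case
  proof (cases "i < N - 1")
    case True
    then have "zword u = (\<lambda>v. 0)" using Cons by fastforce
    then show ?thesis by (simp add: zmul_zero del: zmul.simps)
  qed (simp add: zmul_ge del: zmul.simps)
qed simp

text \<open>\<open>raise\<close> only lowers letters, so on a good word it evaluates its argument at
  good words only.\<close>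

lemma raise_cong_good:
  "\<lbrakk>\<And>w. good w \<Longrightarrow> f w = g w; good u\<rbrakk> \<Longrightarrow> raise f u = raise g u"
proof (induction u arbitrary: f g)
  case (Cons j u)
  have "raise (\<lambda>v. f (j # v)) u = raise (\<lambda>v. g (j # v)) u"
    using Cons.prems by (intro Cons.IH) auto
  moreover have "f ((j - 1) # u) = g ((j - 1) # u)"
    using Cons.prems by auto
  ultimately show ?case by simp
qed simp

lemma funpow_raise_cong_good:
  "\<lbrakk>\<And>w. good w \<Longrightarrow> f w = g w; good u\<rbrakk> \<Longrightarrow> (raise ^^ n) f u = (raise ^^ n) g u"
proof (induction n arbitrary: u)
  case (Suc n)
  have "raise ((raise ^^ n) f) u = raise ((raise ^^ n) g) u"
    using Suc by (intro raise_cong_good) auto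
  then show ?case by simp
qed simp

lemma zmul_cong_good:
  "\<lbrakk>\<And>w. good w \<Longrightarrow> f w = g w; good u; i < N\<rbrakk> \<Longrightarrow> zmul i f u = zmul i g u"
proof (induction u arbitrary: f g)
  case (Cons j u)
  have "zmul i (\<lambda>v. f (j # v)) u = zmul i (\<lambda>v. g (j # v)) u"
    using Cons.prems by (intro Cons.IH) auto
  moreover have "(raise ^^ (i - j)) ((qdeg ^^ Suc j) f) u = (raise ^^ (i - j)) ((qdeg ^^ Suc j) g) u"
    using Cons.prems by (intro funpow_raise_cong_good) (auto simp: funpow_qdeg simp del: funpow.simps)
  ultimately show ?case using Cons.prems by (simp add: zmul_Cons del: zmul.simps funpow.simps)
qed simp

definition flip :: "nat list \<Rightarrow> nat list"
  where "flip u = map (\<lambda>i. N - 2 - i) u"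

lemma flip_simps [simp]: "flip [] = []" "flip (i # u) = (N - 2 - i) # flip u"
  by (simp_all add: flip_def)

text \<open>The factors are chosen such that \<open>flip\<close> carries \<open>lraise\<close> to \<open>raise\<close>, up to powers of \<open>q\<close>.\<close>

primrec flip_factor :: "nat \<Rightarrow> 'k"
  where "flip_factor 0 = 1" | "flip_factor (Suc j) = flip_factor j * (inverse (q ^ Suc (Suc j)) - 1)"

definition flip_weight :: "nat list \<Rightarrow> 'k"
  where "flip_weight u = prod_list (map flip_factor u)"

lemma flip_weight_simps [simp]: "flip_weight [] = 1" "flip_weight (i # u) = flip_factor i * flip_weight u"
  by (simp_all add: flip_weight_def)

lemma flip_factor_rec: "j \<noteq> 0 \<Longrightarrow> q ^ Suc j * flip_factor j = (1 - q ^ Suc j) * flip_factor (j - 1)"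
  using q_nz by (cases j) (simp_all add: field_simps)

lemma flip_factor_nz: "j < N - 1 \<Longrightarrow> flip_factor j \<noteq> 0"
proof (induction j)
  case (Suc j)
  then have "q ^ Suc (Suc j) \<noteq> 1" by (intro q_less) auto
  then show ?case using Suc by (simp del: power_Suc) 
qed simp

lemma flip_weight_nz: "good u \<Longrightarrow> flip_weight u \<noteq> 0"
  by (induction u) (auto simp: flip_factor_nz)

text \<open>The letters \<open>i\<close> and \<open>N - 2 - i\<close> have degrees adding up to
  \<open>N\<close>.\<close>

lemma wdeg_flip: "good u \<Longrightarrow> q ^ wdeg (flip u) * q ^ wdeg u = 1"
proof (induction u)
  case (Cons i u)
  then have "i < N - 1" by simp
  then have "Suc (N - 2 - i) + Suc i = N" by simp
  then have e: "q ^ Suc (N - 2 - i) * q ^ Suc i = 1"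
    by (simp only: qN flip: power_add)
  have "q ^ wdeg (flip (i # u)) * q ^ wdeg (i # u)
     = (q ^ Suc (N - 2 - i) * q ^ Suc i) * (q ^ wdeg (flip u) * q ^ wdeg u)"
    by (simp add: power_add mult_ac)
  moreover have "q ^ wdeg (flip u) * q ^ wdeg u = 1" using Cons by simp
  ultimately show ?case by (simp only: e mult_1_left)
qed simp

text \<open>Raising a letter cannot make a bad word good.\<close>

lemma lraise_bad:
  "\<lbrakk>\<And>w. \<not> good w \<Longrightarrow> h w = 0; \<not> good u\<rbrakk> \<Longrightarrow> lraise h u = 0"
proof (induction u arbitrary: h)
  case (Cons i u)
  have "h (Suc i # u) = 0" using Cons.prems by (auto intro!: Cons.prems(1))
  moreover have "lraise (\<lambda>u. h (i # u)) u = 0"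
  proof (cases "good u")
    case True
    then have "\<not> i < N - 1" using Cons.prems by auto
    then have "(\<lambda>u. h (i # u)) = (\<lambda>u. 0)" using Cons.prems(1) by auto
    moreover have "lraise (\<lambda>u. 0) u = 0" by (induction u) auto
    ultimately show ?thesis by simp
  next
    case False
    then show ?thesis using Cons.prems by (intro Cons.IH) auto
  qed
  ultimately show ?case by simp
qed simp

text \<open>\<open>raise\<close> evaluates at a lowered letter and \<open>lraise\<close> at a raised
  one, so the flip matches them position by position. \<open>flip_factor_rec\<close> adjusts the
  coefficients, and \<open>q ^ N = 1\<close> the powers of \<open>q\<close>.\<close>

lemma raise_flip:
  assumes "\<And>w. \<not> good w \<Longrightarrow> h w = 0" "good u"
  shows "raise (\<lambda>u. flip_weight u * h (flip u)) u = q ^ wdeg u * (flip_weight u * lraise h (flip u))"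
  using assms
proof (induction u arbitrary: h)
  case (Cons j u)
  then have j: "j < N - 1" by simp
  then have "Suc (N - 2 - j) + Suc j = N" by simp
  then have e: "q ^ Suc (N - 2 - j) * q ^ Suc j = 1"
    by (simp only: qN flip: power_add)
  let ?h = "\<lambda>u. h ((N - 2 - j) # u)"
  have IH: "raise (\<lambda>u. flip_weight u * ?h (flip u)) u = q ^ wdeg u * (flip_weight u * lraise ?h (flip u))"
    using Cons.prems by (intro Cons.IH) auto
  have 1: "raise (\<lambda>u. flip_weight (j # u) * h (flip (j # u))) u = flip_factor j * (q ^ wdeg u * (flip_weight u * lraise ?h (flip u)))"
    using raise_scale[of "flip_factor j" "\<lambda>u. flip_weight u * ?h (flip u)" u]
    by (simp only: IH mult.assoc flip_weight_simps flip_simps)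
  have 2: "(if j = 0 then 0 else (1 - q ^ Suc j) * (flip_weight ((j - 1) # u) * h (flip ((j - 1) # u))))
    = q ^ Suc j * flip_factor j * flip_weight u * h (Suc (N - 2 - j) # flip u)"
  proof (cases "j = 0")
    case True
    \<comment> \<open>The letter 0 flips to \<open>N - 2\<close>, and raising that gives a bad
      letter; this matches the missing term of \<open>raise\<close> at 0.\<close>
    have "h (Suc (N - 2) # flip u) = 0" using N3 by (intro Cons.prems(1)) auto
    then show ?thesis using True by simp
  next
    case False
    then have "Suc (N - 2 - j) = N - 2 - (j - 1)" using j by simp
    then show ?thesis using flip_factor_rec[OF False] False by simp
  qed
  have "raise (\<lambda>u. flip_weight u * h (flip u)) (j # u) = flip_factor j * (q ^ wdeg u * (flip_weight u * lraise ?h (flip u)))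
     + q ^ wdeg u * (if j = 0 then 0 else (1 - q ^ Suc j) * (flip_weight ((j - 1) # u) * h (flip ((j - 1) # u))))"
    unfolding raise.simps(2) 1 by simp
  also have "\<dots> = q ^ wdeg u * flip_factor j * flip_weight u * (q ^ Suc j * (h (Suc (N - 2 - j) # flip u)
      + (q ^ Suc (N - 2 - j) * lraise ?h (flip u))))"
  proof -
    have "x * (A + y * B) = x * A + B" if "y * x = 1" for x y A B :: 'k
    proof -
      have "x * (A + y * B) = x * A + (y * x) * B" by (simp only: distrib_left mult_ac)
      then show ?thesis using that by simp
    qed
    note key = this[OF e]
    show ?thesis unfolding 2 key by (simp only: distrib_left mult_ac add_ac)
  qed
  finally show ?case by (simp add: power_add mult_ac)
qed simp

text \<open>Each use of \<open>raise_flip\<close> leaves a \<open>qdeg\<close>; taking it out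
  through the remaining applications of \<open>raise\<close> adds \<open>0 + ... + (r - 1)\<close>
  to the exponent.\<close>

lemma funpow_raise_flip:
  assumes "\<And>w. \<not> good w \<Longrightarrow> h w = 0" "good u"
  shows "q ^ (\<Sum>{..<r}) * (raise ^^ r) (\<lambda>u. flip_weight u * h (flip u)) u
    = q ^ (r * wdeg u) * (flip_weight u * (lraise ^^ r) h (flip u))"
  using assms
proof (induction r arbitrary: h)
  case (Suc r)
  let ?f = "\<lambda>u. flip_weight u * lraise h (flip u)"
  have "(raise ^^ r) (raise (\<lambda>u. flip_weight u * h (flip u))) u = (raise ^^ r) (qdeg ?f) u"
    using Suc.prems raise_flip[OF Suc.prems(1)]
    by (intro funpow_raise_cong_good) (simp_all only: qdeg_def)
  then have "q ^ r * (raise ^^ Suc r) (\<lambda>u. flip_weight u * h (flip u)) u = q ^ wdeg u * (raise ^^ r) ?f u"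
    by (simp add: funpow_swap1 qdeg_def flip: qdeg_funpow_raise)
  moreover have "q ^ (\<Sum>{..<r}) * (raise ^^ r) ?f u = q ^ (r * wdeg u) * (flip_weight u * (lraise ^^ r) (lraise h) (flip u))"
    using Suc.prems by (intro Suc.IH lraise_bad) auto
  ultimately show ?case by (simp add: power_add funpow_swap1 mult.left_commute mult.assoc)
qed simp

text \<open>The value forced by the case \<open>r = 0\<close> of \<open>acoef_flip\<close>, where
  only diagonal coefficients occur.\<close>

definition flip_const :: "nat \<Rightarrow> 'k"
  where "flip_const j = flip_factor j * acoef (N - 2 - j) (N - 2 - j) / acoef j j"

lemma acoef_diag: "j < N \<Longrightarrow> acoef j j = qpoch (Suc j) / (1 - q)"
  using qpoch_nz[of j] by (simp add: acoef_def)

lemma acoef_diag_nz: "j < N - 1 \<Longrightarrow> acoef j j \<noteq> 0"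
  using qpoch_nz[of "Suc j"] q_less[of 1] N3 by (simp add: acoef_diag del: qpoch_simps)

lemma flip_const_nz: "j < N - 1 \<Longrightarrow> flip_const j \<noteq> 0"
  using flip_factor_nz[of j] acoef_diag_nz[of j] acoef_diag_nz[of "N - 2 - j"] N3
  by (simp add: flip_const_def)

text \<open>Matches the coefficients of \<open>rmul\<close> with those in \<open>zmul_Cons\<close>
  under the flip. The induction on \<open>r\<close> keeps \<open>i + r\<close> fixed.\<close>

lemma acoef_flip:
  assumes "i + r < N - 1"
  shows "flip_factor i * acoef (N - 2 - i) (N - 2 - (i + r)) * q ^ (r * Suc i + \<Sum>{..<r})
    = flip_const (i + r) * acoef (i + r) i"
  using assms
proof (induction r arbitrary: i)
  case 0
  then show ?case using acoef_diag_nz[of i] by (simp add: flip_const_def)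
next
  case (Suc r)
  define s where "s = N - 2 - (i + Suc r)"
  have N: "N = s + i + Suc r + 2" using Suc.prems by (simp add: s_def)
  have IH: "flip_factor (Suc i) * acoef (s + r) s * q ^ (r * Suc (Suc i) + \<Sum>{..<r})
     = flip_const (i + Suc r) * acoef (i + Suc r) (Suc i)"
    using Suc.IH[of "Suc i"] Suc.prems by (simp add: N)
  have nz: "\<And>n. n < N \<Longrightarrow> qpoch n \<noteq> 0" "\<And>n. 0 < n \<Longrightarrow> n < N \<Longrightarrow> 1 - q ^ n \<noteq> 0"
    using qpoch_nz q_less by auto
  have e: "q ^ Suc (Suc i) * q ^ Suc (s + r) = 1"
    using qN by (simp add: N flip: power_add power_Suc) (simp add: power_add add_ac mult_ac power_Suc)
  \<comment> \<open>The two exponents add up to \<open>N\<close>, so \<open>a\<close> and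
    \<open>b\<close> are inverse to each other; this makes the factors produced by \<open>A\<close>
    and \<open>B\<close> agree.\<close>
  define a b where "a = q ^ Suc (Suc i)" and "b = q ^ Suc (s + r)"
  have ab: "a * b = 1" using e by (simp add: a_def b_def)
  have A: "acoef (s + Suc r) s * (1 - q ^ Suc r) = acoef (s + r) s * (1 - q ^ Suc (Suc (s + r))) * (1 - b)"
    using nz(1)[of r] nz(1)[of s] nz(2)[of "Suc r"]
    by (simp add: acoef_def N b_def divide_simps) (simp add: algebra_simps)?
  have B: "acoef (i + Suc r) i * (1 - q ^ Suc r) = acoef (i + Suc r) (Suc i) * (1 - q ^ Suc i)"
    using nz(1)[of r] nz(1)[of i] nz(2)[of "Suc r"] nz(2)[of "Suc i"]
    by (simp add: acoef_def N divide_simps) (simp add: algebra_simps)?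
  define c where "c = q ^ Suc i"
  have c: "c * (1 - b * q) = c - 1" "a = c * q"
    using ab by (simp_all add: a_def c_def algebra_simps)
  define P where "P = q ^ (r * Suc (Suc i) + \<Sum>{..<r})"
  have P: "q ^ (Suc r * Suc i + \<Sum>{..<Suc r}) = c * P"
    by (simp add: c_def P_def add_ac flip: power_add power_Suc)
  have "inverse a = b" using ab by (rule inverse_unique)
  then have g: "flip_factor (Suc i) = flip_factor i * (b - 1)" by (simp only: flip_factor.simps a_def)
  have s1: "N - 2 - i = s + Suc r" "N - 2 - (i + Suc r) = s" by (simp_all add: N)
  have bq: "q ^ Suc (Suc (s + r)) = b * q" by (simp add: b_def)
  have "flip_factor i * acoef (s + Suc r) s * (c * P) * (1 - q ^ Suc r)
      = flip_factor i * (acoef (s + Suc r) s * (1 - q ^ Suc r)) * (c * P)" by (simp add: mult_ac)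
  also have "\<dots> = flip_factor i * acoef (s + r) s * (1 - b) * P * (c * (1 - b * q))"
    unfolding A bq by (simp add: mult_ac)
  also have "\<dots> = (flip_factor (Suc i) * acoef (s + r) s * P) * (1 - c)"
    unfolding c g by (simp add: algebra_simps)
  also have "\<dots> = flip_const (i + Suc r) * (acoef (i + Suc r) i * (1 - q ^ Suc r))"
    unfolding P_def IH B by (simp add: c_def mult_ac)
  finally have "(flip_factor i * acoef (s + Suc r) s * (c * P)) * (1 - q ^ Suc r)
    = (flip_const (i + Suc r) * acoef (i + Suc r) i) * (1 - q ^ Suc r)"
    by (simp only: mult.assoc)
  moreover have "1 - q ^ Suc r \<noteq> 0" using N by (intro nz(2)) auto
  ultimately show ?case
    unfolding P s1 by (simp only: mult_cancel_right) simp
qed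

lemma flip_flip: "good u \<Longrightarrow> flip (flip u) = u"
  by (induction u) auto

lemma good_flip: "good (flip u)"
  using N3 by (induction u) auto

text \<open>Leibniz terms correspond by induction, and the extra terms by
  \<open>funpow_raise_flip\<close> and \<open>acoef_flip\<close>.\<close>

lemma rmul_flip:
  assumes "\<And>w. \<not> good w \<Longrightarrow> h w = 0" "good u" "j < N - 1"
  shows "flip_weight u * rmul (N - 2 - j) h (flip u) = flip_const j * zmul j (\<lambda>u. flip_weight u * h (flip u)) u"
  using assms(1,2)
proof (induction u arbitrary: h)
  case Nil
  then show ?case by simp
next
  case (Cons i u)
  then have i: "i < N - 1" by simp
  let ?h = "\<lambda>u. h ((N - 2 - i) # u)" and ?f = "\<lambda>u. flip_weight u * h (flip u)"
  have IH: "flip_weight u * rmul (N - 2 - j) ?h (flip u) = flip_const j * zmul j (\<lambda>u. flip_weight u * ?h (flip u)) u"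
    using Cons.prems by (intro Cons.IH) auto
  have 1: "zmul j (\<lambda>u. flip_weight (i # u) * h (flip (i # u))) u = flip_factor i * zmul j (\<lambda>u. flip_weight u * ?h (flip u)) u"
    using zmul_scale[of j "flip_factor i" "\<lambda>u. flip_weight u * ?h (flip u)" u] by (simp add: mult.assoc)
  define Q Q' where "Q = q ^ wdeg u" and "Q' = q ^ wdeg (flip u)"
  have Q: "Q' * Q = 1" using Cons.prems wdeg_flip[of u] by (simp add: Q_def Q'_def)
  have 2: "flip_factor i * acoef (N - 2 - i) (N - 2 - j) * q ^ (wdeg (flip u) * Suc (N - 2 - j)) *
       (flip_weight u * (lraise ^^ (j - i)) h (flip u))
     = flip_const j * acoef j i * (raise ^^ (j - i)) ((qdeg ^^ Suc i) ?f) u"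
  proof (cases "i \<le> j")
    case False
    then have "N - 2 - i < N - 2 - j" "j < i" using i assms(3) by auto
    then show ?thesis by (simp add: acoef_gt)
  next
    case True
    define r where "r = j - i"
    have jr: "j = i + r" using True by (simp add: r_def)
    define E where "E = (raise ^^ r) ?f u"
    define L where "L = flip_weight u * (lraise ^^ r) h (flip u)"
    have EL: "q ^ (\<Sum>{..<r}) * E = Q ^ r * L"
    proof -
      have "q ^ (r * wdeg u) = Q ^ r"
        by (simp add: Q_def mult.commute[of r] power_mult)
      then show ?thesis
        using funpow_raise_flip[of h u r] Cons.prems by (simp add: E_def L_def)
    qed
    have "q ^ (r * n) * (raise ^^ r) ((qdeg ^^ n) ?f) u = Q ^ n * E" for n
    proof (induction n)
      case (Suc n)
      have "q ^ r * (raise ^^ r) ((qdeg ^^ Suc n) ?f) u = Q * (raise ^^ r) ((qdeg ^^ n) ?f) u"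
        by (simp add: Q_def qdeg_def flip: qdeg_funpow_raise)
      then have "q ^ (r * n) * (q ^ r * (raise ^^ r) ((qdeg ^^ Suc n) ?f) u)
          = Q * (q ^ (r * n) * (raise ^^ r) ((qdeg ^^ n) ?f) u)"
        by (simp only: mult_ac)
      also have "\<dots> = Q * (Q ^ n * E)" by (simp only: Suc)
      finally show ?case by (simp only: mult_Suc_right power_add power_Suc mult_ac)
    qed (simp add: E_def)
    then have "q ^ (r * Suc i) * (raise ^^ r) ((qdeg ^^ Suc i) ?f) u = Q ^ Suc i * E" .
    then have "q ^ (\<Sum>{..<r}) * (q ^ (r * Suc i) * (raise ^^ r) ((qdeg ^^ Suc i) ?f) u)
        = q ^ (\<Sum>{..<r}) * (Q ^ Suc i * E)" by (simp only:)
    also have "\<dots> = Q ^ Suc i * (q ^ (\<Sum>{..<r}) * E)" by (rule mult.left_commute)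
    also have "\<dots> = Q ^ Suc i * (Q ^ r * L)" by (simp only: EL)
    finally have "q ^ (r * Suc i + \<Sum>{..<r}) * (raise ^^ r) ((qdeg ^^ Suc i) ?f) u = Q ^ (r + Suc i) * L"
      by (simp only: power_add mult_ac)
    note W = this
    \<comment> \<open>The two exponents add up to \<open>N\<close>, and \<open>Q ^ N = 1\<close>
      since \<open>Q\<close> is a power of \<open>q\<close>.\<close>
    have Q_flip: "Q ^ (r + Suc i) = Q' ^ Suc (N - 2 - j)"
    proof -
      have "Suc (N - 2 - j) + (r + Suc i) = N" using assms(3) by (simp add: jr)
      then have "Q' ^ Suc (N - 2 - j) * Q ^ Suc (N - 2 - j) * Q ^ (r + Suc i) = Q' ^ Suc (N - 2 - j) * (q ^ wdeg u) ^ N"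
        by (simp only: Q_def mult.assoc flip: power_add)
      also have "(q ^ wdeg u) ^ N = (q ^ N) ^ wdeg u"
        by (simp add: mult.commute flip: power_mult)
      finally show ?thesis by (simp only: qN power_one Q mult_1_left mult_1_right flip: power_mult_distrib)
    qed
    have "flip_factor i * acoef (N - 2 - i) (N - 2 - j) * q ^ (wdeg (flip u) * Suc (N - 2 - j)) * L
        = flip_factor i * acoef (N - 2 - i) (N - 2 - j) * (q ^ (r * Suc i + \<Sum>{..<r}) * (raise ^^ r) ((qdeg ^^ Suc i) ?f) u)"
      unfolding W Q_flip by (simp only: Q'_def power_mult mult.assoc)
    also have "\<dots> = flip_const j * acoef j i * (raise ^^ r) ((qdeg ^^ Suc i) ?f) u"
      using acoef_flip[of i r] assms(3) unfolding jr by (simp only: mult.assoc[symmetric])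
    finally show ?thesis by (simp only: L_def r_def)
  qed
  have r: "N - 2 - i - (N - 2 - j) = j - i" using i assms(3) by simp
  have "flip_weight (i # u) * rmul (N - 2 - j) h (flip (i # u)) = flip_factor i * (flip_weight u * rmul (N - 2 - j) ?h (flip u))
     + flip_factor i * acoef (N - 2 - i) (N - 2 - j) * q ^ (wdeg (flip u) * Suc (N - 2 - j)) *
       (flip_weight u * (lraise ^^ (j - i)) h (flip u))"
    by (simp only: flip_simps flip_weight_simps rmul.simps r) (simp add: algebra_simps)
  also have "\<dots> = flip_const j * zmul j ?f (i # u)"
    using assms(3) unfolding IH 2
    by (subst zmul_Cons) (simp_all only: 1, simp_all add: algebra_simps)
  finally show ?case .
qed

text \<open>A letter prepended to the second argument acts as \<open>rmul\<close> on the first, and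
  the flip turns this into \<open>zmul\<close>, that is, into prepending the flipped letter. The
  constant depends on \<open>v\<close> only, so it passes through the linear operator
  \<open>zmul\<close>.\<close>

lemma zword_flip:
  assumes "good v"
  shows "\<exists>c. c \<noteq> 0 \<and> (\<forall>u. good u \<longrightarrow> flip_weight u * zword (flip u) v = c * zword (flip v) u)"
  using assms
proof (induction v)
  case Nil
  have "flip_weight u * zword (flip u) [] = 1 * zword (flip []) u" for u
    by (cases u) (simp_all del: zmul.simps)
  then show ?case by (intro exI[of _ 1]) simp
next
  case (Cons j v)
  then obtain c where c: "c \<noteq> 0" "\<And>u. good u \<Longrightarrow> flip_weight u * zword (flip u) v = c * zword (flip v) u"
    by auto
  have j: "j < N - 1" using Cons.prems by simp
  define j' where "j' = N - 2 - j"
  have j': "j = N - 2 - j'" "j' < N - 1" using j N3 by (auto simp: j'_def)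
  have "flip_weight u * zword (flip u) (j # v) = (flip_const j' * c) * zword (flip (j # v)) u" if u: "good u" for u
  proof -
    have "flip_weight u * zword (flip u) (j # v) = flip_weight u * rmul (N - 2 - j') (\<lambda>u. zword u v) (flip u)"
      using good_flip[of u] by (subst zword_Cons_right) (auto simp: j')
    also have "\<dots> = flip_const j' * zmul j' (\<lambda>u. flip_weight u * zword (flip u) v) u"
      using u j' by (intro rmul_flip zword_bad) auto
    also have "zmul j' (\<lambda>u. flip_weight u * zword (flip u) v) u = zmul j' (\<lambda>u. c * zword (flip v) u) u"
      using u j' by (intro zmul_cong_good c(2)) auto
    finally show ?thesis by (simp add: zmul_scale j'_def del: zmul.simps)
  qed
  then show ?case using c(1) flip_const_nz[OF j'(2)] by (intro exI[of _ "flip_const j' * c"]) auto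
qed

end

section \<open>The bigraded algebra K and its bidegrees\<close>

context qparam begin

text \<open>Bihomogeneous elements of K: \<open>i\<close> is the degree in x and \<open>b\<close>
  the degree in y.\<close>

inductive coinv :: "nat \<Rightarrow> nat \<Rightarrow> (nat list \<Rightarrow> 'k) \<Rightarrow> bool"
  where
    coinv_unit: "coinv 0 0 unit_fun"
  | coinv_zmul0: "coinv i b f \<Longrightarrow> coinv i (Suc b) (zmul0 f)"
  | coinv_raise: "coinv i b f \<Longrightarrow> coinv (Suc i) b (raise f)"
  | coinv_zero: "coinv i b (\<lambda>v. 0)"
  | coinv_add: "coinv i b f \<Longrightarrow> coinv i b g \<Longrightarrow> coinv i b (\<lambda>v. f v + g v)"
  | coinv_scale: "coinv i b f \<Longrightarrow> coinv i b (\<lambda>v. c * f v)"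

lemma coinv_diff: "coinv i b f \<Longrightarrow> coinv i b g \<Longrightarrow> coinv i b (\<lambda>v. f v - g v)"
  using coinv_add[OF _ coinv_scale[of i b g "-1"], of f] by simp

lemma zmul0_support: "(\<And>v. f v \<noteq> 0 \<Longrightarrow> length v = b \<and> sum_list v = i) \<Longrightarrow>
   zmul0 f v \<noteq> 0 \<Longrightarrow> length v = Suc b \<and> sum_list v = i"
proof (induction v arbitrary: f b i)
  case (Cons j v)
  show ?case
  proof (cases "zmul0 (\<lambda>v. f (j # v)) v = 0")
    case True
    then show ?thesis using Cons.prems by (auto split: if_splits)
  next
    case False
    have "\<exists>w. f (j # w) \<noteq> 0"
      by (rule ccontr) (use False fun_linear_zero[OF fun_linear_zmul0] in auto)
    then have ji: "j \<le> i" "0 < b" using Cons.prems(1) by fastforce+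
    have "length v = Suc (b - 1) \<and> sum_list v = i - j"
      by (rule Cons.IH[OF _ False]) (use Cons.prems(1) in fastforce)
    then show ?thesis using ji by auto
  qed
qed simp

lemma raise_support: "(\<And>v. f v \<noteq> 0 \<Longrightarrow> length v = b \<and> sum_list v = i) \<Longrightarrow>
   raise f v \<noteq> 0 \<Longrightarrow> length v = b \<and> sum_list v = Suc i"
proof (induction v arbitrary: f b i)
  case (Cons j v)
  show ?case
  proof (cases "raise (\<lambda>v. f (j # v)) v = 0")
    case True
    then show ?thesis using Cons.prems by (fastforce split: if_splits)
  next
    case False
    have "\<exists>w. f (j # w) \<noteq> 0"
      by (rule ccontr) (use False raise_zero in auto)
    then have ji: "j \<le> i" "0 < b" using Cons.prems(1) by fastforce+
    have "length v = b - 1 \<and> sum_list v = Suc (i - j)"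
      by (rule Cons.IH[OF _ False]) (use Cons.prems(1) in fastforce)
    then show ?thesis using ji by auto
  qed
qed simp

text \<open>The letter \<open>j\<close> lowers the degree in y by 1 and the degree in x by
  \<open>j\<close>; only words exhausting both leave a nonzero counit.\<close>

lemma coinv_support: "coinv i b f \<Longrightarrow> f v \<noteq> 0 \<Longrightarrow> length v = b \<and> sum_list v = i"
proof (induction arbitrary: v rule: coinv.induct)
  case (coinv_zmul0 i b f)
  show ?case by (rule zmul0_support[OF coinv_zmul0.IH coinv_zmul0.prems])
next
  case (coinv_raise i b f)
  show ?case by (rule raise_support[OF coinv_raise.IH coinv_raise.prems])
next
  case (coinv_add i b f g)
  then have "f v \<noteq> 0 \<or> g v \<noteq> 0" by auto
  then show ?case using coinv_add.IH by blast
next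
  case (coinv_scale i b f c)
  then have "f v \<noteq> 0" by auto
  then show ?case by (rule coinv_scale.IH)
next
  case coinv_unit
  then show ?case by (simp add: unit_fun_def split: if_splits)
qed simp

lemma coinv_qdeg: "coinv i b f \<Longrightarrow> qdeg f = (\<lambda>v. q ^ (i + b) * f v)"
  using coinv_support[of i b f] by (fastforce simp: qdeg_def wdeg_def add.commute)

lemma coinv_zmul: "coinv i' b f \<Longrightarrow> coinv (i + i') (Suc b) (zmul i f)"
proof (induction i arbitrary: i' f)
  case 0
  then show ?case by (simp add: coinv_zmul0)
next
  case (Suc i)
  have "coinv (Suc (i + i')) (Suc b) (raise (zmul i f))"
    using Suc by (intro coinv_raise)
  moreover have "coinv (Suc (i + i')) (Suc b) (zmul i (raise f))"
    using Suc.IH[OF coinv_raise[OF Suc.prems]] by simp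
  ultimately show ?case by (simp only: zmul.simps add_Suc) (intro coinv_diff coinv_scale)
qed

end

context qroot begin

lemma coinv_zword: "coinv (sum_list u) (length u) (zword u)"
  by (induction u) (auto intro: coinv_unit dest: coinv_zmul simp del: zmul.simps)

inductive zword_span :: "nat \<Rightarrow> nat \<Rightarrow> (nat list \<Rightarrow> 'k) \<Rightarrow> bool"
  where
    zword_span_zword: "sum_list u = i \<Longrightarrow> length u = b \<Longrightarrow> zword_span i b (zword u)"
  | zword_span_zero: "zword_span i b (\<lambda>v. 0)"
  | zword_span_add: "zword_span i b f \<Longrightarrow> zword_span i b g \<Longrightarrow> zword_span i b (\<lambda>v. f v + g v)"
  | zword_span_scale: "zword_span i b f \<Longrightarrow> zword_span i b (\<lambda>v. c * f v)"

lemma zword_span_zmul: "zword_span i b f \<Longrightarrow> zword_span (j + i) (Suc b) (zmul j f)"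
proof (induction rule: zword_span.induct)
  case (zword_span_zword u i b)
  then show ?case using zword_span.zword_span_zword[of "j # u" "j + i" "Suc b"] by simp
qed (simp_all add: fun_linearD[OF fun_linear_zmul] zword_span.intros)

lemma zword_span_raise: "zword_span i b f \<Longrightarrow> zword_span (Suc i) b (raise f)"
proof (induction rule: zword_span.induct)
  case (zword_span_zword u i b)
  then show ?case
  proof (induction u arbitrary: i b)
    case Nil
    then show ?case by (simp add: zword_span_zero)
  next
    case (Cons j u)
    have "zword_span (Suc i) b (\<lambda>v. zword (Suc j # u) v + q ^ Suc j * zmul j (raise (zword u)) v)"
    proof (intro zword_span_add zword_span_scale)
      show "zword_span (Suc i) b (zword (Suc j # u))" 
        by (rule zword_span.zword_span_zword) (use Cons.prems in auto)
      have "zword_span (Suc (sum_list u)) (length u) (raise (zword u))" by (rule Cons.IH) auto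
      from zword_span_zmul[OF this, of j] show "zword_span (Suc i) b (zmul j (raise (zword u)))"
        using Cons.prems by auto
    qed
    then show ?case by simp
  qed
qed (simp_all add: fun_linearD[OF fun_linear_raise] zword_span.intros)

text \<open>The span of the monomials in the z_i contains 1 and is stable under multiplication by y
  = z_0 and under the adjoint action of x.\<close>

lemma coinv_zspan: "coinv i b f \<Longrightarrow> zword_span i b f"
proof (induction rule: coinv.induct)
  case coinv_unit
  show ?case using zword_span_zword[of "[]"] by simp
next
  case (coinv_zmul0 i b f)
  then show ?case using zword_span_zmul[of i b f 0] by simp
qed (auto intro: zword_span.intros zword_span_raise)

lemma zword_span_nonzero:
  assumes "zword_span i b f" "f v \<noteq> 0"
  shows "\<exists>u. sum_list u = i \<and> length u = b \<and> zword u v \<noteq> 0"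
  using assms
proof (induction rule: zword_span.induct)
  case (zword_span_add i b f g)
  then have "f v \<noteq> 0 \<or> g v \<noteq> 0" by auto
  then show ?case using zword_span_add.IH by blast
qed auto

text \<open>Nonvanishing is tested on good words because \<open>embed\<close> sees no
  others.\<close>

definition coinv_supp :: "(nat \<times> nat) set"
  where "coinv_supp = {(i, b). \<exists>f v. coinv i b f \<and> good v \<and> f v \<noteq> 0}"

lemma sum_list_good: "good v \<Longrightarrow> sum_list v \<le> (N - 2) * length v"
  by (induction v) auto

lemma sum_list_flip: "good v \<Longrightarrow> sum_list (flip v) = (N - 2) * length v - sum_list v"
proof (induction v)
  case (Cons a v)
  then show ?case using sum_list_good[of v] by auto
qed simp

text \<open>A nonzero value at \<open>v\<close> yields a word \<open>u\<close> pairing nontrivially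
  with \<open>v\<close>; then \<open>flip v\<close> pairs nontrivially with \<open>flip u\<close>,
  and \<open>flip v\<close> has the reflected bidegree.\<close>

lemma coinv_supp_flip:
  assumes "(i, b) \<in> coinv_supp"
  shows "i \<le> (N - 2) * b \<and> ((N - 2) * b - i, b) \<in> coinv_supp"
proof -
  obtain f v where f: "coinv i b f" "good v" "f v \<noteq> 0" using assms by (auto simp: coinv_supp_def)
  have v: "length v = b" "sum_list v = i" using coinv_support[OF f(1,3)] by auto
  obtain u where u: "zword u v \<noteq> 0" using zword_span_nonzero[OF coinv_zspan[OF f(1)] f(3)] by blast
  then have "good u" using zword_bad by blast
  obtain c where "flip_weight (flip u) * zword (flip (flip u)) v = c * zword (flip v) (flip u)"
    using zword_flip[OF f(2)] good_flip by blast
  then have "zword (flip v) (flip u) \<noteq> 0"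
    using u flip_flip[OF \<open>good u\<close>] flip_weight_nz[OF good_flip] by auto
  moreover have "coinv ((N - 2) * b - i) b (zword (flip v))"
    using coinv_zword[of "flip v"] sum_list_flip[OF f(2)] v by (simp add: flip_def)
  ultimately show ?thesis using good_flip sum_list_good[OF f(2)] v by (auto simp: coinv_supp_def)
qed

end

context qparam begin

section \<open>The bidegrees of the Nichols algebra\<close>

definition qnum :: "nat \<Rightarrow> 'k" where "qnum n = (\<Sum>i<n. q ^ i)"

lemma qnum_simps [simp]: "qnum 0 = 0" "qnum (Suc n) = qnum n + q ^ n"
  by (simp_all add: qnum_def)

lemma qnum_mult: "qnum n * (1 - q) = 1 - q ^ n"
  by (induction n) (simp_all add: distrib_right, simp add: algebra_simps)

end

context qroot begin

text \<open>The image of \<open>k x\<^sup>j\<close> in the Nichols algebra, where \<open>k \<in> K\<close> is encoded by \<open>f\<close>.\<close>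

fun embed :: "nat \<Rightarrow> (nat list \<Rightarrow> 'k) \<Rightarrow> bool list \<Rightarrow> 'k"
  where
    "embed j f [] = (if j = 0 then f [] else 0)"
  | "embed j f (False # w) = qnum j * embed (j - 1) f w"
  | "embed j f (True # w) = q ^ j * (\<Sum>l<N - 1. embed (j + l) (\<lambda>v. f (l # v)) w)"

lemma fun_linear_embed: "fun_linear (embed j)"
proof (rule fun_linearI)
  show "embed j (\<lambda>v. f v + g v) w = embed j f w + embed j g w" for f g w
  proof (induction w arbitrary: j f g)
    case (Cons a w)
    then show ?case by (cases a) (simp_all add: algebra_simps sum.distrib)
  qed simp
  show "embed j (\<lambda>v. c * f v) w = c * embed j f w" for c f w
  proof (induction w arbitrary: j f)
    case (Cons a w)
    then show ?case by (cases a) (simp_all add: algebra_simps sum_distrib_left)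
  qed simp
qed

lemmas embed_add = fun_linear_add[OF fun_linear_embed]
  and embed_scale = fun_linear_scale[OF fun_linear_embed]
  and embed_zero = fun_linear_zero[OF fun_linear_embed]

lemma qnum_N: "qnum N = 0"
  using qnum_mult[of N] qN q_less[of 1] N3 by simp

lemma qnum_nz: "0 < n \<Longrightarrow> n < N \<Longrightarrow> qnum n \<noteq> 0"
  using qnum_mult[of n] q_less[of n] by auto

text \<open>The relation \<open>x ^ N = 0\<close>: derivatives along y never lower the exponent, and
  descending below \<open>N\<close> along x costs the factor \<open>qnum N = 0\<close>.\<close>

lemma embed_ge: "N \<le> j \<Longrightarrow> embed j f w = 0"
proof (induction w arbitrary: j f)
  case Nil
  then show ?case using N3 by simp
next
  case (Cons a w)
  show ?case
  proof (cases a)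
    case True
    then show ?thesis using Cons by simp
  next
    case False
    then show ?thesis using Cons by (cases "j = N") (simp_all add: qnum_N)
  qed
qed

lemma embed_good_zero: "(\<And>v. good v \<Longrightarrow> f v = 0) \<Longrightarrow> embed j f w = 0"
proof (induction w arbitrary: j f)
  case (Cons a w)
  show ?case
  proof (cases a)
    case True
    have "embed (j + l) (\<lambda>v. f (l # v)) w = 0" if "l < N - 1" for l
      by (rule Cons.IH, rule Cons.prems) (use that in auto)
    then show ?thesis using True by simp
  next
    case False
    then show ?thesis using Cons by simp
  qed
qed simp

lemma letter_mult_sum: "letter_mult j (\<lambda>v. \<Sum>x\<in>A. f x v) v = (\<Sum>x\<in>A. letter_mult j (f x) v)"
  by (rule fun_linear_sum[OF fun_linear_letter_mult])

lemma embed_qdeg: "q ^ j * embed j (qdeg f) w = q ^ length w * embed j f w"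
proof (induction w arbitrary: j f)
  case (Cons a w)
  show ?case
  proof (cases a)
    case True
    have "q ^ (j + l) * embed (j + l) (\<lambda>v. qdeg f (l # v)) w * q ^ j
        = q * (q ^ length w * embed (j + l) (\<lambda>v. f (l # v)) w * q ^ (j + l))" for l
      unfolding qdeg_Cons embed_scale Cons[symmetric] by (simp add: power_add mult_ac)
    then have "embed (j + l) (\<lambda>v. qdeg f (l # v)) w * q ^ j
        = q ^ Suc (length w) * embed (j + l) (\<lambda>v. f (l # v)) w" for l
        using q_nz by simp
    then show ?thesis using True by (simp add: sum_distrib_left sum_distrib_right mult_ac)
  next
    case False
    then show ?thesis using Cons[of "j - 1" f] by (cases j) (simp_all add: mult_ac)
  qed
qed (simp add: qdeg_def)

text \<open>In the algebra: \<open>y (k x^j) = (y k) x^j\<close>.\<close>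

lemma letter_mult_True_embed: "letter_mult True (embed j f) w = embed j (zmul0 f) w"
proof (induction w arbitrary: j f)
  case (Cons a w)
  show ?case
  proof (cases a)
    case True
    have "letter_mult True (embed j f) (True # w) = q ^ j * (\<Sum>l<N - 1. embed (j + l) (zmul0 (\<lambda>v. f (l # v))) w)
        + q ^ length w * embed j f w"
      by (simp add: letter_mult_scale letter_mult_sum Cons)
    moreover have "embed j (zmul0 f) (True # w) =
       q ^ j * (\<Sum>l<N - 1. embed (j + l) (zmul0 (\<lambda>v. f (l # v))) w + (if l = 0 then embed j (qdeg f) w else 0))"
    proof -
      have "embed (j + l) (\<lambda>v. zmul0 f (l # v)) w =
        embed (j + l) (zmul0 (\<lambda>v. f (l # v))) w + (if l = 0 then embed j (qdeg f) w else 0)" for l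
        by (cases "l = 0") (simp_all add: embed_add qdeg_def[abs_def])
      then show ?thesis by simp
    qed
    ultimately show ?thesis
      using True N3 embed_qdeg[of j f w] by (simp add: sum.distrib distrib_left)
  next
    case False
    then show ?thesis using Cons by (simp add: letter_mult_scale)
  qed
qed simp

text \<open>In the algebra, with \<open>n\<close> the degree of \<open>k\<close>:
  \<open>x k x^j = (ad x)(k) x^j + q^n k x^(j+1)\<close>.\<close>

lemma letter_mult_False_embed: "letter_mult False (embed j f) w = embed j (raise f) w + embed (Suc j) (qdeg f) w"
proof (induction w arbitrary: j f)
  case (Cons a w)
  show ?case
  proof (cases a)
    case True
    define e where "e l = embed (Suc (j + l)) (qdeg (\<lambda>v. f (l # v))) w" for l
    define t where "t l = embed (j + l) (raise (\<lambda>v. f (l # v))) w" for l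
    have 1: "letter_mult False (embed j f) (True # w) = q ^ j * (\<Sum>l<N - 1. t l + e l)"
      by (simp add: letter_mult_scale letter_mult_sum Cons e_def t_def)
    have "embed (j + l) (\<lambda>v. raise f (l # v)) w = t l + (if l = 0 then 0 else (1 - q ^ Suc l) * e (l - 1))" for l
      by (cases "l = 0") (simp_all add: raise_Cons embed_add embed_scale t_def e_def del: raise.simps power_Suc)
    then have 2: "embed j (raise f) (True # w)
       = q ^ j * (\<Sum>l<N - 1. t l + (if l = 0 then 0 else (1 - q ^ Suc l) * e (l - 1)))"
      by (simp only: embed.simps)
    have 3: "embed (Suc j) (qdeg f) (True # w) = q ^ j * (\<Sum>l<N - 1. q ^ Suc (Suc l) * e l)"
      by (simp add: qdeg_Cons embed_scale e_def sum_distrib_left mult_ac)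
    define M where "M = N - 2"
    have M: "N - 1 = Suc M" "N = Suc (Suc M)" using N3 by (simp_all add: M_def)
    have qM: "q ^ Suc (Suc M) = 1" using qN M(2) by simp
    have "(\<Sum>l<N - 1. if l = 0 then 0 else (1 - q ^ Suc l) * e (l - 1)) = (\<Sum>l<M. (1 - q ^ Suc (Suc l)) * e l)"
      unfolding M(1) by (subst sum.lessThan_Suc_shift) simp
    \<comment> \<open>The term of index \<open>N - 2\<close> may be added because
      \<open>1 - q ^ N = 0\<close>; this makes the truncation in \<open>embed\<close>
      consistent.\<close>
    also have "\<dots> = (\<Sum>l<N - 1. (1 - q ^ Suc (Suc l)) * e l)"
      unfolding M(1) sum.lessThan_Suc qM by simp
    finally have "(\<Sum>l<N - 1. if l = 0 then 0 else (1 - q ^ Suc l) * e (l - 1)) + (\<Sum>l<N - 1. q ^ Suc (Suc l) * e l)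
       = (\<Sum>l<N - 1. e l)"
      by (simp add: left_diff_distrib sum_subtractf del: power_Suc)
    then have "(\<Sum>l<N - 1. t l + e l) = (\<Sum>l<N - 1. t l + (if l = 0 then 0 else (1 - q ^ Suc l) * e (l - 1)))
       + (\<Sum>l<N - 1. q ^ Suc (Suc l) * e l)"
      by (simp only: sum.distrib add.assoc)
    then show ?thesis using True 1 2 3 by (simp only: distrib_left)
  next
    case False
    have "letter_mult False (embed j f) (False # w) = qnum j * (embed (j - 1) (raise f) w + embed (Suc (j - 1)) (qdeg f) w)
       + q ^ j * embed j (qdeg f) w"
      by (simp add: letter_mult_scale Cons embed_qdeg)
    then show ?thesis using False by (cases j) (simp_all add: algebra_simps)
  qed
qed (simp add: qdeg_def)

lemma embed_unit_pow: "embed (Suc j) unit_fun = letter_mult False (embed j unit_fun)"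
  by (rule ext) (simp add: letter_mult_False_embed embed_zero)

lemma embed_unit: "embed 0 unit_fun = unit_fun"
proof
  fix w show "embed 0 unit_fun w = unit_fun w"
  proof (cases w)
    case (Cons a w')
    then show ?thesis by (cases a) (simp_all add: embed_zero)
  qed simp
qed

end

section \<open>The bidegrees of A\<close>

context qparam begin

inductive shuffle_alg :: "nat \<Rightarrow> nat \<Rightarrow> (bool list \<Rightarrow> 'k) \<Rightarrow> bool"
  where
    shuffle_alg_word: "count_list u False = a \<Longrightarrow> count_list u True = b \<Longrightarrow> shuffle_alg a b (shuffle_word u)"
  | shuffle_alg_zero: "shuffle_alg a b (\<lambda>v. 0)"
  | shuffle_alg_add: "shuffle_alg a b f \<Longrightarrow> shuffle_alg a b g \<Longrightarrow> shuffle_alg a b (\<lambda>v. f v + g v)"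
  | shuffle_alg_scale: "shuffle_alg a b f \<Longrightarrow> shuffle_alg a b (\<lambda>v. c * f v)"

lemma shuffle_alg_diff: "shuffle_alg a b f \<Longrightarrow> shuffle_alg a b g \<Longrightarrow> shuffle_alg a b (\<lambda>v. f v - g v)"
  using shuffle_alg_add[OF _ shuffle_alg_scale[of a b g "-1"], of f] by simp

lemma shuffle_alg_lm: "shuffle_alg a b f \<Longrightarrow> shuffle_alg (if j then a else Suc a) (if j then Suc b else b) (letter_mult j f)"
proof (induction rule: shuffle_alg.induct)
  case (shuffle_alg_word u a b)
  then show ?case using shuffle_alg.shuffle_alg_word[of "j # u"] by (cases j) auto
qed (simp_all only: fun_linearD[OF fun_linear_letter_mult] shuffle_alg_zero shuffle_alg_add shuffle_alg_scale)

definition shuffle_supp :: "(nat \<times> nat) set"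
  where "shuffle_supp = {(count_list u False, count_list u True) |u. shuffle_word u \<noteq> (\<lambda>v. 0)}"

lemma shuffle_alg_nonzero: "shuffle_alg a b f \<Longrightarrow> f v \<noteq> 0 \<Longrightarrow> (a, b) \<in> shuffle_supp"
proof (induction rule: shuffle_alg.induct)
  case (shuffle_alg_add a b f g)
  then have "f v \<noteq> 0 \<or> g v \<noteq> 0" by auto
  then show ?case using shuffle_alg_add.IH by blast
qed (auto simp: shuffle_supp_def fun_eq_iff)

lemma shuffle_supp_swap:
  assumes "(a, b) \<in> shuffle_supp"
  shows "(b, a) \<in> shuffle_supp"
proof -
  obtain u v where u: "a = count_list u False" "b = count_list u True" "shuffle_word u v \<noteq> 0"
    using assms by (auto simp: shuffle_supp_def fun_eq_iff)
  have "count_list (map Not u) c = count_list u (\<not> c)" for c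
    by (induction u) auto
  moreover have "shuffle_word (map Not u) (map Not v) \<noteq> 0"
    using u(3) by (simp add: shuffle_word_map_Not)
  ultimately show ?thesis using shuffle_alg_nonzero[OF shuffle_alg_word[of "map Not u"]] u(1,2) by simp
qed

lemma shuffle_supp_0: "(0, 0) \<in> shuffle_supp"
  using shuffle_alg_nonzero[OF shuffle_alg_word[of "[]"], of 0 0 "[]"] by simp

end

section \<open>A as the direct sum of the K x^j with j < N\<close>

context qroot begin

text \<open>For \<open>raise\<close>, the formula for \<open>x k x^j\<close> is solved for
  \<open>(ad x)(k) x^j\<close>. This involves \<open>k x^(j+1)\<close>, hence the arbitrary
  \<open>j\<close>.\<close>

lemma coinv_embed: "coinv i b f \<Longrightarrow> shuffle_alg (i + j) b (embed j f)"
proof (induction arbitrary: j rule: coinv.induct)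
  case coinv_unit
  show ?case
  proof (induction j)
    case 0
    show ?case using shuffle_alg_word[of "[]" 0 0] by (simp add: embed_unit)
  next
    case (Suc j)
    then show ?case using shuffle_alg_lm[of j 0 "embed j unit_fun" False] by (simp add: embed_unit_pow)
  qed
next
  case (coinv_zmul0 i b f)
  have "embed j (zmul0 f) = letter_mult True (embed j f)" by (rule ext) (simp add: letter_mult_True_embed)
  then show ?case using shuffle_alg_lm[OF coinv_zmul0.IH, of True j] by simp
next
  case (coinv_raise i b f)
  have "embed j (raise f) = (\<lambda>w. letter_mult False (embed j f) w - q ^ (i + b) * embed (Suc j) f w)"
    by (rule ext) (simp add: letter_mult_False_embed coinv_qdeg[OF coinv_raise.hyps] embed_scale)
  moreover have "shuffle_alg (Suc i + j) b (letter_mult False (embed j f))"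
    using shuffle_alg_lm[OF coinv_raise.IH, of False j] by simp
  moreover have "shuffle_alg (Suc i + j) b (embed (Suc j) f)"
    using coinv_raise.IH[of "Suc j"] by simp
  ultimately show ?case by (simp add: shuffle_alg_diff shuffle_alg_scale)
qed (simp_all add: fun_linearD[OF fun_linear_embed] shuffle_alg.intros)

text \<open>The q-analogue of the falling factorial: the coefficient in the \<open>r\<close>-th
  derivative of \<open>x ^ l\<close>.\<close>

fun qfall :: "nat \<Rightarrow> nat \<Rightarrow> 'k"
  where "qfall l 0 = 1" | "qfall l (Suc r) = qnum l * qfall (l - 1) r"

lemma embed_replicate: "embed l f (replicate r False @ w) = qfall l r * embed (l - r) f w"
  by (induction r arbitrary: l) simp_all

lemma qfall_lt: "l < r \<Longrightarrow> qfall l r = 0"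
  by (induction l r rule: qfall.induct) (auto, metis One_nat_def less_Suc_eq_0_disj not_less_eq diff_Suc_1 qnum_simps(1))

lemma qfall_diag: "l < N \<Longrightarrow> qfall l l \<noteq> 0"
  by (induction l) (simp_all del: qnum_simps(2) add: qnum_nz)

text \<open>The sum of the K x^l is direct. Differentiating \<open>l\<close> times along x and once
  along y gives a relation of the same form for a shorter word; descending in \<open>l\<close>
  leaves one unknown term.\<close>

lemma embed_indep:
  assumes "\<And>w. (\<Sum>l<N. embed l (f l) w) = 0" "l < N" "good v"
  shows "f l v = 0"
  using assms
proof (induction v arbitrary: f l)
  case Nil
  have "embed l' (f l') (replicate l False) = (if l' = l then qfall l l * f l [] else 0)" for l'
    using embed_replicate[of l' "f l'" l "[]"] by (cases "l' < l") (auto simp: qfall_lt)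
  then have "(\<Sum>l'<N. embed l' (f l') (replicate l False)) = qfall l l * f l []"
    using Nil.prems(2) by simp
  then show ?case using Nil.prems qfall_diag[of l] by simp
next
  case (Cons t v)
  have "\<forall>k<N - 1. f l (k # v) = 0" if "l < N" for l
    using that
  proof (induction "N - l" arbitrary: l rule: less_induct)
    case less
    have above: "f l' (k # v) = 0" if "l < l'" "l' < N" "k < N - 1" for l' k
      using less.hyps[of l'] that by auto
    \<comment> \<open>The coefficient produced by these derivatives. It vanishes for
      \<open>l' < l\<close>, so the truncated subtraction is harmless.\<close>
    define c where "c l' = qfall l' l * q ^ (l' - l)" for l'
    \<comment> \<open>The part of the new relation in front of \<open>x ^ s\<close>. Exponents from
      \<open>N\<close> on contribute nothing by \<open>embed_ge\<close>.\<close>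
    define g where "g s = (\<lambda>v. \<Sum>l'<N. \<Sum>k<N - 1. (if l' - l + k = s then c l' else 0) * f l' (k # v))" for s
    have "(\<Sum>s<N. embed s (g s) w) = 0" for w
    proof -
      have g: "embed s (g s) w = (\<Sum>l'<N. \<Sum>k<N - 1. (if l' - l + k = s then c l' else 0) * embed s (\<lambda>v. f l' (k # v)) w)" for s
        unfolding g_def by (simp only: fun_linear_sum[OF fun_linear_embed] embed_scale)
      have "(\<Sum>s<N. embed s (g s) w) = (\<Sum>l'<N. \<Sum>k<N - 1. \<Sum>s<N. (if l' - l + k = s then c l' else 0) * embed s (\<lambda>v. f l' (k # v)) w)"
        unfolding g by (subst sum.swap, rule sum.cong[OF refl], subst sum.swap) rule
      also have "\<dots> = (\<Sum>l'<N. \<Sum>k<N - 1. c l' * embed (l' - l + k) (\<lambda>v. f l' (k # v)) w)"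
      proof (intro sum.cong refl)
        fix l' k
        let ?t = "l' - l + k"
        have "(\<Sum>s<N. (if ?t = s then c l' else 0) * embed s (\<lambda>v. f l' (k # v)) w)
          = (\<Sum>s<N. if ?t = s then c l' * embed s (\<lambda>v. f l' (k # v)) w else 0)"
          by (intro sum.cong) auto
        also have "\<dots> = c l' * embed ?t (\<lambda>v. f l' (k # v)) w"
          by (auto simp: embed_ge)
        finally show "(\<Sum>s<N. (if ?t = s then c l' else 0) * embed s (\<lambda>v. f l' (k # v)) w)
          = c l' * embed ?t (\<lambda>v. f l' (k # v)) w" .
      qed
      also have "\<dots> = (\<Sum>l'<N. embed l' (f l') (replicate l False @ True # w))"
        unfolding embed_replicate embed.simps c_def by (simp only: sum_distrib_left mult.assoc)
      also have "\<dots> = 0" by (rule Cons.prems)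
      finally show ?thesis .
    qed
    then have gv: "g s v = 0" if "s < N" for s
      using Cons.IH[of g s] Cons.prems(3) that by auto
    show ?case
    proof (intro allI impI)
      fix k assume k: "k < N - 1"
      \<comment> \<open>Indices below \<open>l\<close> have coefficient 0 and those above
        \<open>l\<close> are already treated, so only \<open>l' = l\<close> remains.\<close>
      have "0 = g k v" using gv k by simp
      also have "\<dots> = (\<Sum>l'<N. if l' = l then qfall l l * f l (k # v) else 0)"
        unfolding g_def
      proof (intro sum.cong refl)
        fix l' assume l': "l' \<in> {..<N}"
        consider "l' < l" | "l' = l" | "l' > l" by linarith
        then show "(\<Sum>k'<N - 1. (if l' - l + k' = k then c l' else 0) * f l' (k' # v))
          = (if l' = l then qfall l l * f l (k # v) else 0)"
        proof cases
          case 1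
          then have "c l' = 0" by (simp add: c_def qfall_lt)
          then show ?thesis using 1 by (auto intro!: sum.neutral)
        next
          case 2
          have "(\<Sum>k'<N - 1. (if k' = k then c l else 0) * f l (k' # v))
            = (\<Sum>k'<N - 1. if k' = k then c l * f l (k # v) else 0)"
            by (intro sum.cong) auto
          with k show ?thesis unfolding 2 by (simp add: c_def)
        next
          case 3
          then show ?thesis using l' by (auto intro!: sum.neutral above)
        qed
      qed
      also have "\<dots> = qfall l l * f l (k # v)" using less.prems by simp
      finally show "f l (k # v) = 0" using qfall_diag[OF less.prems] by simp
    qed
  qed
  then show ?case using Cons.prems by simp
qed

lemma coinv_supp_asupp:
  assumes "(i, b) \<in> coinv_supp" "j < N"
  shows "(i + j, b) \<in> shuffle_supp"
proof -
  obtain f v where f: "coinv i b f" "good v" "f v \<noteq> 0" using assms by (auto simp: coinv_supp_def)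
  obtain w where "embed j f w \<noteq> 0"
  proof (rule ccontr)
    assume *: "\<not> thesis"
    have "(\<Sum>l<N. embed l (if l = j then f else (\<lambda>v. 0)) w) = 0" for w
      by (rule sum.neutral) (use * that in \<open>auto simp: embed_zero\<close>)
    from embed_indep[of "\<lambda>l. if l = j then f else (\<lambda>v. 0)", OF this assms(2) f(2)] f(3)
    show False by simp
  qed
  then show ?thesis using shuffle_alg_nonzero[OF coinv_embed[OF f(1)]] by blast
qed

inductive embed_span :: "nat \<Rightarrow> nat \<Rightarrow> (bool list \<Rightarrow> 'k) \<Rightarrow> bool"
  where
    embed_span_embed: "coinv i b f \<Longrightarrow> a = i + j \<Longrightarrow> embed_span a b (embed j f)"
  | embed_span_add: "embed_span a b f \<Longrightarrow> embed_span a b g \<Longrightarrow> embed_span a b (\<lambda>v. f v + g v)"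

lemma embed_span_lm: "embed_span a b f \<Longrightarrow> embed_span (if j then a else Suc a) (if j then Suc b else b) (letter_mult j f)"
proof (induction rule: embed_span.induct)
  case (embed_span_embed i b f a l)
  show ?case
  proof (cases j)
    case True
    have "letter_mult True (embed l f) = embed l (zmul0 f)" by (rule ext) (rule letter_mult_True_embed)
    then show ?thesis using True embed_span_embed coinv_zmul0 embed_span.embed_span_embed by simp
  next
    case False
    have e: "letter_mult False (embed l f) = (\<lambda>w. embed l (raise f) w + embed (Suc l) (qdeg f) w)"
      by (rule ext) (rule letter_mult_False_embed)
    have "embed_span (Suc a) b (embed l (raise f))"
      using embed_span_embed coinv_raise[OF embed_span_embed(1)]
      by (intro embed_span.embed_span_embed[of "Suc i"]) auto
    moreover have "coinv i b (qdeg f)"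
      unfolding coinv_qdeg[OF embed_span_embed(1)] using embed_span_embed(1) by (rule coinv_scale)
    then have "embed_span (Suc a) b (embed (Suc l) (qdeg f))"
      using embed_span_embed by (intro embed_span.embed_span_embed) auto
    ultimately show ?thesis using False by (simp add: e embed_span_add)
  qed
qed (simp add: fun_linearD[OF fun_linear_letter_mult] embed_span_add)

text \<open>The sums of the K x^j contain 1 and are stable under left multiplication by both
  letters, so they exhaust A.\<close>

lemma embed_span_word: "embed_span (count_list u False) (count_list u True) (shuffle_word u)"
proof (induction u)
  case Nil
  show ?case using embed_span_embed[OF coinv_unit, of 0 0] by (simp add: embed_unit)
next
  case (Cons j u)
  from embed_span_lm[OF this, of j] show ?case by (cases j) simp_all
qed

lemma embed_span_nonzero:
  "embed_span a b f \<Longrightarrow> f v \<noteq> 0 \<Longrightarrow> \<exists>j<N. j \<le> a \<and> (a - j, b) \<in> coinv_supp"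
proof (induction rule: embed_span.induct)
  case (embed_span_embed i b f a j)
  have "j < N" using embed_ge[of j f v] embed_span_embed by (meson not_le)
  moreover have "\<exists>v. good v \<and> f v \<noteq> 0" using embed_good_zero[of f j v] embed_span_embed(3) by blast
  ultimately have "(i, b) \<in> coinv_supp" using embed_span_embed by (auto simp: coinv_supp_def)
  then show ?case using \<open>j < N\<close> embed_span_embed(2) by (intro exI[of _ j]) simp
next
  case (embed_span_add a b f g)
  then have "f v \<noteq> 0 \<or> g v \<noteq> 0" by auto
  then show ?case using embed_span_add.IH by blast
qed

lemma shuffle_supp_ksupp:
  assumes "(a, b) \<in> shuffle_supp"
  shows "\<exists>j<N. j \<le> a \<and> (a - j, b) \<in> coinv_supp"
proof -
  obtain u v where "a = count_list u False" "b = count_list u True" "shuffle_word u v \<noteq> 0"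
    using assms by (auto simp: shuffle_supp_def fun_eq_iff)
  then show ?thesis using embed_span_nonzero[OF embed_span_word] by blast
qed

section \<open>The two symmetries of the bidegrees against each other\<close>

text \<open>Let \<open>(i, b)\<close> be the bidegree of the factor in K. Swapping in A and
  reflecting in K give \<open>b \<le> i + 4\<close>; the same for the reflected bidegree is
  \<open>b \<le> (b - i) + 4\<close>. Hence \<open>i \<le> 4\<close>, \<open>b \<le> 8\<close> and
  \<open>a \<le> i + 2\<close>, with sum at most 14.\<close>

lemma shuffle_supp_bounded:
  assumes "N = 3" "(a, b) \<in> shuffle_supp"
  shows "a + b \<le> 14"
proof -
  obtain j where j: "j < N" "j \<le> a" "(a - j, b) \<in> coinv_supp" using shuffle_supp_ksupp[OF assms(2)] by blast
  have le: "b \<le> i + 4" if "(i, b) \<in> coinv_supp" for i b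
  proof -
    have "(b, i + 2) \<in> shuffle_supp" using coinv_supp_asupp[OF that, of 2] assms(1) shuffle_supp_swap by simp
    then obtain j where "j < N" "j \<le> b" "(b - j, i + 2) \<in> coinv_supp" using shuffle_supp_ksupp by blast
    moreover from this have "b - j \<le> (N - 2) * (i + 2)" using coinv_supp_flip by blast
    ultimately show ?thesis using assms(1) by simp
  qed
  have "a - j \<le> b" "(b - (a - j), b) \<in> coinv_supp" using coinv_supp_flip[OF j(3)] assms(1) by simp_all
  then show ?thesis using le[OF j(3)] le[of "b - (a - j)" b] j(1,2) assms(1) by linarith
qed

text \<open>At a maximum of \<open>a + b\<close> with \<open>a \<le> b\<close>, the reflected factor
  in K times \<open>x ^ (N - 1)\<close> also lives in A. Its total degree is at least
  \<open>2 b - (a - j) + (N - 1) + b\<close>, which exceeds \<open>a + b\<close>.\<close>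

lemma shuffle_supp_infinite:
  assumes "N \<ge> 4"
  shows "infinite shuffle_supp"
proof
  assume fin: "finite shuffle_supp"
  let ?S = "(\<lambda>(a, b). a + b) ` shuffle_supp"
  have S: "finite ?S" "?S \<noteq> {}" using fin shuffle_supp_0 by auto
  obtain a b where ab: "(a, b) \<in> shuffle_supp" "a + b = Max ?S" using Max_in[OF S] by auto
  have max: "a' + b' \<le> a + b" if "(a', b') \<in> shuffle_supp" for a' b'
    unfolding ab(2) using that S(1) by (intro Max_ge) (auto intro!: image_eqI[of _ _ "(a', b')"])
  have "\<exists>a b. (a, b) \<in> shuffle_supp \<and> a \<le> b \<and> (\<forall>a' b'. (a', b') \<in> shuffle_supp \<longrightarrow> a' + b' \<le> a + b)"
  proof (cases "a \<le> b")
    case True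
    then show ?thesis using ab(1) max by blast
  next
    case False
    then show ?thesis using shuffle_supp_swap[OF ab(1)] max by (intro exI[of _ b] exI[of _ a]) (auto simp: add.commute)
  qed
  then obtain a b where ab: "(a, b) \<in> shuffle_supp" "a \<le> b" and max: "\<And>a' b'. (a', b') \<in> shuffle_supp \<Longrightarrow> a' + b' \<le> a + b"
    by blast
  obtain j where j: "j < N" "j \<le> a" "(a - j, b) \<in> coinv_supp" using shuffle_supp_ksupp[OF ab(1)] by blast
  have "(a - j) + (N - 1) + b \<le> a + b"
    using assms by (intro max coinv_supp_asupp j) auto
  moreover have "((N - 2) * b - (a - j)) + (N - 1) + b \<le> a + b" "a - j \<le> (N - 2) * b"
    using assms coinv_supp_flip[OF j(3)] by (intro max coinv_supp_asupp | simp)+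
  moreover have "2 * b \<le> (N - 2) * b" using assms by (intro mult_le_mono1) simp
  ultimately show False using ab(2) assms by linarith
qed

end

section \<open>Nilpotency of A in terms of the order of q\<close>

context qparam begin

lemma letter_mult_lm_comm:
  assumes "q = 1"
  shows "letter_mult i (letter_mult j f) v = letter_mult j (letter_mult i f) v"
proof (induction v arbitrary: f)
  case (Cons a v)
  have qn: "q ^ n = 1" for n using assms by simp
  have *: "(\<lambda>v. letter_mult k f (a # v)) = (\<lambda>v. letter_mult k (\<lambda>v. f (a # v)) v + (if a = k then 1 else 0) * f v)" for k
    by (rule ext) (simp add: qn)
  show ?case unfolding letter_mult.simps(2)[of i "letter_mult j f"] letter_mult.simps(2)[of j "letter_mult i f"] * letter_mult_add letter_mult_scale
    using Cons[of "\<lambda>v. f (a # v)"] by (auto simp: qn)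
qed simp

text \<open>The Leibniz rule produces the term \<open>letter_mult j f\<close> twice, and twice
  anything is 0.\<close>

lemma letter_mult_lm_zero:
  assumes "q = 1" "(2 :: 'k) = 0"
  shows "letter_mult j (letter_mult j f) v = 0"
proof (induction v arbitrary: f)
  case (Cons a v)
  have qn: "q ^ n = 1" for n using assms by simp
  have *: "(\<lambda>v. letter_mult j f (a # v)) = (\<lambda>v. letter_mult j (\<lambda>v. f (a # v)) v + (if a = j then 1 else 0) * f v)"
    by (rule ext) (simp add: qn)
  have "x + x = 0" for x :: 'k unfolding mult_2[symmetric] assms(2) by simp
  then show ?case unfolding letter_mult.simps(2)[of j "letter_mult j f"] * letter_mult_add letter_mult_scale
    using Cons[of "\<lambda>v. f (a # v)"] by (auto simp: qn)
qed simp

text \<open>Among three letters two coincide; commuting them together gives a square.\<close>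

lemma shuffle_word_q1:
  assumes "q = 1" "(2 :: 'k) = 0" "length u \<ge> 3"
  shows "shuffle_word u = (\<lambda>w. 0)"
proof -
  obtain a b c v where u: "u = a # b # c # v"
    using assms(3) by (auto simp: Suc_le_length_iff numeral_3_eq_3)
  have z: "letter_mult j (letter_mult j f) = (\<lambda>v. 0)" for j f using letter_mult_lm_zero[OF assms(1,2)] by blast
  have c: "letter_mult i (letter_mult j f) = letter_mult j (letter_mult i f)" for i j f using letter_mult_lm_comm[OF assms(1)] by blast
  have 0: "letter_mult j (\<lambda>v. 0) = (\<lambda>v. 0)" for j by (rule ext) (rule letter_mult_zero)
  consider "a = b" | "b = c" | "a = c" by blast
  then show ?thesis
  proof cases
    case 3
    then show ?thesis by (simp add: u c[of b c] z)
  qed (simp_all add: u z 0)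
qed

text \<open>This q-factorial is the pairing of \<open>x ^ n\<close> with itself; it shows that no
  power of x vanishes unless q is 1 or a root of unity.\<close>

lemma shuffle_word_replicate:
  "shuffle_word (replicate n False) (replicate n False) = (\<Prod>k=1..n. qnum k)"
proof -
  have 1: "letter_mult False f (replicate (Suc n) False) = qnum (Suc n) * f (replicate n False)" for f n
  proof (induction n arbitrary: f)
    case (Suc n)
    show ?case
      using Suc[of "\<lambda>v. f (False # v)"] by (simp add: algebra_simps)
  qed simp
  show ?thesis
  proof (induction n)
    case (Suc n)
    have "shuffle_word (replicate (Suc n) False) (replicate (Suc n) False)
        = letter_mult False (shuffle_word (replicate n False)) (replicate (Suc n) False)" by simp
    also have "\<dots> = (\<Prod>k=1..Suc n. qnum k)" unfolding 1 Suc by (simp add: mult.commute)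
    finally show ?case .
  qed simp
qed

text \<open>Finite dimensionality of A in the form that transfers to \<open>T(V)/J\<close>.\<close>

definition nilpotent_words :: bool
  where "nilpotent_words \<longleftrightarrow> (\<exists>L. \<forall>u. length u \<ge> L \<longrightarrow> shuffle_word u = (\<lambda>w. 0))"

lemma shuffle_supp_finite_iff: "nilpotent_words \<longleftrightarrow> finite shuffle_supp"
proof
  assume nilpotent_words
  then obtain L where L: "\<And>u. length u \<ge> L \<Longrightarrow> shuffle_word u = (\<lambda>w. 0)"
    by (auto simp: nilpotent_words_def)
  have "shuffle_supp \<subseteq> {..L} \<times> {..L}"
  proof
    fix x assume "x \<in> shuffle_supp"
    then obtain u where u: "x = (count_list u False, count_list u True)" "shuffle_word u \<noteq> (\<lambda>v. 0)"
      by (auto simp: shuffle_supp_def)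
    then have "length u < L" using L[of u] by (meson not_le)
    then show "x \<in> {..L} \<times> {..L}"
      using count_le_length[of u False] count_le_length[of u True] u by auto
  qed
  then show "finite shuffle_supp" by (rule finite_subset) auto
next
  assume fin: "finite shuffle_supp"
  let ?L = "Suc (Max ((\<lambda>(a, b). a + b) ` shuffle_supp))"
  have "shuffle_word u = (\<lambda>w. 0)" if "length u \<ge> ?L" for u
  proof (rule ccontr)
    assume "shuffle_word u \<noteq> (\<lambda>w. 0)"
    then have "(count_list u False, count_list u True) \<in> shuffle_supp" by (auto simp: shuffle_supp_def)
    then have "count_list u False + count_list u True \<in> (\<lambda>(a, b). a + b) ` shuffle_supp"
      by (rule image_eqI[rotated]) simp
    then have "count_list u False + count_list u True \<le> Max ((\<lambda>(a, b). a + b) ` shuffle_supp)"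
      using fin by (intro Max_ge) auto
    moreover have "length u = count_list u False + count_list u True" by (induction u) auto
    ultimately show False using that by simp
  qed
  then show nilpotent_words by (auto simp: nilpotent_words_def)
qed

theorem nilpotent_words_iff:
  assumes two: "(2 :: 'k) = 0" and "q \<noteq> 0"
  shows "nilpotent_words \<longleftrightarrow> q = 1 \<or> (q ^ 3 = 1 \<and> q \<noteq> 1)"
proof (cases "q = 1")
  case True
  have nilpotent_words
    unfolding nilpotent_words_def using shuffle_word_q1[OF True two] by blast
  then show ?thesis using True by blast
next
  case False
  show ?thesis
  proof (cases "\<exists>n>0. q ^ n = 1")
    case no: False
    have "shuffle_word (replicate n False) \<noteq> (\<lambda>w. 0)" for n
    proof -
      have "qnum k \<noteq> 0" if "k > 0" for k
      proof -
        have "q ^ k \<noteq> 1" using no that by blast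
        then show ?thesis using qnum_mult[of k] by auto
      qed
      then have "shuffle_word (replicate n False) (replicate n False) \<noteq> 0"
        by (simp add: shuffle_word_replicate)
      then show ?thesis by auto
    qed
    then have "\<not> nilpotent_words" by (metis nilpotent_words_def length_replicate order_refl)
    moreover have "q ^ 3 \<noteq> 1" using no by (meson zero_less_numeral)
    ultimately show ?thesis using False by blast
  next
    case True
    define N where "N = (LEAST n. n > 0 \<and> q ^ n = 1)"
    have N: "N > 0" "q ^ N = 1" using LeastI_ex[OF True] by (auto simp: N_def)
    have least: "q ^ k \<noteq> 1" if "0 < k" "k < N" for k
      using not_less_Least[of k "\<lambda>n. n > 0 \<and> q ^ n = 1"] that by (auto simp: N_def)
    have "N \<noteq> 1" using N False by auto
    \<comment> \<open>In characteristic 2, \<open>q ^ 2 - 1\<close> is the square of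
      \<open>q - 1\<close>.\<close>
    moreover have "N \<noteq> 2"
    proof
      assume "N = 2"
      then have "(q - 1) ^ 2 = 0" using N two by (simp add: power2_diff)
      then show False using False by simp
    qed
    ultimately have N3: "N \<ge> 3" using N(1) by linarith
    interpret qroot q N by unfold_locales (use N N3 least in auto)
    show ?thesis
    proof (cases "N = 3")
      case True
      have "shuffle_supp \<subseteq> {..14} \<times> {..14}" using shuffle_supp_bounded[OF True] by fastforce
      then have "finite shuffle_supp" by (rule finite_subset) auto
      then show ?thesis using False N True by (simp add: shuffle_supp_finite_iff)
    next
      case N4: False
      then have "infinite shuffle_supp" using N3 by (intro shuffle_supp_infinite) auto
      moreover have "q ^ 3 \<noteq> 1" using least[of 3] N4 N3 by auto
      ultimately show ?thesis using False by (simp add: shuffle_supp_finite_iff)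
    qed
  qed
qed

end

section \<open>The tensor algebra\<close>

lemma poly_mapping_lin_induct:
  assumes "P 0" "\<And>x. P (Poly_Mapping.single x 1)" "\<And>a b. P a \<Longrightarrow> P b \<Longrightarrow> P (a + b)"
    "\<And>c a. P a \<Longrightarrow> P (pm_scale c a)"
  shows "P (r :: 'a \<Rightarrow>\<^sub>0 'k::field)"
proof -
  have "P (\<Sum>x\<in>A. pm_scale (Poly_Mapping.lookup r x) (Poly_Mapping.single x 1))" for A
    by (induction A rule: infinite_finite_induct) (auto simp del: pm_scale_single intro: assms)
  from this[of "Poly_Mapping.keys r"] show ?thesis
    using lin_ext_id[of r] unfolding lin_ext_def by (simp del: pm_scale_single)
qed

lemma lin_ext_diff [simp]: "lin_ext f (a - b) = lin_ext f a - lin_ext f b"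
  using lin_ext_add[of f "a - b" b] by (simp del: lin_ext_add)

lemma lin_ext_mem:
  assumes "pm.subspace S" "\<And>x. x \<in> Poly_Mapping.keys r \<Longrightarrow> f x \<in> S"
  shows "lin_ext f r \<in> S"
  unfolding lin_ext_def using assms by (intro pm.subspace_sum pm.subspace_scale)

lemma lin_ext_add_fun: "lin_ext (\<lambda>x. f x + g x) r = lin_ext f r + lin_ext g r"
  by (simp add: lin_ext_def pm.scale_right_distrib sum.distrib)

lemma lin_ext_scale_fun: "lin_ext (\<lambda>x. pm_scale c (f x)) r = pm_scale c (lin_ext f r)"
  by (simp add: lin_ext_def pm.scale_sum_right pm.scale_scale mult.commute)

lemma lin_ext_zero_fun [simp]: "lin_ext (\<lambda>x. 0) r = 0"
  by (simp add: lin_ext_def)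

lemma lin_ext_cong_keys: "(\<And>x. x \<in> Poly_Mapping.keys r \<Longrightarrow> f x = g x) \<Longrightarrow> lin_ext f r = lin_ext g r"
  by (simp add: lin_ext_def)

lemma pm_scale_mult_left [simp]: "pm_scale c a * b = pm_scale c (a * b)"
  for a :: "('b, 'k::field) tensor_algebra"
  by (simp add: pm_scale_def mult_map_scale_conv_mult mult.assoc)

lemma word_mult [simp]: "word u * word v = (word (u @ v) :: ('b, 'k::field) tensor_algebra)"
  by (simp add: mult_single plus_list_def)

lemma one_word: "1 = (word [] :: ('b, 'k::field) tensor_algebra)"
  by (simp add: zero_list_def flip: single_one)

lemma pm_scale_mult_right [simp]: "a * pm_scale c b = pm_scale c (a * b)"
  for a :: "('b, 'k::field) tensor_algebra"
proof -
  have "a * Poly_Mapping.single 0 c = Poly_Mapping.single 0 c * a"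
  proof (induction a rule: poly_mapping_lin_induct)
    case (4 d a)
    have *: "Poly_Mapping.single 0 c * (Poly_Mapping.single 0 d * a) = Poly_Mapping.single 0 d * (Poly_Mapping.single 0 c * a)"
      by (simp add: mult_single mult.commute flip: mult.assoc)
    show ?case unfolding pm_scale_mult_left 4 by (simp add: pm_scale_def mult_map_scale_conv_mult *)
  qed (simp_all add: mult_single distrib_left distrib_right)
  then show ?thesis
    by (simp add: pm_scale_def mult_map_scale_conv_mult flip: mult.assoc)
qed

lemma word_mult_lin_ext: "word w * r = lin_ext (\<lambda>u. word (w @ u)) r"
  by (induction r rule: poly_mapping_lin_induct) (simp_all add: distrib_left)

lemma word_Cons_mult: "word (x # w) = word [x] * (word w :: ('b, 'k::field) tensor_algebra)"
  by simp

lemma pm_linear_mult: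
  fixes f g :: "('b, 'k::field) tensor_algebra \<Rightarrow> ('b, 'k) tensor_algebra"
  shows "(\<And>u v. lin_ext h (word u * word v) = lin_ext h (word u) * lin_ext h (word v)) \<Longrightarrow>
    lin_ext h (a * b) = lin_ext h a * (lin_ext h b :: ('b, 'k) tensor_algebra)"
proof (induction a rule: poly_mapping_lin_induct)
  case (2 u)
  then show ?case by (induction b rule: poly_mapping_lin_induct) (simp_all add: distrib_left)
qed (simp_all add: distrib_right)

lemma tensor_zero [simp]: "tensor 0 b = 0" "tensor a 0 = 0"
  by (simp_all add: tensor_def)

lemma tensor_add_left: "tensor (a + b) c = tensor a c + tensor b c"
  and tensor_add_right: "tensor a (b + c) = tensor a b + tensor a c"
  and tensor_scale_left: "tensor (pm_scale s a) b = pm_scale s (tensor a b)"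
  and tensor_scale_right: "tensor a (pm_scale s b) = pm_scale s (tensor a b)"
  by (simp_all add: tensor_def lin_ext_add_fun lin_ext_scale_fun)

lemma tensor_diff_left: "tensor (a - b) c = tensor a c - tensor b c"
  and tensor_diff_right: "tensor a (b - c) = tensor a b - tensor a c"
  using tensor_add_left[of "a - b" b c] tensor_add_right[of a "b - c" c] by simp_all

lemma tensor_word [simp]: "tensor (word u) (word v) = Poly_Mapping.single (u, v) 1"
  by (simp add: tensor_def)

definition tensor_map where
  "tensor_map f g = lin_ext (\<lambda>(a, b). tensor (f a) (g b))"

lemma tensor_map_add [simp]: "tensor_map f g (X + Y) = tensor_map f g X + tensor_map f g Y"
  and tensor_map_scale [simp]: "tensor_map f g (pm_scale c X) = pm_scale c (tensor_map f g X)"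
  and tensor_map_zero [simp]: "tensor_map f g 0 = 0"
  and tensor_map_single [simp]: "tensor_map f g (Poly_Mapping.single (u, v) 1) = tensor (f u) (g v)"
  by (simp_all add: tensor_map_def)

lemma tensor_map_tensor [simp]: "tensor_map f g (tensor a b) = tensor (lin_ext f a) (lin_ext g b)"
proof (induction a rule: poly_mapping_lin_induct)
  case (2 u)
  show ?case
    by (induction b rule: poly_mapping_lin_induct) (simp_all add: tensor_add_right tensor_scale_right)
qed (simp_all add: tensor_add_left tensor_scale_left)

text \<open>The map \<open>id \<otimes> \<phi>\<close> for a linear functional
  \<open>\<phi>\<close>.\<close>

definition slice :: "(('b, 'k::field) tensor_algebra \<Rightarrow> 'k) \<Rightarrow> ('b, 'k) tensor_square \<Rightarrow> ('b, 'k) tensor_algebra"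
  where "slice \<phi> = lin_ext (\<lambda>(a, b). pm_scale (\<phi> (word b)) (word a))"

definition lin_fun :: "(('a \<Rightarrow>\<^sub>0 'k::field) \<Rightarrow> 'k) \<Rightarrow> bool"
  where "lin_fun \<phi> \<longleftrightarrow> (\<forall>a b. \<phi> (a + b) = \<phi> a + \<phi> b) \<and> (\<forall>c a. \<phi> (pm_scale c a) = c * \<phi> a)"

lemma lin_fun_zero: "lin_fun \<phi> \<Longrightarrow> \<phi> 0 = 0"
  unfolding lin_fun_def by (metis mult_zero_left pm.scale_zero_left)

lemma lin_fun_diff: "lin_fun \<phi> \<Longrightarrow> \<phi> (a - b) = \<phi> a - \<phi> b"
  unfolding lin_fun_def by (metis add_diff_cancel_right' diff_add_cancel)

lemma slice_add [simp]: "slice \<phi> (X + Y) = slice \<phi> X + slice \<phi> Y"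
  and slice_diff [simp]: "slice \<phi> (X - Y) = slice \<phi> X - slice \<phi> Y"
  and slice_scale [simp]: "slice \<phi> (pm_scale c X) = pm_scale c (slice \<phi> X)"
  and slice_zero [simp]: "slice \<phi> 0 = 0"
  and slice_single [simp]: "slice \<phi> (Poly_Mapping.single (u, v) 1) = pm_scale (\<phi> (word v)) (word u)"
  by (simp_all add: slice_def)

lemma slice_tensor:
  assumes "lin_fun \<phi>"
  shows "slice \<phi> (tensor a b) = pm_scale (\<phi> b) a"
proof (induction a rule: poly_mapping_lin_induct)
  case (2 u)
  show ?case
    using assms
    by (induction b rule: poly_mapping_lin_induct)
      (simp_all add: tensor_add_right tensor_scale_right lin_fun_zero single_add lin_fun_def distrib_right)
qed (simp_all add: tensor_add_left tensor_scale_left pm.scale_right_distrib mult.commute pm.scale_scale)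

lemma lin_fun_counit: "lin_fun counit"
  by (simp add: lin_fun_def counit_def[abs_def] lookup_add)

lemma subspace_homogeneous: "pm.subspace (homogeneous n)"
  unfolding homogeneous_def pm.subspace_def
  by (auto simp: in_keys_iff lookup_add)

lemma component_word [simp]: "component n (word w) = (if length w = n then word w else 0)"
  and component_add [simp]: "component n (a + b) = component n a + component n b"
  and component_scale [simp]: "component n (pm_scale c a) = pm_scale c (component n a)"
  and component_zero [simp]: "component n 0 = 0"
  by (simp_all add: component_def)

lemma word_homogeneous: "length w = n \<Longrightarrow> word w \<in> homogeneous n"
  by (simp add: homogeneous_def)

lemma mult_homogeneous:
  fixes a b :: "('b, 'k::field) tensor_algebra"
  assumes "a \<in> homogeneous m" "b \<in> homogeneous n"
  shows "a * b \<in> homogeneous (m + n)"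
proof -
  have "\<exists>u v. w = u @ v \<and> u \<in> Poly_Mapping.keys a \<and> v \<in> Poly_Mapping.keys b"
    if "w \<in> Poly_Mapping.keys (a * b)" for w
    using keys_mult[of a b] that by (auto simp: plus_list_def)
  then show ?thesis using assms by (fastforce simp: homogeneous_def)
qed

lemma component_homogeneous: "a \<in> homogeneous n \<Longrightarrow> component m a = (if m = n then a else 0)"
proof -
  assume a: "a \<in> homogeneous n"
  have "component m a = lin_ext (\<lambda>w. if m = n then word w else 0) a"
    unfolding component_def by (rule lin_ext_cong_keys) (use a in \<open>auto simp: homogeneous_def\<close>)
  then show ?thesis by (simp add: lin_ext_id)
qed

lemma component_in_homogeneous: "component n a \<in> homogeneous n"
  unfolding component_def
  by (rule lin_ext_mem[OF subspace_homogeneous])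
     (auto simp: word_homogeneous pm.subspace_0[OF subspace_homogeneous])

lemma sum_component:
  assumes "\<And>w. w \<in> Poly_Mapping.keys a \<Longrightarrow> length w < n"
  shows "a = (\<Sum>k<n. component k a)"
proof -
  have "(\<Sum>k<n. component k a) = lin_ext (\<lambda>w. \<Sum>k<n. if length w = k then word w else 0) a"
    by (induction n) (simp_all add: lin_ext_add_fun component_def)
  also have "\<dots> = lin_ext word a"
    by (rule lin_ext_cong_keys) (use assms in auto)
  finally show ?thesis by (simp add: lin_ext_id)
qed

lemma sum_component_ex: "\<exists>n. a = (\<Sum>k<n. component k a)"
proof -
  have "finite (length ` Poly_Mapping.keys a)" by simp
  then obtain n where "\<forall>m\<in>length ` Poly_Mapping.keys a. m < n"
    using finite_nat_set_iff_bounded by blast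
  then have "a = (\<Sum>k<n. component k a)" by (intro sum_component) auto
  then show ?thesis ..
qed

section \<open>Skew derivations\<close>

declare pm_scale_single [simp del]

locale endymion_char2 =
  fixes p q :: "'k::field"
  assumes p_nz: "p \<noteq> 0" and q_nz: "q \<noteq> 0" and two: "(2 :: 'k) = 0"
begin

abbreviation c :: "(basis3, 'k) braiding" where "c \<equiv> endymion p q"

abbreviation xx :: "basis3 \<Rightarrow> (basis3, 'k) tensor_algebra" where "xx i \<equiv> word [i]"

text \<open>\<open>c(x\<^sub>i \<otimes> x\<^sub>j) = g_letter i j \<otimes> x\<^sub>i\<close>.\<close>

fun g_letter :: "basis3 \<Rightarrow> basis3 \<Rightarrow> (basis3, 'k) tensor_algebra"
  where
    "g_letter X3 X1 = pm_scale (inverse p) (xx X1)"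
  | "g_letter X3 X2 = pm_scale (inverse p) (xx X2 + xx X1)"
  | "g_letter X3 X3 = pm_scale q (xx X3)"
  | "g_letter i X3 = pm_scale p (xx X3)"
  | "g_letter i j = xx j"

fun g_word :: "basis3 \<Rightarrow> basis3 list \<Rightarrow> (basis3, 'k) tensor_algebra"
  where
    "g_word i [] = 1"
  | "g_word i (j # w) = g_letter i j * g_word i w"

definition g_act :: "basis3 \<Rightarrow> (basis3, 'k) tensor_algebra \<Rightarrow> (basis3, 'k) tensor_algebra"
  where "g_act i = lin_ext (g_word i)"

lemma g_act_add [simp]: "g_act i (a + b) = g_act i a + g_act i b"
  and g_act_diff [simp]: "g_act i (a - b) = g_act i a - g_act i b"
  and g_act_scale [simp]: "g_act i (pm_scale s a) = pm_scale s (g_act i a)"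
  and g_act_zero [simp]: "g_act i 0 = 0"
  and g_act_word: "g_act i (word w) = g_word i w"
  by (simp_all add: g_act_def)

lemma g_act_xx [simp]: "g_act i (xx j) = g_letter i j" by (simp add: g_act_word)

lemma g_word_append: "g_word i (u @ v) = g_word i u * g_word i v"
  by (induction u) (simp_all add: mult.assoc)

lemma g_act_mult [simp]: "g_act i (a * b) = g_act i a * g_act i b"
  unfolding g_act_def by (rule pm_linear_mult) (simp add: g_word_append)

lemma g_act_one [simp]: "g_act i 1 = 1" by (simp add: one_word g_act_word)

lemma g_word_X2: "g_word X2 w = g_word X1 w"
proof (induction w)
  case (Cons j w)
  then show ?case by (cases j) simp_all
qed simp

lemma g_act_comm: "g_act i (g_act j a) = g_act j (g_act i a)"
proof (induction a rule: poly_mapping_lin_induct)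
  case (2 w)
  show ?case unfolding g_act_word
  proof (induction w)
    case (Cons y w)
    have "g_act i (g_letter j y) = g_act j (g_letter i y)"
      by (cases i; cases j; cases y) (simp_all add: pm.scale_right_distrib)
    then show ?case using Cons by simp
  qed simp
qed simp_all

text \<open>The letter comes out unchanged, so braiding with it amounts to an algebra automorphism;
  the skew derivations rest on this.\<close>

lemma braid_letter_eq: "braid_letter c x u = lin_ext (\<lambda>v. Poly_Mapping.single (v, x) 1) (g_word x u)"
proof (induction u arbitrary: x)
  case Nil
  then show ?case by (simp add: one_word)
next
  case (Cons y u)
  have *: "lin_ext f (xx j * t) = lin_ext (\<lambda>u. f (j # u)) t" for f j and t :: "(basis3, 'k) tensor_algebra"
    by (simp add: word_mult_lin_ext lin_ext_lin_ext)
  show ?case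
    by (cases x; cases y) (simp_all add: Cons lin_ext_lin_ext * pm.scale_right_distrib distrib_right)
qed

definition lmulT :: "basis3 \<Rightarrow> (basis3, 'k) tensor_square \<Rightarrow> (basis3, 'k) tensor_square"
  where "lmulT x = tensor_map (\<lambda>a. word (x # a)) word"

text \<open>Left multiplication by \<open>1 \<otimes> x\<close> in the braided tensor square:
  \<open>x\<close> acts on the first factor while passing it. \<open>lmulT\<close> is the same for
  \<open>x \<otimes> 1\<close>.\<close>

definition rmulT :: "basis3 \<Rightarrow> (basis3, 'k) tensor_square \<Rightarrow> (basis3, 'k) tensor_square"
  where "rmulT x = tensor_map (g_word x) (\<lambda>b. word (x # b))"

lemma lin_ext_Cons: "lin_ext (\<lambda>a. word (x # a)) t = xx x * t"
  by (simp add: word_mult_lin_ext)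

lemma lmulT_simps [simp]: "lmulT x (X + Y) = lmulT x X + lmulT x Y"
  "lmulT x (pm_scale s X) = pm_scale s (lmulT x X)" "lmulT x 0 = 0"
  "lmulT x (tensor a b) = tensor (xx x * a) b"
  "lmulT x (Poly_Mapping.single (u, v) 1) = Poly_Mapping.single (x # u, v) 1"
  by (simp_all add: lmulT_def lin_ext_Cons lin_ext_id)

lemma rmulT_simps [simp]: "rmulT x (X + Y) = rmulT x X + rmulT x Y"
  "rmulT x (pm_scale s X) = pm_scale s (rmulT x X)" "rmulT x 0 = 0"
  "rmulT x (tensor a b) = tensor (g_act x a) (xx x * b)"
  "rmulT x (Poly_Mapping.single (u, v) 1) = tensor (g_word x u) (word (x # v))"
  by (simp_all add: rmulT_def lin_ext_Cons g_act_def)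

lemma comult_word_Cons: "comult_word c (x # w) = lmulT x (comult_word c w) + rmulT x (comult_word c w)"
proof -
  have "braided_mult c (Poly_Mapping.single ([x], []) 1) Y = lmulT x Y" for Y
    unfolding braided_mult_def lmulT_def tensor_map_def
    by (simp add: case_prod_unfold lin_ext_def[of _ Y])
  moreover have "braided_mult c (Poly_Mapping.single ([], [x]) 1) Y = rmulT x Y" for Y
    unfolding braided_mult_def rmulT_def tensor_map_def
    by (simp add: case_prod_unfold braid_letter_eq lin_ext_lin_ext tensor_def)
  ultimately show ?thesis
    by (simp add: braided_mult_def one_word)
qed

lemma comult_add [simp]: "comult c (a + b) = comult c a + comult c b"
  and comult_scale [simp]: "comult c (pm_scale s a) = pm_scale s (comult c a)"
  and comult_zero [simp]: "comult c 0 = 0"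
  and comult_on_word: "comult c (word w) = comult_word c w"
  by (simp_all add: comult_def)

lemma comult_xx_mult: "comult c (xx x * t) = lmulT x (comult c t) + rmulT x (comult c t)"
  by (induction t rule: poly_mapping_lin_induct)
    (simp_all add: distrib_left comult_on_word comult_word_Cons pm.scale_right_distrib del: comult_word.simps)

fun der_of_word :: "basis3 \<Rightarrow> basis3 list \<Rightarrow> (basis3, 'k) tensor_algebra"
  where
    "der_of_word i [] = 0"
  | "der_of_word i (x # w) = xx x * der_of_word i w + (if x = i then g_word i w else 0)"

definition der :: "basis3 \<Rightarrow> (basis3, 'k) tensor_algebra \<Rightarrow> (basis3, 'k) tensor_algebra"
  where "der i = lin_ext (der_of_word i)"

lemma der_add [simp]: "der i (a + b) = der i a + der i b"
  and der_diff [simp]: "der i (a - b) = der i a - der i b"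
  and der_scale [simp]: "der i (pm_scale s a) = pm_scale s (der i a)"
  and der_zero [simp]: "der i 0 = 0"
  and der_word: "der i (word w) = der_of_word i w"
  by (simp_all add: der_def)

lemma der_one [simp]: "der i 1 = 0" by (simp add: one_word der_word)

lemma der_xx: "der i (xx j) = (if j = i then 1 else 0)" by (simp add: der_word)

lemma der_mult: "der i (a * b) = a * der i b + der i a * g_act i b"
proof (induction a rule: poly_mapping_lin_induct)
  case (2 u)
  show ?case
  proof (induction b rule: poly_mapping_lin_induct)
    case (2 v)
    show ?case
    proof (induction u)
      case Nil
      show ?case by (simp add: der_word flip: one_word)
    next
      case (Cons x u)
      have "der_of_word i (x # u @ v) = xx x * (word u * der_of_word i v + der_of_word i u * g_word i v)
         + (if x = i then g_word i u * g_word i v else 0)"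
        using Cons by (simp add: der_word g_act_word g_word_append)
      also have "\<dots> = word (x # u) * der_of_word i v + der_of_word i (x # u) * g_word i v"
        by (subst (2) word_Cons_mult) (simp add: distrib_left distrib_right mult.assoc del: word_mult)
      finally show ?case by (simp add: der_word g_act_word)
    qed
  qed (simp_all add: distrib_left pm.scale_right_distrib add_ac)
qed (simp_all add: distrib_right pm.scale_right_distrib add_ac)

definition id_der :: "basis3 \<Rightarrow> (basis3, 'k) tensor_square \<Rightarrow> (basis3, 'k) tensor_square"
  where "id_der i = tensor_map word (der_of_word i)"

lemma id_der_simps [simp]: "id_der i (X + Y) = id_der i X + id_der i Y"
  "id_der i (pm_scale s X) = pm_scale s (id_der i X)" "id_der i 0 = 0"
  "id_der i (tensor a b) = tensor a (der i b)"
  "id_der i (Poly_Mapping.single (u, v) 1) = tensor (word u) (der_of_word i v)"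
  by (simp_all add: id_der_def der_def lin_ext_id)

text \<open>Each automorphism is a coalgebra map, because the automorphisms commute and those of
  \<open>x1\<close> and \<open>x2\<close> coincide.\<close>

lemma comult_g_act: "comult c (g_act i t) = tensor_map (g_word i) (g_word i) (comult c t)"
proof (induction t rule: poly_mapping_lin_induct)
  case (2 w)
  show ?case unfolding g_act_word comult_on_word
  proof (induction w)
    case Nil
    show ?case by (simp add: one_word comult_on_word)
  next
    case (Cons y w)
    let ?G = "tensor_map (g_word i) (g_word i)"
    have G: "?G (tensor a b) = tensor (g_act i a) (g_act i b)" for a b by (simp add: g_act_def)
    have "comult c (g_letter i y * t) = ?G (lmulT y Y) + ?G (rmulT y Y)" if "comult c t = ?G Y" for t Y
    proof -
      have 1: "lmulT y' (?G Y) = tensor_map (\<lambda>u. xx y' * g_word i u) (g_word i) Y" for y'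
        by (induction Y rule: poly_mapping_lin_induct) (auto simp: pm.scale_right_distrib)
      have 2: "rmulT y' (?G Y) = tensor_map (\<lambda>u. g_act y' (g_word i u)) (\<lambda>v. xx y' * g_word i v) Y" for y'
        by (induction Y rule: poly_mapping_lin_induct) (auto simp: pm.scale_right_distrib)
      have 3: "?G (lmulT y Y) = tensor_map (\<lambda>u. g_letter i y * g_word i u) (g_word i) Y"
        by (induction Y rule: poly_mapping_lin_induct) (auto simp: pm.scale_right_distrib)
      have 4: "?G (rmulT y Y) = tensor_map (\<lambda>u. g_act y (g_word i u)) (\<lambda>v. g_letter i y * g_word i v) Y"
      proof (induction Y rule: poly_mapping_lin_induct)
        case (2 z)
        have "lin_ext (g_word i) (g_word y u) = g_act y (g_word i u)" for u
          using g_act_comm[of i y "word u"] by (simp add: g_act_word) (simp add: g_act_def)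
        then show ?case by (cases z) simp
      qed simp_all
      \<comment> \<open>For \<open>i = X3\<close>, \<open>y = X2\<close> the image of the letter
        involves both \<open>x2\<close> and \<open>x1\<close>; their contributions combine because
        both act by the same automorphism.\<close>
      have 5: "tensor_map (\<lambda>u. g_act X2 (g_word i u)) f Y = tensor_map (\<lambda>u. g_act X1 (g_word i u)) f Y" for f
        by (simp add: g_act_def g_word_X2[abs_def])
      have 6: "tensor_map (\<lambda>u. f u + f' u) g Y = tensor_map f g Y + tensor_map f' g Y"
        "tensor_map f (\<lambda>u. g u + g' u) Y = tensor_map f g Y + tensor_map f g' Y"
        "tensor_map (\<lambda>u. pm_scale s (f u)) g Y = pm_scale s (tensor_map f g Y)"
        "tensor_map f (\<lambda>u. pm_scale s (g u)) Y = pm_scale s (tensor_map f g Y)" for f f' g g' s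
        by (simp_all add: tensor_map_def case_prod_unfold tensor_add_left tensor_add_right
          tensor_scale_left tensor_scale_right lin_ext_add_fun lin_ext_scale_fun)
      show ?thesis unfolding 3 4 using that 1 2 5
        by (cases i; cases y) (simp_all add: comult_xx_mult 6 distrib_right pm.scale_right_distrib add_ac)
    qed
    from this[OF Cons] show ?case by (simp add: comult_word_Cons del: comult_word.simps)
  qed
qed (simp_all)

text \<open>When the first letter is the one differentiated, it leaves
  \<open>g_i \<otimes> g_i\<close> applied to the comultiplication of the rest, which
  \<open>comult_g_act\<close> identifies.\<close>

lemma id_der_comult: "id_der i (comult c t) = comult c (der i t)"
proof (induction t rule: poly_mapping_lin_induct)
  case (2 w)
  show ?case unfolding der_word comult_on_word
  proof (induction w)
    case Nil
    show ?case by (simp add: one_word)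
  next
    case (Cons x w)
    define Y where "Y = comult_word c w"
    have 1: "id_der i (lmulT x Y) = lmulT x (id_der i Y)"
      by (induction Y rule: poly_mapping_lin_induct) (auto simp flip: word_Cons_mult)
    have 2: "id_der i (rmulT x Y) = rmulT x (id_der i Y)
        + (if x = i then tensor_map (g_word i) (g_word i) Y else 0)"
    proof (induction Y rule: poly_mapping_lin_induct)
      case (2 z)
      show ?case by (cases z) (simp add: der_word tensor_add_right g_act_word)
    qed (auto simp: pm.scale_right_distrib add_ac)
    have 3: "comult c (g_word i w) = tensor_map (g_word i) (g_word i) Y"
      using comult_g_act[of i "word w"] by (simp add: g_act_word comult_on_word Y_def)
    show ?case
      using Cons by (simp add: comult_word_Cons comult_xx_mult 1 2 3 flip: Y_def del: comult_word.simps)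
  qed
qed simp_all

lemma counit_simps [simp]: "counit (a + b) = counit a + counit b" "counit (pm_scale s a) = s * counit a"
  "counit (0 :: (basis3, 'k) tensor_algebra) = 0" "counit (1 :: (basis3, 'k) tensor_algebra) = 1"
  "counit (word w) = (if w = [] then 1 else 0)"
  for a b :: "(basis3, 'k) tensor_algebra"
  by (auto simp: counit_def lookup_add lookup_single one_word)

lemma counit_xx_mult [simp]: "counit (xx i * t) = 0"
  by (induction t rule: poly_mapping_lin_induct) (simp_all add: distrib_left)

lemma counit_g_word: "counit (g_word i w) = (if w = [] then 1 else 0)"
proof (cases w)
  case (Cons y w')
  then show ?thesis by (cases i; cases y) (simp_all add: distrib_right)
qed simp

primrec ders :: "basis3 list \<Rightarrow> (basis3, 'k) tensor_algebra \<Rightarrow> (basis3, 'k) tensor_algebra"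
  where "ders [] t = t" | "ders (i # s) t = ders s (der i t)"

lemma ders_add [simp]: "ders s (a + b) = ders s a + ders s b"
  and ders_scale [simp]: "ders s (pm_scale r a) = pm_scale r (ders s a)"
  and ders_zero [simp]: "ders s 0 = 0"
  by (induction s arbitrary: a b; simp)+

lemma lin_fun_counit_ders: "lin_fun (\<lambda>t. counit (ders s t))"
  by (simp add: lin_fun_def)

lemma slice_counit: "slice counit (comult c t) = t"
proof (induction t rule: poly_mapping_lin_induct)
  case (2 w)
  show ?case unfolding comult_on_word
  proof (induction w)
    case Nil
    show ?case by (simp add: one_word)
  next
    case (Cons x w)
    have 1: "slice counit (lmulT x Y) = xx x * slice counit Y" for Y
      by (induction Y rule: poly_mapping_lin_induct) (auto simp: distrib_left)
    have 2: "slice counit (rmulT x Y) = 0" for Y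
    proof (induction Y rule: poly_mapping_lin_induct)
      case (2 z)
      then show ?case by (cases z) (simp add: slice_tensor lin_fun_counit)
    qed auto
    show ?case by (simp add: comult_word_Cons 1 2 Cons del: comult_word.simps)
  qed
qed simp_all

lemma slice_der: 
  assumes "lin_fun \<phi>"
  shows "slice (\<lambda>t. \<phi> (der i t)) X = slice \<phi> (id_der i X)"
proof (induction X rule: poly_mapping_lin_induct)
  case (2 z)
  show ?case using assms by (cases z) (simp add: slice_tensor der_word)
qed simp_all

text \<open>Iterates \<open>id_der_comult\<close> down to the counit axiom. It expresses derivatives
  through the comultiplication, about which the hypotheses on \<open>J\<close> speak.\<close>

lemma slice_ders: "slice (\<lambda>t. counit (ders s t)) (comult c t) = ders s t"
proof (induction s arbitrary: t)
  case Nil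
  show ?case using slice_counit by simp
next
  case (Cons i s)
  show ?case
    using slice_der[OF lin_fun_counit_ders, of s i "comult c t"] Cons by (simp add: id_der_comult)
qed

lemma counit_der: "counit (der i t) = Poly_Mapping.lookup t [i]"
proof (induction t rule: poly_mapping_lin_induct)
  case (2 w)
  then show ?case by (cases w) (auto simp: der_word counit_g_word lookup_single)
qed (simp_all add: lookup_add)

lemma g_letter_homogeneous: "g_letter i j \<in> homogeneous 1"
proof -
  have x: "xx j \<in> homogeneous (Suc 0)" for j by (rule word_homogeneous) simp
  show ?thesis
    by (cases i; cases j) (auto intro!: pm.subspace_scale[OF subspace_homogeneous] pm.subspace_add[OF subspace_homogeneous] x)
qed

lemma one_homogeneous: "(1 :: (basis3, 'k) tensor_algebra) \<in> homogeneous 0"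
  by (simp add: one_word word_homogeneous)

lemma g_word_homogeneous: "g_word i w \<in> homogeneous (length w)"
proof (induction w)
  case (Cons y w)
  show ?case using mult_homogeneous[OF g_letter_homogeneous[of i y] Cons] by simp
qed (simp add: one_homogeneous)

lemma der_of_word_homogeneous: "der_of_word i w \<in> homogeneous (length w - 1)"
proof (induction w)
  case Nil
  show ?case by (simp add: pm.subspace_0[OF subspace_homogeneous])
next
  case (Cons x w)
  have "xx x * der_of_word i w \<in> homogeneous (length w)"
  proof (cases w)
    case Nil
    then show ?thesis by (simp add: pm.subspace_0[OF subspace_homogeneous])
  next
    case (Cons a w')
    then show ?thesis using mult_homogeneous[OF word_homogeneous[of "[x]" 1] Cons.IH] Cons by simp
  qed
  then show ?case using g_word_homogeneous[of i w]
    by (simp add: pm.subspace_0[OF subspace_homogeneous] pm.subspace_add[OF subspace_homogeneous])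
qed

lemma der_component: "der i (component (Suc k) t) = component k (der i t)"
proof (induction t rule: poly_mapping_lin_induct)
  case (2 w)
  show ?case
  proof (cases w)
    case (Cons a v)
    then show ?thesis using component_homogeneous[OF der_of_word_homogeneous[of i w], of k]
      by (auto simp: der_word simp del: der_of_word.simps)
  qed (simp add: der_word)
qed simp_all

lemma der_component_0: "der i (component 0 t) = 0"
  by (induction t rule: poly_mapping_lin_induct) (simp_all add: der_word)

lemma counit_component: "counit (component k t) = (if k = 0 then counit t else 0)" for t :: "(basis3, 'k) tensor_algebra"
  by (induction t rule: poly_mapping_lin_induct) (simp_all)

lemma counit_ders_component:
  "counit (ders s (component k t)) = (if length s = k then counit (ders s t) else 0)"
proof (induction s arbitrary: k t)
  case Nil
  then show ?case by (auto simp: counit_component)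
next
  case (Cons i s)
  then show ?case by (cases k) (simp_all add: der_component der_component_0)
qed

text \<open>Only the second factor is constrained, since the functionals in
  \<open>tensor_kernel_detect\<close> act on that factor.\<close>

definition mid :: "nat \<Rightarrow> (basis3, 'k) tensor_square set"
  where "mid n = {X. \<forall>z\<in>Poly_Mapping.keys X. 1 \<le> length (snd z) \<and> length (snd z) < n}"

lemma subspace_mid: "pm.subspace (mid n)"
  unfolding mid_def pm.subspace_def
  by (auto simp: in_keys_iff lookup_add) (metis add.right_neutral in_keys_iff snd_conv One_nat_def)+

lemma tensor_mid: "1 \<le> length v \<Longrightarrow> length v < n \<Longrightarrow> tensor a (word v) \<in> mid n"
proof (induction a rule: poly_mapping_lin_induct)
  case (2 u)
  then show ?case by (simp add: mid_def)
qed (simp_all add: tensor_add_left tensor_scale_left pm.subspace_0[OF subspace_mid] pm.subspace_add[OF subspace_mid] pm.subspace_scale[OF subspace_mid])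

lemma comult_word_mid:
  "w \<noteq> [] \<Longrightarrow> comult_word c w - tensor (word w) 1 - tensor 1 (word w) \<in> mid (length w)"
proof (induction w)
  case (Cons x w)
  note sub = pm.subspace_add[OF subspace_mid] pm.subspace_0[OF subspace_mid]
  show ?case
  proof (cases "w = []")
    case True
    have "comult_word c [x] = tensor (xx x) 1 + tensor 1 (xx x)"
      by (simp add: comult_word_Cons one_word del: comult_word.simps(2))
    then show ?thesis using True by (simp add: sub del: comult_word.simps)
  next
    case False
    define Z where "Z = comult_word c w - tensor (word w) 1 - tensor 1 (word w)"
    have Z: "Z \<in> mid (length w)" using Cons.IH[OF False] by (simp add: Z_def)
    have Y: "comult_word c w = tensor (word w) 1 + tensor 1 (word w) + Z" by (simp add: Z_def)
    have 1: "lmulT x Z \<in> mid (length (x # w))"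
      unfolding lmulT_def tensor_map_def
      by (rule lin_ext_mem[OF subspace_mid]) (use Z in \<open>auto simp: mid_def\<close>)
    have 2: "rmulT x Z \<in> mid (length (x # w))"
      unfolding rmulT_def tensor_map_def
    proof (rule lin_ext_mem[OF subspace_mid])
      fix z assume "z \<in> Poly_Mapping.keys Z"
      then have "length (snd z) < length w" using Z by (auto simp: mid_def)
      then show "(case z of (a, b) \<Rightarrow> tensor (g_word x a) (word (x # b))) \<in> mid (length (x # w))"
        by (cases z) (auto intro!: tensor_mid)
    qed
    have 3: "tensor (xx x) (word w) \<in> mid (length (x # w))" "tensor (g_act x (word w)) (xx x) \<in> mid (length (x # w))"
      using False by (auto intro!: tensor_mid simp: Suc_le_eq simp del: tensor_word)
    have "comult_word c (x # w) - tensor (word (x # w)) 1 - tensor 1 (word (x # w))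
      = tensor (xx x) (word w) + lmulT x Z + (tensor (g_act x (word w)) (xx x) + rmulT x Z)"
      unfolding comult_word_Cons Y by (simp del: tensor_word)
    then show ?thesis using 1 2 3 by (simp only: sub)
  qed
qed simp

lemma comult_mid:
  assumes "t \<in> homogeneous n" "n > 0"
  shows "comult c t - tensor t 1 - tensor 1 t \<in> mid n"
proof -
  have "comult c t - tensor t 1 - tensor 1 t =
     lin_ext (\<lambda>w. comult_word c w - tensor (word w) 1 - tensor 1 (word w)) t"
  proof (induction t rule: poly_mapping_lin_induct)
    case (3 a b)
    show ?case by (simp add: 3[symmetric] tensor_add_left tensor_add_right)
  next
    case (4 s a)
    show ?case by (simp add: 4[symmetric] tensor_scale_left tensor_scale_right pm.scale_right_diff_distrib)
  qed (simp_all add: comult_on_word del: tensor_word)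
  also have "\<dots> \<in> mid n"
  proof (rule lin_ext_mem[OF subspace_mid])
    fix w assume "w \<in> Poly_Mapping.keys t"
    then have "length w = n" using assms by (auto simp: homogeneous_def)
    then show "comult_word c w - tensor (word w) 1 - tensor 1 (word w) \<in> mid n"
      using comult_word_mid[of w] assms(2) by auto
  qed
  finally show ?thesis .
qed

end

text \<open>
  By induction on the number of tensors: if some second factor \<open>v\<^sub>0\<close> is not in \<open>J\<close>, a functional not
  vanishing on it shows that its first factor is, modulo \<open>J\<close>, a combination of the others, so that the
  tensor can be absorbed into them.
\<close>

lemma tensor_kernel_detect:
  fixes J V :: "('b, 'k::field) tensor_algebra set"
  assumes J: "pm.subspace J" and V: "pm.subspace V"
    and lin: "\<And>\<phi>. \<phi> \<in> \<Phi> \<Longrightarrow> lin_fun \<phi>"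
    and detect: "\<And>v. v \<in> V \<Longrightarrow> (\<And>\<phi>. \<phi> \<in> \<Phi> \<Longrightarrow> \<phi> v = 0) \<Longrightarrow> v \<in> J"
  shows "\<lbrakk>\<forall>(u, v)\<in>set xs. v \<in> V; \<forall>\<phi>\<in>\<Phi>. (\<Sum>(u, v)\<leftarrow>xs. pm_scale (\<phi> v) u) \<in> J\<rbrakk>
    \<Longrightarrow> (\<Sum>(u, v)\<leftarrow>xs. tensor u v) \<in> tensor_kernel J"
proof (induction "length xs" arbitrary: xs)
  case 0
  then show ?case by (simp add: tensor_kernel_def pm.span_zero)
next
  case (Suc n)
  have gen: "tensor u v \<in> tensor_kernel J" "tensor v u \<in> tensor_kernel J" if "v \<in> J" for u v
    unfolding tensor_kernel_def using that by (auto intro!: pm.span_base)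
  have sub: "pm.subspace (tensor_kernel J)"
    unfolding tensor_kernel_def by (rule pm.subspace_span)
  show ?case
  proof (cases "\<forall>(u, v)\<in>set xs. v \<in> J")
    case True
    then show ?thesis
      by (induction xs) (auto simp: pm.subspace_0[OF sub] intro!: pm.subspace_add[OF sub] gen(1))
  next
    case False
    then obtain u0 v0 where uv: "(u0, v0) \<in> set xs" "v0 \<notin> J" by auto
    then obtain ys zs where xs: "xs = ys @ (u0, v0) # zs" by (meson split_list)
    obtain \<phi>0 where \<phi>0: "\<phi>0 \<in> \<Phi>" "\<phi>0 v0 \<noteq> 0" using detect[of v0] uv Suc.prems(1) by auto
    define rest where "rest = ys @ zs"
    define r where "r v = \<phi>0 v / \<phi>0 v0" for v
    \<comment> \<open>Substituting for \<open>u0\<close> its expression modulo \<open>J\<close> from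
      \<open>rsum\<close> changes each second factor by a multiple of \<open>v0\<close>.\<close>
    define rest' where "rest' = map (\<lambda>(u, v). (u, v - pm_scale (r v) v0)) rest"
    define y where "y = (\<Sum>(u, v)\<leftarrow>xs. pm_scale (\<phi>0 v) u)"
    have y: "y \<in> J" using Suc.prems(2) \<phi>0(1) by (simp add: y_def)
    have sum_xs: "(\<Sum>(u, v)\<leftarrow>xs. F u v) = F u0 v0 + (\<Sum>(u, v)\<leftarrow>rest. F u v)" for F :: "_ \<Rightarrow> _ \<Rightarrow> 'c::comm_monoid_add"
      by (simp add: xs rest_def add_ac)
    have rsum: "(\<Sum>(u, v)\<leftarrow>rest. pm_scale (r v) u) = pm_scale (inverse (\<phi>0 v0)) y - u0"
    proof -
      have "(\<Sum>(u, v)\<leftarrow>rest. pm_scale (r v) u) = pm_scale (inverse (\<phi>0 v0)) (\<Sum>(u, v)\<leftarrow>rest. pm_scale (\<phi>0 v) u)"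
        by (induction rest) (auto simp: r_def pm.scale_right_distrib divide_inverse mult.commute)
      also have "(\<Sum>(u, v)\<leftarrow>rest. pm_scale (\<phi>0 v) u) = y - pm_scale (\<phi>0 v0) u0"
        unfolding y_def sum_xs by simp
      finally show ?thesis using \<phi>0(2) by (simp add: pm.scale_right_diff_distrib)
    qed
    have "(\<Sum>(u, v)\<leftarrow>rest'. tensor u v) \<in> tensor_kernel J"
    proof (rule Suc.hyps(1))
      show "n = length rest'" using Suc.hyps(2) by (simp add: rest'_def rest_def xs)
      show "\<forall>(u, v)\<in>set rest'. v \<in> V"
        using Suc.prems(1) by (auto simp: rest'_def rest_def xs intro!: pm.subspace_diff[OF V] pm.subspace_scale[OF V])
      show "\<forall>\<phi>\<in>\<Phi>. (\<Sum>(u, v)\<leftarrow>rest'. pm_scale (\<phi> v) u) \<in> J"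
      proof
        fix \<phi> assume \<phi>: "\<phi> \<in> \<Phi>"
        have l: "\<phi> (v - pm_scale s w) = \<phi> v - s * \<phi> w" for v w s
          using lin[OF \<phi>] lin_fun_diff[OF lin[OF \<phi>]] by (simp add: lin_fun_def)
        have "(\<Sum>(u, v)\<leftarrow>rest'. pm_scale (\<phi> v) u) = (\<Sum>(u, v)\<leftarrow>rest. pm_scale (\<phi> v) u)
            - pm_scale (\<phi> v0) (\<Sum>(u, v)\<leftarrow>rest. pm_scale (r v) u)"
          unfolding rest'_def
          by (induction rest) (auto simp: l pm.scale_left_diff_distrib pm.scale_right_distrib mult.commute)
        also have "\<dots> = (\<Sum>(u, v)\<leftarrow>xs. pm_scale (\<phi> v) u) - pm_scale (\<phi> v0 * inverse (\<phi>0 v0)) y"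
          unfolding rsum sum_xs by (simp add: pm.scale_right_diff_distrib)
        also have "\<dots> \<in> J"
          using Suc.prems(2) \<phi> y by (intro pm.subspace_diff[OF J] pm.subspace_scale[OF J]) auto
        finally show "(\<Sum>(u, v)\<leftarrow>rest'. pm_scale (\<phi> v) u) \<in> J" .
      qed
    qed
    moreover have "(\<Sum>(u, v)\<leftarrow>xs. tensor u v) = (\<Sum>(u, v)\<leftarrow>rest'. tensor u v) + tensor (pm_scale (inverse (\<phi>0 v0)) y) v0"
    proof -
      have "(\<Sum>(u, v)\<leftarrow>rest'. tensor u v) = (\<Sum>(u, v)\<leftarrow>rest. tensor u v) - tensor (\<Sum>(u, v)\<leftarrow>rest. pm_scale (r v) u) v0"
        unfolding rest'_def
        by (induction rest) (auto simp: tensor_add_left tensor_diff_right tensor_scale_left tensor_scale_right)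
      then show ?thesis unfolding rsum sum_xs by (simp add: tensor_diff_left)
    qed
    ultimately show ?thesis
      using gen(2)[OF pm.subspace_scale[OF J y]] by (simp add: pm.subspace_add[OF sub])
  qed
qed

lemma slice_tensor_kernel:
  assumes J: "pm.subspace J" and "lin_fun \<phi>" "\<And>y. y \<in> J \<Longrightarrow> \<phi> y = 0" "X \<in> tensor_kernel J"
  shows "slice \<phi> X \<in> J"
  using assms(4) unfolding tensor_kernel_def
proof (induction rule: pm.span_induct_alt)
  case base
  then show ?case by (simp add: pm.subspace_0[OF J])
next
  case (step s x y)
  then have "slice \<phi> x \<in> J"
    using assms(2,3) by (auto simp: slice_tensor pm.subspace_0[OF J] pm.subspace_scale[OF J])
  then show ?case using step by (simp add: pm.subspace_add[OF J] pm.subspace_scale[OF J])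
qed

section \<open>The Nichols ideal in terms of iterated derivatives\<close>

locale endymion_nichols = endymion_char2 p q for p q :: "'k::field" +
  fixes J :: "(basis3, 'k) tensor_algebra set"
  assumes nichols: "nichols_ideal (endymion p q) J"
begin

lemma J_hopf: "graded_braided_Hopf_ideal c J" and J1: "J \<inter> homogeneous 1 = {0}"
  and prim: "primitive_mod c J = {v + y |v y. v \<in> homogeneous 1 \<and> y \<in> J}"
  using nichols by (auto simp: nichols_ideal_def)

lemma J_sub: "pm.subspace J" and J_mult: "y \<in> J \<Longrightarrow> t * y \<in> J" "y \<in> J \<Longrightarrow> y * t \<in> J"
  and J_component: "y \<in> J \<Longrightarrow> component n y \<in> J"
  and J_comult: "y \<in> J \<Longrightarrow> comult c y \<in> tensor_kernel J"
  and J_counit: "y \<in> J \<Longrightarrow> counit y = 0"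
  using J_hopf by (auto simp: graded_braided_Hopf_ideal_def two_sided_ideal_def)

lemmas J_0 = pm.subspace_0[OF J_sub]
  and J_add = pm.subspace_add[OF J_sub]
  and J_diff = pm.subspace_diff[OF J_sub]
  and J_scale = pm.subspace_scale[OF J_sub]

text \<open>The counit after \<open>der i\<close> reads off a coefficient in degree 1, so it kills
  \<open>J\<close>. Slicing the comultiplication with it therefore stays in \<open>J\<close>, and
  this slice is \<open>der i\<close>.\<close>

lemma J_der:
  assumes "y \<in> J"
  shows "der i y \<in> J"
proof -
  have "counit (der i z) = 0" if "z \<in> J" for z
  proof -
    have "component 1 z = 0" using J1 J_component[OF that, of 1] component_in_homogeneous[of 1 z] by blast
    then show ?thesis using counit_ders_component[of "[i]" 1 z] by simp
  qed
  moreover have "slice (\<lambda>t. counit (der i t)) (comult c y) = der i y"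
    using slice_ders[of "[i]" y] by simp
  ultimately show ?thesis
    using slice_tensor_kernel[OF J_sub _ _ J_comult[OF assms], of "\<lambda>t. counit (der i t)"]
      lin_fun_counit_ders[of "[i]"] by simp
qed

lemma J_ders: "y \<in> J \<Longrightarrow> ders s y \<in> J"
  by (induction s arbitrary: y) (auto intro: J_der)

text \<open>
  By induction on the degree, \<open>t\<close> is primitive modulo \<open>J\<close>: slicing its comultiplication with iterated
  derivatives returns derivatives of \<open>t\<close>, which have lower degree.
\<close>

lemma homogeneous_in_J:
  "\<lbrakk>t \<in> homogeneous n; \<And>s. counit (ders s t) = 0\<rbrakk> \<Longrightarrow> t \<in> J"
proof (induction n arbitrary: t rule: less_induct)
  case (less n)
  have low: "t \<in> J" if "Poly_Mapping.keys t = {}" for t using that J_0 by simp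
  consider "n = 0" | "n = 1" | "n \<ge> 2" by linarith
  then show ?case
  proof cases
    case 1
    then have "Poly_Mapping.keys t \<subseteq> {[]}" using less.prems(1) by (auto simp: homogeneous_def)
    moreover have "[] \<notin> Poly_Mapping.keys t"
      using less.prems(2)[of "[]"] by (simp add: counit_def in_keys_iff)
    ultimately show ?thesis by (intro low) blast
  next
    case 2
    have "w \<notin> Poly_Mapping.keys t" for w
    proof
      assume w: "w \<in> Poly_Mapping.keys t"
      then have "length w = 1" using less.prems(1) 2 by (auto simp: homogeneous_def)
      then obtain i where "w = [i]" by (cases w) auto
      then show False using w less.prems(2)[of "[i]"] counit_der[of i t] by (simp add: in_keys_iff)
    qed
    then show ?thesis by (intro low) blast
  next
    case 3
    define X where "X = comult c t - tensor t 1 - tensor 1 t"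
    obtain zs where zs: "set zs = Poly_Mapping.keys X" "distinct zs"
      using finite_distinct_list[OF finite_keys[of X]] by blast
    define xs where "xs = map (\<lambda>z. (pm_scale (Poly_Mapping.lookup X z) (word (fst z)), word (snd z) :: (basis3, 'k) tensor_algebra)) zs"
    \<comment> \<open>In these degrees the induction hypothesis places the common zeros of the
      functionals in \<open>\<Phi>\<close> inside \<open>J\<close>.\<close>
    define V where "V = {v :: (basis3, 'k) tensor_algebra. \<forall>w\<in>Poly_Mapping.keys v. 1 \<le> length w \<and> length w < n}"
    define \<Phi> where "\<Phi> = range (\<lambda>s t. counit (ders s t))"
    have mid: "X \<in> mid n" unfolding X_def using less.prems(1) 3 by (intro comult_mid) auto
    have xs_sum: "(\<Sum>(u, v)\<leftarrow>xs. F u v) = (\<Sum>z\<in>Poly_Mapping.keys X. F (pm_scale (Poly_Mapping.lookup X z) (word (fst z))) (word (snd z)))"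
      for F :: "_ \<Rightarrow> _ \<Rightarrow> 'c::comm_monoid_add"
      unfolding xs_def using zs by (simp add: o_def sum_list_distinct_conv_sum_set)
    have "(\<Sum>(u, v)\<leftarrow>xs. tensor u v) = lin_ext (\<lambda>z. Poly_Mapping.single z 1) X"
      unfolding xs_sum lin_ext_def by (simp add: tensor_scale_left)
    then have X: "(\<Sum>(u, v)\<leftarrow>xs. tensor u v) = X" by (simp add: lin_ext_id)
    have slice_X: "(\<Sum>(u, v)\<leftarrow>xs. pm_scale (\<phi> v) u) = slice \<phi> X" for \<phi>
      unfolding xs_sum slice_def lin_ext_def by (simp add: case_prod_unfold mult.commute)
    have "X \<in> tensor_kernel J"
      unfolding X[symmetric]
    proof (rule tensor_kernel_detect[OF J_sub])
      show "pm.subspace V" unfolding V_def pm.subspace_def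
        by (auto simp: in_keys_iff lookup_add)
      show "lin_fun \<phi>" if "\<phi> \<in> \<Phi>" for \<phi>
        using that lin_fun_counit_ders by (auto simp: \<Phi>_def)
      show "\<forall>(u, v)\<in>set xs. v \<in> V"
        using mid zs(1) by (auto simp: xs_def V_def mid_def)
      show "\<forall>\<phi>\<in>\<Phi>. (\<Sum>(u, v)\<leftarrow>xs. pm_scale (\<phi> v) u) \<in> J"
      proof
        fix \<phi> assume "\<phi> \<in> \<Phi>"
        then obtain s where s: "\<phi> = (\<lambda>t. counit (ders s t))" by (auto simp: \<Phi>_def)
        have lin: "lin_fun \<phi>" unfolding s by (rule lin_fun_counit_ders)
        have sX: "slice \<phi> X = ders s t - pm_scale (\<phi> 1) t - pm_scale (\<phi> t) 1"
          by (simp add: X_def slice_tensor[OF lin]) (simp add: s slice_ders)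
        have "\<phi> t = 0" using less.prems(2) by (simp add: s)
        show "(\<Sum>(u, v)\<leftarrow>xs. pm_scale (\<phi> v) u) \<in> J"
        \<comment> \<open>For the empty word \<open>ders s t\<close> cancels against the subtracted
          \<open>t\<close>; otherwise \<open>\<phi> 1 = 0\<close> and \<open>der i t\<close> has
          lower degree.\<close>
        proof (cases s)
          case Nil
          then show ?thesis unfolding slice_X sX \<open>\<phi> t = 0\<close> by (simp add: s J_0)
        next
          case (Cons i s')
          have "der i t \<in> homogeneous (n - 1)"
          proof -
            have "component n t = t" using component_homogeneous[OF less.prems(1)] by simp
            then have "der i t = component (n - 1) (der i t)" using der_component[of i "n - 1" t] 3 by simp
            then show ?thesis using component_in_homogeneous by metis
          qed
          then have "der i t \<in> J"
            using less.prems(2)[of "i # _"] 3 by (intro less.IH[of "n - 1"]) auto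
          then have "ders s t \<in> J" using Cons J_ders by simp
          then show ?thesis unfolding slice_X sX \<open>\<phi> t = 0\<close> by (simp add: s Cons)
        qed
      qed
      show "v \<in> J" if v: "v \<in> V" "\<And>\<phi>. \<phi> \<in> \<Phi> \<Longrightarrow> \<phi> v = 0" for v
      proof -
        have "component k v \<in> J" if "k < n" for k
          using v(2) that by (intro less.IH[OF that component_in_homogeneous]) (auto simp: counit_ders_component \<Phi>_def)
        then have "(\<Sum>k<n. component k v) \<in> J" by (intro pm.subspace_sum[OF J_sub]) auto
        moreover have "v = (\<Sum>k<n. component k v)"
          using v(1) by (intro sum_component) (auto simp: V_def)
        ultimately show ?thesis by simp
      qed
    qed
    then have "t \<in> primitive_mod c J" by (simp add: primitive_mod_def X_def)
    then obtain v y where vy: "t = v + y" "v \<in> homogeneous 1" "y \<in> J" using prim by auto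
    \<comment> \<open>In degree \<open>n \<ge> 2\<close> the part \<open>v\<close> from degree 1
      drops out.\<close>
    have "t = component n t" using component_homogeneous[OF less.prems(1)] by simp
    also have "\<dots> = component n y" using component_homogeneous[OF vy(2), of n] 3 vy(1) by simp
    finally show ?thesis using J_component[OF vy(3)] by simp
  qed
qed

lemma in_J_iff: "t \<in> J \<longleftrightarrow> (\<forall>s. counit (ders s t) = 0)"
proof
  assume *: "\<forall>s. counit (ders s t) = 0"
  obtain n where n: "t = (\<Sum>k<n. component k t)" using sum_component_ex by blast
  have "component k t \<in> J" for k
    by (rule homogeneous_in_J[OF component_in_homogeneous]) (simp add: counit_ders_component *)
  then have "(\<Sum>k<n. component k t) \<in> J" by (intro pm.subspace_sum[OF J_sub])
  then show "t \<in> J" using n by simp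
qed (use J_ders J_counit in blast)

text \<open>Reduces verifying a relation to differentiating it once.\<close>

lemma in_J_I:
  assumes "counit t = 0" "\<And>i. der i t \<in> J"
  shows "t \<in> J"
  unfolding in_J_iff
proof
  fix s show "counit (ders s t) = 0"
    using assms by (cases s) (auto simp: in_J_iff)
qed

section \<open>Reduction to the scaled flip\<close>

definition eqJ :: "(basis3, 'k) tensor_algebra \<Rightarrow> (basis3, 'k) tensor_algebra \<Rightarrow> bool" (infix "\<equiv>\<^sub>J" 50)
  where "a \<equiv>\<^sub>J b \<longleftrightarrow> a - b \<in> J"

lemma eqJ_refl [simp]: "a \<equiv>\<^sub>J a" by (simp add: eqJ_def J_0)

lemma eqJ_sym: "a \<equiv>\<^sub>J b \<Longrightarrow> b \<equiv>\<^sub>J a"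
  using J_scale[of "a - b" "-1"] by (simp add: eqJ_def)

lemma eqJ_trans [trans]: "a \<equiv>\<^sub>J b \<Longrightarrow> b \<equiv>\<^sub>J d \<Longrightarrow> a \<equiv>\<^sub>J d"
  using J_add[of "a - b" "b - d"] by (simp add: eqJ_def)

lemma eqJ_add: "a \<equiv>\<^sub>J b \<Longrightarrow> a' \<equiv>\<^sub>J b' \<Longrightarrow> a + a' \<equiv>\<^sub>J b + b'"
  using J_add[of "a - b" "a' - b'"] by (simp add: eqJ_def algebra_simps)

lemma eqJ_scale: "a \<equiv>\<^sub>J b \<Longrightarrow> pm_scale s a \<equiv>\<^sub>J pm_scale s b"
  using J_scale[of "a - b" s] by (simp add: eqJ_def pm.scale_right_diff_distrib)

lemma eqJ_mult_left: "a \<equiv>\<^sub>J b \<Longrightarrow> t * a \<equiv>\<^sub>J t * b"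
  using J_mult(1)[of "a - b" t] by (simp add: eqJ_def right_diff_distrib)

lemma eqJ_mult_right: "a \<equiv>\<^sub>J b \<Longrightarrow> a * t \<equiv>\<^sub>J b * t"
  using J_mult(2)[of "a - b" t] by (simp add: eqJ_def left_diff_distrib)

lemma eqJ_0: "a \<equiv>\<^sub>J 0 \<longleftrightarrow> a \<in> J" by (simp add: eqJ_def)

lemma eqJ_in: "a \<equiv>\<^sub>J b \<Longrightarrow> a \<in> J \<longleftrightarrow> b \<in> J"
  using eqJ_trans eqJ_sym eqJ_0 by metis

lemma two_T: "a + a = (0 :: (basis3, 'k) tensor_algebra)"
proof -
  have "a + a = pm_scale (1 + 1) a" by (simp only: pm.scale_left_distrib pm.scale_one)
  then show ?thesis using two by simp
qed

lemma minus_T: "- a = (a :: (basis3, 'k) tensor_algebra)"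
  using two_T[of a] by (simp add: neg_eq_iff_add_eq_0)

abbreviation "x1 \<equiv> xx X1"
abbreviation "x2 \<equiv> xx X2"
abbreviation "x3 \<equiv> xx X3"

definition w1 :: "(basis3, 'k) tensor_algebra"
  where "w1 = x2 * x3 - pm_scale p (x3 * x2)"

lemma counit_mult: "counit (a * b) = counit a * (counit b :: 'k)" for a b :: "(basis3, 'k) tensor_algebra"
proof (induction a rule: poly_mapping_lin_induct)
  case (2 u)
  show ?case by (induction b rule: poly_mapping_lin_induct) (simp_all add: distrib_left)
qed (simp_all add: distrib_right)

lemma counit_diff: "counit (a - b) = counit a - (counit b :: 'k)" for a b :: "(basis3, 'k) tensor_algebra"
  by (rule lin_fun_diff[OF lin_fun_counit])

lemmas T_simps = der_mult der_xx counit_mult counit_diff pm.scale_right_distrib pm.scale_right_diff_distrib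
  distrib_left distrib_right right_diff_distrib left_diff_distrib

lemma x1_x1: "x1 * x1 \<in> J"
proof (rule in_J_I)
  show "der i (x1 * x1) \<in> J" for i
    by (cases i) (simp_all add: T_simps two_T J_0 del: word_mult)
qed (simp add: T_simps del: word_mult)

lemma x2_x2: "x2 * x2 \<in> J"
proof (rule in_J_I)
  show "der i (x2 * x2) \<in> J" for i
    by (cases i) (simp_all add: T_simps two_T J_0 del: word_mult)
qed (simp add: T_simps del: word_mult)

lemma x1_x2: "x1 * x2 \<equiv>\<^sub>J x2 * x1"
  unfolding eqJ_def
proof (rule in_J_I)
  show "der i (x1 * x2 - x2 * x1) \<in> J" for i
    by (cases i) (simp_all add: T_simps J_0 del: word_mult)
qed (simp add: T_simps del: word_mult)

lemma x1_x3: "x1 * x3 \<equiv>\<^sub>J pm_scale p (x3 * x1)"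
  unfolding eqJ_def
proof (rule in_J_I)
  show "der i (x1 * x3 - pm_scale p (x3 * x1)) \<in> J" for i
    using p_nz by (cases i) (simp_all add: T_simps J_0 del: word_mult)
qed (simp add: T_simps del: word_mult)

lemma x2_x3: "x2 * x3 = w1 + pm_scale p (x3 * x2)"
  by (simp add: w1_def)

text \<open>Only the extra summand \<open>x1\<close> of \<open>g_letter X3 X2\<close> survives; its
  sign disappears in characteristic 2.\<close>

lemma der_w1: "der X1 w1 = 0" "der X2 w1 = 0" "der X3 w1 = x1"
  using p_nz by (simp_all add: w1_def T_simps minus_T del: word_mult)

lemma counit_w1: "counit w1 = 0"
  by (simp add: w1_def T_simps del: word_mult)

lemma x1_w1: "x1 * w1 \<equiv>\<^sub>J pm_scale p (w1 * x1)"
proof -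
  define d12 d13 where "d12 = x1 * x2 - x2 * x1" and "d13 = x1 * x3 - pm_scale p (x3 * x1)"
  have J: "d12 \<in> J" "d13 \<in> J" using x1_x2 x1_x3 by (simp_all add: d12_def d13_def eqJ_def del: word_mult)
  have "x1 * w1 - pm_scale p (w1 * x1) = d12 * x3 + x2 * d13 - pm_scale p (d13 * x2) - pm_scale p (pm_scale p (x3 * d12))"
    by (simp add: w1_def d12_def d13_def T_simps algebra_simps)
  also have "\<dots> \<in> J" using J by (intro J_add J_diff J_scale J_mult)
  finally show ?thesis by (simp add: eqJ_def)
qed

lemma x2_w1: "x2 * w1 \<equiv>\<^sub>J pm_scale p (w1 * x2)"
proof -
  \<comment> \<open>This mixed term arises from both products and cancels in characteristic
    2.\<close>
  define t where "t = pm_scale p (x2 * x3 * x2)"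
  have "x2 * w1 - pm_scale p (w1 * x2) = (x2 * x2) * x3 + pm_scale (p * p) (x3 * (x2 * x2)) - (t + t)"
    by (simp add: w1_def t_def T_simps algebra_simps)
  also have "\<dots> \<in> J" unfolding two_T
    by (intro J_add J_diff J_scale J_0 J_mult(1)[OF x2_x2] J_mult(2)[OF x2_x2])
  finally show ?thesis by (simp add: eqJ_def)
qed

text \<open>For \<open>X3\<close> this holds modulo \<open>J\<close> only: the extra
  \<open>x1\<close> in the image of \<open>x2\<close> produces the relation between
  \<open>x1\<close> and \<open>x3\<close>.\<close>

lemma g_act_w1: "g_act X3 w1 \<equiv>\<^sub>J pm_scale (inverse p * q) w1" "g_act X1 w1 = pm_scale p w1"
proof -
  have "g_act X3 w1 - pm_scale (inverse p * q) w1 = pm_scale (inverse p * q) (x1 * x3 - pm_scale p (x3 * x1))"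
    using p_nz by (simp add: w1_def T_simps mult_ac del: word_mult)
  also have "\<dots> \<in> J" using x1_x3 unfolding eqJ_def by (rule J_scale)
  finally show "g_act X3 w1 \<equiv>\<^sub>J pm_scale (inverse p * q) w1" by (simp add: eqJ_def)
  show "g_act X1 w1 = pm_scale p w1" by (simp add: w1_def T_simps mult_ac del: word_mult)
qed

sublocale qparam q .

text \<open>
  Modulo \<open>J\<close>, the element \<open>t\<close> represents the element of the Nichols algebra of the scaled flip that is
  encoded by \<open>f\<close> and has bidegree \<open>(a, b)\<close>. The power of \<open>\<wp>\<close> undoes the twist. Bidegrees are integers
  because differentiation lowers them; nothing nonzero has a negative one.
\<close>

inductive realises :: "int \<Rightarrow> int \<Rightarrow> (basis3, 'k) tensor_algebra \<Rightarrow> (bool list \<Rightarrow> 'k) \<Rightarrow> bool"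
  where
    realises_unit: "realises 0 0 1 unit_fun"
  | realises_x3: "realises a b t f \<Longrightarrow> realises (a + 1) b (pm_scale (p powi b) (x3 * t)) (letter_mult False f)"
  | realises_w1: "realises a b t f \<Longrightarrow> realises a (b + 1) (w1 * t) (letter_mult True f)"
  | realises_zero: "realises a b 0 (\<lambda>v. 0)"
  | realises_add: "realises a b t f \<Longrightarrow> realises a b t' f' \<Longrightarrow> realises a b (t + t') (\<lambda>v. f v + f' v)"
  | realises_scale: "realises a b t f \<Longrightarrow> realises a b (pm_scale s t) (\<lambda>v. s * f v)"

text \<open>The factor \<open>p powi (- b)\<close> is the twist that the scaling in
  \<open>realises_x3\<close> compensates.\<close>

lemma realises_gT: "realises a b t f \<Longrightarrow> g_act X3 t \<equiv>\<^sub>J pm_scale (q powi (a + b) * p powi (- b)) t"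
proof (induction rule: realises.induct)
  case (realises_x3 a b t f)
  have "pm_scale (p powi b * q) (x3 * g_act X3 t)
    \<equiv>\<^sub>J pm_scale (p powi b * q) (x3 * (pm_scale (q powi (a + b) * p powi (- b)) t))"
    by (intro eqJ_scale eqJ_mult_left realises_x3.IH)
  then show ?case using q_nz by (simp add: power_int_add mult_ac del: word_mult)
next
  case (realises_w1 a b t f)
  have "g_act X3 w1 * g_act X3 t \<equiv>\<^sub>J pm_scale (inverse p * q) w1 * g_act X3 t"
    by (intro eqJ_mult_right g_act_w1)
  also have "\<dots> \<equiv>\<^sub>J pm_scale (inverse p * q) w1 * pm_scale (q powi (a + b) * p powi (- b)) t"
    by (intro eqJ_mult_left realises_w1.IH)
  also have "\<dots> = pm_scale (q powi (a + (b + 1)) * p powi (- (b + 1))) (w1 * t)"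
  proof -
    have "q powi (a + (b + 1)) = q powi (a + b) * q" "p powi (- (b + 1)) = p powi (- b) * inverse p"
      using p_nz q_nz by (simp_all add: power_int_add power_int_minus power_int_diff divide_inverse flip: add.assoc)
    then show ?thesis by (simp add: mult_ac)
  qed
  finally show ?case by simp
next
  case (realises_add a b t f t' f')
  then show ?case using eqJ_add by (simp add: pm.scale_right_distrib)
next
  case (realises_scale a b t f s)
  then show ?case using eqJ_scale[OF realises_scale.IH, of s] by (simp add: mult.commute)
qed simp_all

lemma realises_x1: "realises a b t f \<Longrightarrow> x1 * t \<equiv>\<^sub>J pm_scale (p powi (a + b)) (t * x1)"
proof (induction rule: realises.induct)
  case (realises_x3 a b t f)
  have "x1 * pm_scale (p powi b) (x3 * t) = pm_scale (p powi b) (x1 * x3 * t)"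
    by (simp add: mult.assoc del: word_mult)
  also have "\<dots> \<equiv>\<^sub>J pm_scale (p powi b) (pm_scale p (x3 * x1) * t)"
    by (intro eqJ_scale eqJ_mult_right x1_x3)
  also have "\<dots> = pm_scale (p powi b * p) (x3 * (x1 * t))"
    by (simp add: mult.assoc del: word_mult)
  also have "\<dots> \<equiv>\<^sub>J pm_scale (p powi b * p) (x3 * pm_scale (p powi (a + b)) (t * x1))"
    by (intro eqJ_scale eqJ_mult_left realises_x3.IH)
  also have "\<dots> = pm_scale (p powi (a + 1 + b)) (pm_scale (p powi b) (x3 * t) * x1)"
    using p_nz by (simp add: power_int_add mult_ac del: word_mult)
  finally show ?case .
next
  case (realises_w1 a b t f)
  have "x1 * (w1 * t) = x1 * w1 * t" by (simp add: mult.assoc)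
  also have "\<dots> \<equiv>\<^sub>J pm_scale p (w1 * x1) * t" by (intro eqJ_mult_right x1_w1)
  also have "\<dots> = pm_scale p (w1 * (x1 * t))" by (simp add: mult.assoc)
  also have "\<dots> \<equiv>\<^sub>J pm_scale p (w1 * pm_scale (p powi (a + b)) (t * x1))"
    by (intro eqJ_scale eqJ_mult_left realises_w1.IH)
  also have "\<dots> = pm_scale (p powi (a + (b + 1))) (w1 * t * x1)"
    using p_nz by (simp add: power_int_add mult_ac)
  finally show ?case .
next
  case (realises_add a b t f t' f')
  then show ?case using eqJ_add by (simp add: pm.scale_right_distrib distrib_left distrib_right)
next
  case (realises_scale a b t f s)
  then show ?case using eqJ_scale[OF realises_scale.IH, of s] by (simp add: mult.commute)
qed simp_all

lemma realises_der12: "realises a b t f \<Longrightarrow> der X1 t = 0 \<and> der X2 t = 0"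
  by (induction rule: realises.induct) (simp_all add: der_mult der_xx der_w1)

lemma realises_counit: "realises a b t f \<Longrightarrow> counit t = f []"
  by (induction rule: realises.induct) (simp_all add: counit_mult counit_w1 del: word_mult)

lemma letter_mult_zero_fun [simp]: "letter_mult j (\<lambda>v. 0) = (\<lambda>v. 0)"
  by (rule ext) (rule letter_mult_zero)

lemma realises_neg: "realises a b t f \<Longrightarrow> a < 0 \<or> b < 0 \<Longrightarrow> t = 0 \<and> f = (\<lambda>v. 0)"
proof (induction rule: realises.induct)
  case (realises_x3 a b t f)
  then have "t = 0" "f = (\<lambda>v. 0)" by auto
  then show ?case by simp
next
  case (realises_w1 a b t f)
  then have "t = 0" "f = (\<lambda>v. 0)" by auto
  then show ?case by simp
qed auto

lemma letter_mult_support: "(\<And>v. f v \<noteq> 0 \<Longrightarrow> int (length v) = n) \<Longrightarrow> letter_mult j f v \<noteq> 0 \<Longrightarrow> int (length v) = n + 1"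
proof (induction v arbitrary: f n)
  case (Cons i v)
  show ?case
  proof (cases "letter_mult j (\<lambda>v. f (i # v)) v = 0")
    case True
    then have "f v \<noteq> 0" using Cons.prems(2) by (auto split: if_splits)
    then show ?thesis using Cons.prems(1)[of v] by simp
  next
    case False
    have "int (length v) = (n - 1) + 1"
      by (rule Cons.IH[OF _ False]) (use Cons.prems(1) in fastforce)
    then show ?thesis by simp
  qed
qed simp

lemma realises_support: "realises a b t f \<Longrightarrow> f v \<noteq> 0 \<Longrightarrow> int (length v) = a + b"
proof (induction arbitrary: v rule: realises.induct)
  case (realises_x3 a b t f)
  show ?case using letter_mult_support[OF realises_x3.IH realises_x3.prems] by simp
next
  case (realises_w1 a b t f)
  show ?case using letter_mult_support[OF realises_w1.IH realises_w1.prems] by simp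
next
  case (realises_add a b t f t' f')
  then have "f v \<noteq> 0 \<or> f' v \<noteq> 0" by auto
  then show ?case using realises_add.IH by blast
next
  case (realises_scale a b t f s)
  then show ?case by simp
qed (auto simp: unit_fun_def split: if_splits)

lemma realises_qdeg: "realises a b t f \<Longrightarrow> q ^ length v * f v = q powi (a + b) * f v"
  using realises_support[of a b t f v] by (cases "f v = 0") (simp_all flip: power_int_of_nat)

lemma p_powi: "p powi m * p powi n = p powi (m + n)"
  using p_nz by (simp add: power_int_add)

text \<open>In the Leibniz rule \<open>x3 * t\<close> returns a multiple of \<open>t\<close>, as in
  \<open>letter_mult False\<close>. For \<open>w1 * t\<close> it gives
  \<open>x1 * g_act X3 t\<close>, and moving \<open>x1\<close> to the right leaves the factor
  \<open>p powi a\<close>.\<close>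

lemma realises_der3:
  "realises a b t f \<Longrightarrow> \<exists>t0 t1. realises (a - 1) b t0 (\<lambda>v. f (False # v)) \<and> realises a (b - 1) t1 (\<lambda>v. f (True # v)) \<and>
     der X3 t \<equiv>\<^sub>J t0 + pm_scale (p powi a) (t1 * x1)"
proof (induction rule: realises.induct)
  case realises_unit
  show ?case by (intro exI[of _ 0]) (simp add: realises_zero)
next
  case (realises_x3 a b t f)
  then obtain t0 t1 where t: "realises (a - 1) b t0 (\<lambda>v. f (False # v))" "realises a (b - 1) t1 (\<lambda>v. f (True # v))"
    "der X3 t \<equiv>\<^sub>J t0 + pm_scale (p powi a) (t1 * x1)" by blast
  let ?t0 = "pm_scale (p powi b) (x3 * t0) + pm_scale (q powi (a + b)) t"
  let ?t1 = "pm_scale (p powi (b - 1)) (x3 * t1)"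
  have 0: "realises (a + 1 - 1) b ?t0 (\<lambda>v. letter_mult False f (False # v))"
  proof -
    have "realises a b (pm_scale (p powi b) (x3 * t0)) (letter_mult False (\<lambda>v. f (False # v)))"
      using realises.realises_x3[OF t(1)] by simp
    from realises_add[OF this realises_scale[OF realises_x3.hyps, of "q powi (a + b)"]] show ?thesis
      by (simp add: realises_qdeg[OF realises_x3.hyps])
  qed
  have 1: "realises (a + 1) (b - 1) ?t1 (\<lambda>v. letter_mult False f (True # v))"
    using realises.realises_x3[OF t(2)] by simp
  have "der X3 (pm_scale (p powi b) (x3 * t)) = pm_scale (p powi b) (x3 * der X3 t) + pm_scale (p powi b) (g_act X3 t)"
    by (simp add: T_simps del: word_mult)
  also have "\<dots> \<equiv>\<^sub>J pm_scale (p powi b) (x3 * (t0 + pm_scale (p powi a) (t1 * x1)))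
      + pm_scale (p powi b) (pm_scale (q powi (a + b) * p powi (- b)) t)"
    by (intro eqJ_add eqJ_scale eqJ_mult_left t(3) realises_gT[OF realises_x3.hyps])
  also have "\<dots> = ?t0 + pm_scale (p powi (a + 1)) (?t1 * x1)"
  proof -
    have "p powi b * (q powi (a + b) * p powi (- b)) = q powi (a + b)"
      using p_nz by (simp add: power_int_minus)
    moreover have "p powi (a + 1) * p powi (b - 1) = p powi b * p powi a"
      by (simp only: p_powi) (simp add: add.commute)
    ultimately show ?thesis by (simp add: distrib_left pm.scale_right_distrib mult.assoc add_ac del: word_mult)
  qed
  finally show ?case using 0 1 by blast
next
  case (realises_w1 a b t f)
  then obtain t0 t1 where t: "realises (a - 1) b t0 (\<lambda>v. f (False # v))" "realises a (b - 1) t1 (\<lambda>v. f (True # v))"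
    "der X3 t \<equiv>\<^sub>J t0 + pm_scale (p powi a) (t1 * x1)" by blast
  let ?t1 = "w1 * t1 + pm_scale (q powi (a + b)) t"
  have 0: "realises (a - 1) (b + 1) (w1 * t0) (\<lambda>v. letter_mult True f (False # v))"
    using realises.realises_w1[OF t(1)] by simp
  have 1: "realises a (b + 1 - 1) ?t1 (\<lambda>v. letter_mult True f (True # v))"
  proof -
    have "realises a b (w1 * t1) (letter_mult True (\<lambda>v. f (True # v)))"
      using realises.realises_w1[OF t(2)] by simp
    from realises_add[OF this realises_scale[OF realises_w1.hyps, of "q powi (a + b)"]] show ?thesis
      by (simp add: realises_qdeg[OF realises_w1.hyps])
  qed
  have "der X3 (w1 * t) = w1 * der X3 t + x1 * g_act X3 t"
    by (simp add: der_mult der_w1)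
  also have "\<dots> \<equiv>\<^sub>J w1 * (t0 + pm_scale (p powi a) (t1 * x1)) + x1 * (pm_scale (q powi (a + b) * p powi (- b)) t)"
    by (intro eqJ_add eqJ_mult_left t(3) realises_gT[OF realises_w1.hyps])
  also have "\<dots> = w1 * (t0 + pm_scale (p powi a) (t1 * x1)) + pm_scale (q powi (a + b) * p powi (- b)) (x1 * t)"
    by simp
  also have "\<dots> \<equiv>\<^sub>J w1 * (t0 + pm_scale (p powi a) (t1 * x1))
      + pm_scale (q powi (a + b) * p powi (- b)) (pm_scale (p powi (a + b)) (t * x1))"
    by (intro eqJ_add eqJ_refl eqJ_scale realises_x1[OF realises_w1.hyps])
  also have "\<dots> = w1 * t0 + pm_scale (p powi a) (?t1 * x1)"
  proof -
    have "q powi (a + b) * p powi (- b) * p powi (a + b) = q powi (a + b) * p powi (- b + (a + b))"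
      by (simp only: p_powi mult.assoc)
    then have "q powi (a + b) * p powi (- b) * p powi (a + b) = p powi a * q powi (a + b)"
      by (simp add: mult.commute)
    then show ?thesis by (simp add: distrib_left distrib_right pm.scale_right_distrib mult.assoc add_ac)
  qed
  finally show ?case using 0 1 by blast
next
  case (realises_zero a b)
  show ?case by (intro exI[of _ 0]) (simp add: realises.realises_zero)
next
  case (realises_add a b t f t' f')
  then obtain t0 t1 t0' t1' where *: "realises (a - 1) b t0 (\<lambda>v. f (False # v))" "realises a (b - 1) t1 (\<lambda>v. f (True # v))"
    "der X3 t \<equiv>\<^sub>J t0 + pm_scale (p powi a) (t1 * x1)"
    "realises (a - 1) b t0' (\<lambda>v. f' (False # v))" "realises a (b - 1) t1' (\<lambda>v. f' (True # v))"
    "der X3 t' \<equiv>\<^sub>J t0' + pm_scale (p powi a) (t1' * x1)" by blast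
  show ?case
    using realises.realises_add[OF *(1,4)] realises.realises_add[OF *(2,5)] eqJ_add[OF *(3,6)]
    by (intro exI[of _ "t0 + t0'"] exI[of _ "t1 + t1'"])
      (simp add: distrib_right pm.scale_right_distrib add_ac)
next
  case (realises_scale a b t f s)
  then obtain t0 t1 where t: "realises (a - 1) b t0 (\<lambda>v. f (False # v))" "realises a (b - 1) t1 (\<lambda>v. f (True # v))"
    "der X3 t \<equiv>\<^sub>J t0 + pm_scale (p powi a) (t1 * x1)" by blast
  show ?case
    using realises.realises_scale[OF t(1), of s] realises.realises_scale[OF t(2), of s] eqJ_scale[OF t(3), of s]
    by (intro exI[of _ "pm_scale s t0"] exI[of _ "pm_scale s t1"])
      (simp add: pm.scale_right_distrib mult.commute)
qed

text \<open>\<open>der X1\<close> kills \<open>t0\<close> and \<open>t1\<close>, so it extracts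
  \<open>t1\<close> from \<open>der X3 t\<close>. Hence \<open>der X3 t\<close> lies in
  \<open>J\<close> iff both do, and these have lower degree.\<close>

lemma realises_in_J: "realises a b t f \<Longrightarrow> t \<in> J \<longleftrightarrow> f = (\<lambda>v. 0)"
proof (induction "nat (a + b)" arbitrary: a b t f rule: less_induct)
  case less
  obtain t0 t1 where t: "realises (a - 1) b t0 (\<lambda>v. f (False # v))" "realises a (b - 1) t1 (\<lambda>v. f (True # v))"
    "der X3 t \<equiv>\<^sub>J t0 + pm_scale (p powi a) (t1 * x1)" using realises_der3[OF less.prems] by blast
  have IH: "(t0 \<in> J \<longleftrightarrow> (\<lambda>v. f (False # v)) = (\<lambda>v. 0)) \<and> (t1 \<in> J \<longleftrightarrow> (\<lambda>v. f (True # v)) = (\<lambda>v. 0))"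
  proof (cases "a + b > 0")
    case True
    have "t0 \<in> J \<longleftrightarrow> (\<lambda>v. f (False # v)) = (\<lambda>v. 0)"
      by (rule less.hyps[OF _ t(1)]) (use True in linarith)
    moreover have "t1 \<in> J \<longleftrightarrow> (\<lambda>v. f (True # v)) = (\<lambda>v. 0)"
      by (rule less.hyps[OF _ t(2)]) (use True in linarith)
    ultimately show ?thesis ..
  next
    \<comment> \<open>Here \<open>t0\<close> and \<open>t1\<close> each have a negative degree in x
      or y; this replaces the induction, whose measure cannot decrease.\<close>
    case False
    then have "t0 = 0 \<and> (\<lambda>v. f (False # v)) = (\<lambda>v. 0)" by (intro realises_neg[OF t(1)]) linarith
    moreover have "t1 = 0 \<and> (\<lambda>v. f (True # v)) = (\<lambda>v. 0)"
      using False by (intro realises_neg[OF t(2)]) linarith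
    ultimately show ?thesis using J_0 by blast
  qed
  have f: "f = (\<lambda>v. 0) \<longleftrightarrow> f [] = 0 \<and> (\<lambda>v. f (False # v)) = (\<lambda>v. 0) \<and> (\<lambda>v. f (True # v)) = (\<lambda>v. 0)"
  proof
    assume *: "f [] = 0 \<and> (\<lambda>v. f (False # v)) = (\<lambda>v. 0) \<and> (\<lambda>v. f (True # v)) = (\<lambda>v. 0)"
    show "f = (\<lambda>v. 0)"
    proof
      fix v show "f v = 0"
      proof (cases v)
        case (Cons i w)
        have "f (False # w) = 0" "f (True # w) = 0" using * by (blast dest: fun_cong)+
        then show ?thesis using Cons by (cases i) simp_all
      qed (use * in simp)
    qed
  qed simp
  have *: "t \<in> J \<longleftrightarrow> counit t = 0 \<and> t0 \<in> J \<and> t1 \<in> J"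
  proof
    assume tJ: "t \<in> J"
    then have s: "t0 + pm_scale (p powi a) (t1 * x1) \<in> J"
      using J_der[OF tJ, of X3] eqJ_in[OF t(3)] by simp
    have "der X1 (t0 + pm_scale (p powi a) (t1 * x1)) = pm_scale (p powi a) t1"
      using realises_der12[OF t(1)] realises_der12[OF t(2)] by (simp add: der_mult der_xx)
    then have "pm_scale (p powi a) t1 \<in> J" using J_der[OF s, of X1] by simp
    then have "pm_scale (inverse (p powi a)) (pm_scale (p powi a) t1) \<in> J" by (rule J_scale)
    then have t1: "t1 \<in> J" using p_nz by simp
    have "pm_scale (p powi a) (t1 * x1) \<in> J" by (intro J_scale J_mult(2) t1)
    from J_diff[OF s this] have "t0 \<in> J" by simp
    then show "counit t = 0 \<and> t0 \<in> J \<and> t1 \<in> J" using J_counit[OF tJ] t1 by simp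
  next
    assume *: "counit t = 0 \<and> t0 \<in> J \<and> t1 \<in> J"
    then have "t0 + pm_scale (p powi a) (t1 * x1) \<in> J" by (intro J_add J_scale J_mult(2)) simp_all
    then have "der X3 t \<in> J" using eqJ_in[OF t(3)] by simp
    then have der: "der i t \<in> J" for i using realises_der12[OF less.prems] J_0 by (cases i) simp_all
    show "t \<in> J" by (rule in_J_I) (use * der in simp_all)
  qed
  show ?case unfolding * IH[THEN conjunct1] IH[THEN conjunct2] realises_counit[OF less.prems] by (rule f[symmetric])
qed

section \<open>From A to the whole quotient T(V)/J\<close>

text \<open>The powers of \<open>p\<close> are those of \<open>realises_x3\<close>, so that the word
  represents \<open>shuffle_word u\<close> without further scalars.\<close>

fun plane_word :: "bool list \<Rightarrow> (basis3, 'k) tensor_algebra"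
  where
    "plane_word [] = 1"
  | "plane_word (False # u) = pm_scale (p ^ count_list u True) (x3 * plane_word u)"
  | "plane_word (True # u) = w1 * plane_word u"

lemma realises_pw: "realises (int (count_list u False)) (int (count_list u True)) (plane_word u) (shuffle_word u)"
proof (induction u rule: plane_word.induct)
  case 1
  show ?case using realises_unit by simp
next
  case (2 u)
  then show ?case using realises_x3[OF 2] by (simp add: add.commute)
next
  case (3 u)
  then show ?case using realises_w1[OF 3] by (simp add: add.commute)
qed

lemma plane_word_in_J: "plane_word u \<in> J \<longleftrightarrow> shuffle_word u = (\<lambda>v. 0)"
  by (rule realises_in_J[OF realises_pw])

lemma w1_homogeneous: "w1 \<in> homogeneous 2"
  unfolding w1_def
  by (intro pm.subspace_diff[OF subspace_homogeneous] pm.subspace_scale[OF subspace_homogeneous])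
    (simp_all add: homogeneous_def)

lemma plane_word_homogeneous: "\<exists>n\<ge>length u. plane_word u \<in> homogeneous n"
proof (induction u rule: plane_word.induct)
  case 1
  show ?case using one_homogeneous by auto
next
  case (2 u)
  then obtain n where n: "n \<ge> length u" "plane_word u \<in> homogeneous n" by blast
  have "x3 * plane_word u \<in> homogeneous (1 + n)"
    by (rule mult_homogeneous[OF _ n(2)]) (simp add: word_homogeneous)
  then have "plane_word (False # u) \<in> homogeneous (1 + n)"
    by (simp add: pm.subspace_scale[OF subspace_homogeneous])
  then show ?case using n(1) by (intro exI[of _ "1 + n"]) simp
next
  case (3 u)
  then obtain n where n: "n \<ge> length u" "plane_word u \<in> homogeneous n" by blast
  have "plane_word (True # u) \<in> homogeneous (2 + n)"
    using mult_homogeneous[OF w1_homogeneous n(2)] by simp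
  then show ?case using n(1) by (intro exI[of _ "2 + n"]) simp
qed

text \<open>Since \<open>J\<close> is graded, the quotient vanishes beyond the degrees occurring in
  a finite spanning set.\<close>

lemma finite_dim_high_degree:
  assumes "finite_dimensional_quotient J"
  shows "\<exists>d. \<forall>n\<ge>d. homogeneous n \<subseteq> J"
proof -
  obtain B where B: "finite B" "pm.span (B \<union> J) = UNIV"
    using assms by (auto simp: finite_dimensional_quotient_def)
  have "finite (\<Union>b\<in>B. length ` Poly_Mapping.keys b)" using B(1) by simp
  then obtain d where d: "\<forall>m\<in>(\<Union>b\<in>B. length ` Poly_Mapping.keys b). m < d"
    using finite_nat_set_iff_bounded by blast
  have "t \<in> J" if t: "t \<in> homogeneous n" and n: "n \<ge> d" for n t
  proof -
    have "t \<in> pm.span (B \<union> J)" using B(2) by simp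
    then obtain b y where bt: "t = b + y" "b \<in> pm.span B" "y \<in> pm.span J"
      by (auto simp: pm.span_Un)
    have y: "y \<in> J" using bt(3) pm.span_minimal[OF subset_refl J_sub] by blast
    have "component n b = 0" using bt(2)
    proof (induction rule: pm.span_induct_alt)
      case (step s x z)
      have "component n x = lin_ext (\<lambda>w. 0) x"
        unfolding component_def by (rule lin_ext_cong_keys) (use step(1) d n in fastforce)
      then show ?case using step by simp
    qed simp
    then have "component n t = component n y" using bt(1) by simp
    then show ?thesis using J_component[OF y, of n] component_homogeneous[OF t, of n] by simp
  qed
  then show ?thesis by blast
qed

text \<open>Passing \<open>x3\<close> creates a \<open>w1\<close> and passing \<open>w1\<close> only
  a scalar, so all terms without \<open>x2\<close> on the right stay in A.\<close>

lemma x2_pw: "\<exists>h s. h \<in> pm.span (range plane_word) \<and> x2 * plane_word u \<equiv>\<^sub>J h + pm_scale s (plane_word u * x2)"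
proof (induction u rule: plane_word.induct)
  case 1
  show ?case by (intro exI[of _ 0] exI[of _ 1]) (simp add: pm.span_zero)
next
  case (2 u)
  then obtain h s where hs: "h \<in> pm.span (range plane_word)" "x2 * plane_word u \<equiv>\<^sub>J h + pm_scale s (plane_word u * x2)" by blast
  have x3h: "x3 * h \<in> pm.span (range plane_word)" using hs(1)
  proof (induction rule: pm.span_induct_alt)
    case (step r x z)
    then obtain v where "x = plane_word v" by auto
    then have "x3 * x = pm_scale (inverse (p ^ count_list v True)) (plane_word (False # v))"
      using p_nz by simp
    then have "x3 * x \<in> pm.span (range plane_word)"
      by (simp only:) (intro pm.span_scale pm.span_base rangeI)
    then show ?case using step by (simp add: distrib_left pm.span_add pm.span_scale)
  qed (simp add: pm.span_zero)
  define a where "a = p ^ count_list u True"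
  have "x2 * plane_word (False # u) = pm_scale a ((w1 + pm_scale p (x3 * x2)) * plane_word u)"
    by (simp add: a_def mult.assoc flip: x2_x3 del: word_mult)
  also have "\<dots> = pm_scale a (plane_word (True # u) + pm_scale p (x3 * (x2 * plane_word u)))"
    by (simp add: distrib_right mult.assoc del: word_mult)
  also have "\<dots> \<equiv>\<^sub>J pm_scale a (plane_word (True # u) + pm_scale p (x3 * (h + pm_scale s (plane_word u * x2))))"
    by (intro eqJ_scale eqJ_add eqJ_refl eqJ_mult_left hs(2))
  also have "\<dots> = pm_scale a (plane_word (True # u) + pm_scale p (x3 * h)) + pm_scale (p * s) (plane_word (False # u) * x2)"
    by (simp add: a_def distrib_left pm.scale_right_distrib mult_ac del: word_mult)
  finally have "x2 * plane_word (False # u) \<equiv>\<^sub>J pm_scale a (plane_word (True # u) + pm_scale p (x3 * h)) + pm_scale (p * s) (plane_word (False # u) * x2)" .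
  moreover have "pm_scale a (plane_word (True # u) + pm_scale p (x3 * h)) \<in> pm.span (range plane_word)"
    by (intro pm.span_scale pm.span_add x3h) (rule pm.span_base, rule rangeI)
  ultimately show ?case by blast
next
  case (3 u)
  then obtain h s where hs: "h \<in> pm.span (range plane_word)" "x2 * plane_word u \<equiv>\<^sub>J h + pm_scale s (plane_word u * x2)" by blast
  have w1h: "w1 * h \<in> pm.span (range plane_word)" using hs(1)
  proof (induction rule: pm.span_induct_alt)
    case (step r x z)
    then obtain v where "x = plane_word v" by auto
    then have "w1 * x = plane_word (True # v)" by simp
    then have "w1 * x \<in> pm.span (range plane_word)"
      by (simp only:) (intro pm.span_scale pm.span_base rangeI)
    then show ?case using step by (simp add: distrib_left pm.span_add pm.span_scale)
  qed (simp add: pm.span_zero)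
  have "x2 * plane_word (True # u) = (x2 * w1) * plane_word u" by (simp add: mult.assoc)
  also have "\<dots> \<equiv>\<^sub>J pm_scale p (w1 * x2) * plane_word u" by (intro eqJ_mult_right x2_w1)
  also have "\<dots> = pm_scale p (w1 * (x2 * plane_word u))" by (simp add: mult.assoc)
  also have "\<dots> \<equiv>\<^sub>J pm_scale p (w1 * (h + pm_scale s (plane_word u * x2)))"
    by (intro eqJ_scale eqJ_mult_left hs(2))
  also have "\<dots> = pm_scale p (w1 * h) + pm_scale (p * s) (plane_word (True # u) * x2)"
    by (simp add: distrib_left pm.scale_right_distrib mult.assoc)
  finally have "x2 * plane_word (True # u) \<equiv>\<^sub>J pm_scale p (w1 * h) + pm_scale (p * s) (plane_word (True # u) * x2)" .
  moreover have "pm_scale p (w1 * h) \<in> pm.span (range plane_word)" by (intro pm.span_scale w1h)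
  ultimately show ?case by blast
qed

text \<open>A times the four monomials in \<open>M\<close> spans the quotient: the span contains 1
  and is stable under left multiplication by each \<open>xx i\<close>, as \<open>x1\<close> and
  \<open>x2\<close> commute and square to zero modulo \<open>J\<close>.\<close>

lemma nilpotent_imp_finite_dim:
  assumes "\<And>u. length u \<ge> L \<Longrightarrow> shuffle_word u = (\<lambda>v. 0)"
  shows "finite_dimensional_quotient J"
proof -
  define M where "M = {1, x1, x2, x1 * x2}"
  define B where "B = (\<lambda>(u, m). plane_word u * m) ` ({u. length u \<le> L} \<times> M)"
  define Y where "Y = pm.span (B \<union> J)"
  have "finite {u :: bool list. length u \<le> L}"
    using finite_lists_length_le[of "UNIV :: bool set" L] by simp
  then have "finite B" unfolding B_def M_def by (intro finite_imageI finite_cartesian_product) auto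
  have Y: "pm.subspace Y" unfolding Y_def by (rule pm.subspace_span)
  note Y_add = pm.subspace_add[OF Y] and Y_scale = pm.subspace_scale[OF Y] and Y_0 = pm.subspace_0[OF Y]
  have JY: "a \<in> Y" if "a \<in> J" for a unfolding Y_def using that by (intro pm.span_base) simp
  have eqY: "b \<in> Y \<Longrightarrow> a \<equiv>\<^sub>J b \<Longrightarrow> a \<in> Y" for a b
    using Y_add[of b "a - b"] JY by (auto simp: eqJ_def)
  have pwY: "plane_word u * m \<in> Y" if "m \<in> M" for u m
  proof (cases "length u \<le> L")
    case True
    then show ?thesis unfolding Y_def using that by (intro pm.span_base) (auto simp: B_def)
  next
    case False
    then have "plane_word u \<in> J" using assms[of u] by (simp add: plane_word_in_J)
    then show ?thesis by (intro JY J_mult)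
  qed
  have spanY: "h * m \<in> Y" if "h \<in> pm.span (range plane_word)" "m \<in> M" for h m
    using that(1)
  proof (induction rule: pm.span_induct_alt)
    case (step s x z)
    obtain v where "x = plane_word v" using step(1) by auto
    then have "x * m \<in> Y" using pwY[OF that(2)] by simp
    then show ?case using step(2) by (simp add: distrib_right Y_add Y_scale)
  qed (simp add: Y_0)
  have x1_M: "x1 * m \<in> M \<or> x1 * m \<in> J" if "m \<in> M" for m
  proof -
    have "x1 * (x1 * x2) \<in> J" using J_mult(2)[OF x1_x1, of x2] by (simp add: mult.assoc)
    then show ?thesis using that x1_x1 unfolding M_def by (auto simp del: word_mult)
  qed
  have x2_M: "\<exists>m'\<in>M \<union> J. x2 * m \<equiv>\<^sub>J m'" if "m \<in> M" for m
  proof -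
    consider "m = 1" | "m = x1" | "m = x2" | "m = x1 * x2" using \<open>m \<in> M\<close> unfolding M_def by blast
    then show ?thesis
    proof cases
      case 1
      then show ?thesis by (intro bexI[of _ x2]) (simp_all add: M_def)
    next
      case 2
      then show ?thesis using eqJ_sym[OF x1_x2] by (intro bexI[of _ "x1 * x2"]) (simp_all add: M_def del: word_mult)
    next
      case 3
      then show ?thesis using x2_x2 by (intro bexI[of _ "x2 * x2"]) (simp_all del: word_mult)
    next
      case 4
      have "x2 * (x1 * x2) \<equiv>\<^sub>J x1 * (x2 * x2)"
        using eqJ_mult_right[OF eqJ_sym[OF x1_x2], of x2] by (simp add: mult.assoc del: word_mult)
      then show ?thesis using J_mult(1)[OF x2_x2, of x1] 4 by (intro bexI[of _ "x1 * (x2 * x2)"]) (simp_all del: word_mult)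
    qed
  qed
  have gen: "xx i * (plane_word u * m) \<in> Y" if m: "m \<in> M" for i u m
  proof (cases i)
    case X3
    have "xx i * (plane_word u * m) = pm_scale (inverse (p ^ count_list u True)) (plane_word (False # u) * m)"
      using p_nz X3 by (simp add: mult.assoc)
    then show ?thesis using pwY[OF m] by (simp add: Y_scale del: plane_word.simps)
  next
    case X1
    define s where "s = p powi (int (count_list u False) + int (count_list u True))"
    have "x1 * plane_word u * m \<equiv>\<^sub>J pm_scale s (plane_word u * x1) * m"
      unfolding s_def by (intro eqJ_mult_right realises_x1[OF realises_pw])
    moreover have "pm_scale s (plane_word u * x1) * m \<in> Y"
    proof -
      have "plane_word u * (x1 * m) \<in> Y" using x1_M[OF m] pwY JY J_mult(1) by blast
      then show ?thesis by (simp add: mult.assoc Y_scale)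
    qed
    ultimately show ?thesis using eqY X1 by (simp add: mult.assoc)
  next
    case X2
    obtain h s where hs: "h \<in> pm.span (range plane_word)" "x2 * plane_word u \<equiv>\<^sub>J h + pm_scale s (plane_word u * x2)"
      using x2_pw by blast
    obtain m' where m': "m' \<in> M \<union> J" "x2 * m \<equiv>\<^sub>J m'" using x2_M[OF m] by blast
    have "plane_word u * (x2 * m) \<equiv>\<^sub>J plane_word u * m'" by (intro eqJ_mult_left m'(2))
    moreover have "plane_word u * m' \<in> Y" using m'(1) pwY JY J_mult(1) by blast
    ultimately have "plane_word u * (x2 * m) \<in> Y" using eqY by blast
    then have "(h + pm_scale s (plane_word u * x2)) * m \<in> Y"
      using spanY[OF hs(1) m] by (simp add: distrib_right mult.assoc Y_add Y_scale)
    then have "x2 * plane_word u * m \<in> Y" using eqY eqJ_mult_right[OF hs(2)] by blast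
    then show ?thesis using X2 by (simp add: mult.assoc)
  qed
  have step: "xx i * y \<in> Y" if "y \<in> Y" for i y
    using that unfolding Y_def
  proof (induction rule: pm.span_induct_alt)
    case (step s x z)
    have "xx i * x \<in> Y"
    proof (cases "x \<in> J")
      case True
      then show ?thesis by (intro JY J_mult(1))
    next
      case False
      then obtain u m where "m \<in> M" "x = plane_word u * m" using step(1) by (auto simp: B_def)
      then show ?thesis using gen by simp
    qed
    then show ?case using step(2) by (simp add: distrib_left Y_add Y_scale flip: Y_def)
  qed (simp add: pm.span_zero)
  have "word w \<in> Y" for w
  proof (induction w)
    case Nil
    have "plane_word [] * 1 \<in> Y" by (rule pwY) (simp add: M_def)
    then show ?case by (simp add: one_word)
  next
    case (Cons i w)
    then show ?case using step[of "word w" i] by simp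
  qed
  then have "t \<in> Y" for t
    by (induction t rule: poly_mapping_lin_induct) (auto intro: Y_0 Y_add Y_scale)
  then have "pm.span (B \<union> J) = UNIV" unfolding Y_def by auto
  then show ?thesis unfolding finite_dimensional_quotient_def using \<open>finite B\<close> by blast
qed

theorem finite_dim_iff: "finite_dimensional_quotient J \<longleftrightarrow> q = 1 \<or> (q ^ 3 = 1 \<and> q \<noteq> 1)"
proof -
  have "finite_dimensional_quotient J \<longleftrightarrow> nilpotent_words"
  proof
    assume "finite_dimensional_quotient J"
    then obtain d where d: "\<And>n. n \<ge> d \<Longrightarrow> homogeneous n \<subseteq> J" using finite_dim_high_degree by blast
    have "shuffle_word u = (\<lambda>v. 0)" if u: "length u \<ge> d" for u
    proof -
      obtain n where "n \<ge> length u" "plane_word u \<in> homogeneous n" using plane_word_homogeneous by blast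
      then have "plane_word u \<in> J" using d[of n] u by auto
      then show ?thesis by (simp add: plane_word_in_J)
    qed
    then show nilpotent_words by (auto simp: nilpotent_words_def)
  next
    assume nilpotent_words
    then show "finite_dimensional_quotient J"
      unfolding nilpotent_words_def using nilpotent_imp_finite_dim by blast
  qed
  then show ?thesis using nilpotent_words_iff[OF two q_nz] by simp
qed

end

theorem theorem6p1:
  fixes p q\<^sub>2\<^sub>2 :: "'k::alg_closed_field"
    and J :: "(basis3, 'k) tensor_algebra set"
  assumes "CHAR('k) = 2"
    and "p \<noteq> 0" and "q\<^sub>2\<^sub>2 \<noteq> 0"
    and "nichols_ideal (endymion p q\<^sub>2\<^sub>2) J"
  shows "finite_dimensional_quotient J \<longleftrightarrow>
    q\<^sub>2\<^sub>2 = 1 \<or> (\<exists>\<omega>. primitive_root_of_unity 3 \<omega> \<and> q\<^sub>2\<^sub>2 = \<omega>)"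
proof -
  have two: "(2 :: 'k) = 0" using of_nat_CHAR[where 'a = 'k] assms(1) by simp
  interpret endymion_nichols p q\<^sub>2\<^sub>2 J
    by unfold_locales (use assms two in auto)
  have "primitive_root_of_unity 3 q\<^sub>2\<^sub>2 \<longleftrightarrow> q\<^sub>2\<^sub>2 ^ 3 = 1 \<and> q\<^sub>2\<^sub>2 \<noteq> 1"
  proof
    assume "primitive_root_of_unity 3 q\<^sub>2\<^sub>2"
    then have "q\<^sub>2\<^sub>2 ^ 3 = 1" "q\<^sub>2\<^sub>2 ^ 1 \<noteq> 1" unfolding primitive_root_of_unity_def by auto
    then show "q\<^sub>2\<^sub>2 ^ 3 = 1 \<and> q\<^sub>2\<^sub>2 \<noteq> 1" by simp
  next
    assume q: "q\<^sub>2\<^sub>2 ^ 3 = 1 \<and> q\<^sub>2\<^sub>2 \<noteq> 1"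
    have "q\<^sub>2\<^sub>2 ^ m \<noteq> 1" if "0 < m" "m < 3" for m
    proof -
      have "m = 1 \<or> m = 2" using that by linarith
      moreover have "q\<^sub>2\<^sub>2 ^ 2 \<noteq> 1"
        using q by (simp add: power2_eq_square power3_eq_cube) (metis mult_1_left)
      ultimately show ?thesis using q by auto
    qed
    then show "primitive_root_of_unity 3 q\<^sub>2\<^sub>2" using q unfolding primitive_root_of_unity_def by simp
  qed
  then show ?thesis using finite_dim_iff by simp
qed

end
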